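(* Let $H\in L^1([0,1]^2)$, $H\ge 0$, have essentially bounded coordinate expectations $CE_1(H)(x)=\int_0^1 H(x,y)\,dy$ and $CE_2(H)(y)=\int_0^1 H(x,y)\,dx$. Let $Z_H$ be the $L^\infty[0,1]$-circular operator with covariance $(\alpha_H,\beta_H)$ and let $D\in L^\infty[0,1]$ be the identity function on $[0,1]$. Then $$\delta_0(Z_H:D)\ \le\ \min\{\,2,\ 1+2\,\mathrm{area}(\mathrm{supp}(H))\,\}.$$
   Context: **Setting.** $(\mathcal{M},\tau)$ is a von Neumann algebra with a normal faithful tracial state. $\mathcal{A}=L^\infty[0,1]\subseteq\mathcal{M}$ is a fixed copy such that $\tau|_{\mathcal{A}}$ is integration against Lebesgue measure. $E:\mathcal{M}\to\mathcal{A}$ is the $\tau$-preserving conditional expectation. $D=D^*\in\mathcal{A}$ corresponds to the function $t\mapsto t$. $Z\in\mathcal{M}$ is a circular element with $\tau(Z)=0$, $\tau(Z^*Z)=1$, and $Z$ is $*$-free from $\mathcal{A}$. **$\mathcal{A}$-circular operators.** An element $a\in\mathcal{M}$ is $\mathcal{A}$-circular (with respect to $E$) with covariance $(\alpha,\beta)$, where $\alpha,\beta:\mathcal{A}\to\mathcal{A}$ are linear maps, if all $\mathcal{A}$-valued (operator-valued free) cumulants of the pair $(a,a^* )$ vanish except those of order two of the form $(a^*,a)$ and $(a,a^* )$, and these are given by $E(a^*fa)=\alpha(f)$ and $E(afa^* )=\beta(f)$ for $f\in\mathcal{A}$. In particular, the joint $*$-distribution of $a$ and $\mathcal{A}$ is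 determined by $(\alpha,\beta)$. For $H\ge0$ in $L^1([0,1]^2)$ with $CE_1(H),CE_2(H)\in L^\infty[0,1]$, $Z_H$ denotes an $\mathcal{A}$-circular operator with covariance $(\alpha_H,\beta_H)$, where $$\alpha_H(f)(x)=\int_0^1 H(t,x)f(t)\,dt,\qquad \beta_H(f)(x)=\int_0^1 H(x,t)f(t)\,dt .$$ Such an operator is known to exist in $W^*(\mathcal{A}\cup\{Z\})$. $\mathrm{supp}(H)=H^{-1}((0,\infty))$ is the measurable support (defined up to null sets), and area is Lebesgue measure on $[0,1]^2$. **Microstates free entropy dimension.** For $A\in M_k(\mathbb{C})$ let $|A|_2=\mathrm{tr}_k(A^*A)^{1/2}$, with $\mathrm{tr}_k$ the normalized trace. For tuples of selfadjoint elements $X=(x_1,\dots,x_n)$ and $W=(w_1,\dots,w_q)$ of a tracial von Neumann algebra, $m,k\in\mathbb{N}$, and $\gamma>0$: $\Gamma(X;m,k,\gamma)$ is the set of $n$-tuples of selfadjoint $k\times k$ matrices whose moments (with respect to $\mathrm{tr}_k$) of all orders up to $m$ are within $\gamma$ of the corresponding moments of $X$. $\Gamma(X:W;m,k,\gamma)$ is the set of $(A_1,\dots,A_n)$ for which there is $(B_1,\dots,B_q)$ with $(A_1,\dots,A_n,B_1,\dots,B_q)\in\Gamma((X,W);m,k,\gamma)$. $\Gamma_R$ is the variant in which all matrices involved are also required to have operator norm at most $R$. Voiculescu's free entropy in the presence of $W$ is $$\chi(X:W)=\sup_{R>0}\inf_{m,\gamma}\limsup_{k\to\infty}\Big(k^{-2}\log\mathrm{vol}(\Gamma_R(X:W;m,k,\gamma))+\tfrac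 n2\log k\Big),$$ with volume with respect to the Euclidean norm $k^{1/2}|\cdot|_2$. The free entropy dimension of $X$ in the presence of $W$ is $$\delta_0(X:W)=n+\limsup_{\epsilon\to0}\frac{\chi(x_1+\epsilon s_1,\dots,x_n+\epsilon s_n:w_1,\dots,w_q,s_1,\dots,s_n)}{|\log\epsilon|},$$ where $\{s_1,\dots,s_n\}$ is a (standard) semicircular family free from $X\cup W$ (enlarging the algebra if necessary). By a known theorem of Jung, equivalently $$\delta_0(X:W)=\limsup_{\epsilon\to0}\frac{\mathbb{P}_\epsilon(X:W)}{|\log\epsilon|},\qquad \mathbb{P}_\epsilon(X:W)=\inf_{m,\gamma}\limsup_{k\to\infty}k^{-2}\log P_\epsilon(\Gamma(X:W;m,k,\gamma)),$$ where $P_\epsilon$ is the $\epsilon$-packing number (the maximal number of disjoint open $\epsilon$-balls) for the metric induced by $|\cdot|_2$. For a non-selfadjoint element $y$, $\delta_0(y:W):=\delta_0(\mathrm{Re}(y),\mathrm{Im}(y):W)$. It is known that this can equivalently be computed by the packing formula with $*$-microstates: $k\times k$ matrices that are not necessarily selfadjoint, with $*$-moments up to order $m$ approximated within $\gamma$. *)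

theory Defs
  imports
    "HOL-Analysis.Analysis"
    "HOL-Library.Poly_Mapping"
    "HOL-Library.Disjoint_Sets"
    "HOL-Library.Nonpos_Ints"
    "Jordan_Normal_Form.Matrix"
begin

section \<open>Operators on a complex Hilbert space\<close>

text \<open>The inner product is conjugate-linear in its first argument; its real part is the real
  inner product of the underlying real Hilbert space, so norm and completeness are inherited.\<close>

class chilbert_space = real_inner + complete_space +
  fixes scaleC :: "complex \<Rightarrow> 'a \<Rightarrow> 'a"  (infixr "*\<^sub>C" 75)
    and cinner :: "'a \<Rightarrow> 'a \<Rightarrow> complex"
  assumes scaleC_add_right: "c *\<^sub>C (x + y) = c *\<^sub>C x + c *\<^sub>C y"
    and scaleC_add_left: "(c + d) *\<^sub>C x = c *\<^sub>C x + d *\<^sub>C x"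
    and scaleC_scaleC: "c *\<^sub>C (d *\<^sub>C x) = (c * d) *\<^sub>C x"
    and scaleR_scaleC: "r *\<^sub>R x = complex_of_real r *\<^sub>C x"
    and cinner_add_right: "cinner x (y + z) = cinner x y + cinner x z"
    and cinner_scaleC_right: "cinner x (c *\<^sub>C y) = c * cinner x y"
    and cinner_commute: "cinner x y = cnj (cinner y x)"
    and inner_cinner: "inner x y = Re (cinner x y)"

definition bounded_op :: "('h::chilbert_space \<Rightarrow> 'h) \<Rightarrow> bool" where
  "bounded_op T \<longleftrightarrow> bounded_linear T \<and> (\<forall>c x. T (c *\<^sub>C x) = c *\<^sub>C T x)"

definition is_adj :: "('h::chilbert_space \<Rightarrow> 'h) \<Rightarrow> ('h \<Rightarrow> 'h) \<Rightarrow> bool" where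
  "is_adj T S \<longleftrightarrow> bounded_op S \<and> (\<forall>x y. cinner (T x) y = cinner x (S y))"

definition adj :: "('h::chilbert_space \<Rightarrow> 'h) \<Rightarrow> ('h \<Rightarrow> 'h)" where
  "adj T = (THE S. is_adj T S)"

definition op_le :: "('h::chilbert_space \<Rightarrow> 'h) \<Rightarrow> ('h \<Rightarrow> 'h) \<Rightarrow> bool" where
  "op_le S T \<longleftrightarrow> (\<forall>x. cinner x (T x - S x) \<in> \<real>\<^sub>\<ge>\<^sub>0)"

definition op_prod :: "('h \<Rightarrow> 'h) list \<Rightarrow> ('h \<Rightarrow> 'h)" where
  "op_prod Ts = foldr (\<circ>) Ts id"

definition op_Re :: "('h::chilbert_space \<Rightarrow> 'h) \<Rightarrow> ('h \<Rightarrow> 'h)" where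
  "op_Re T = (\<lambda>x. (1 / 2) *\<^sub>C (T x + adj T x))"

definition op_Im :: "('h::chilbert_space \<Rightarrow> 'h) \<Rightarrow> ('h \<Rightarrow> 'h)" where
  "op_Im T = (\<lambda>x. (1 / (2 * \<i>)) *\<^sub>C (T x - adj T x))"


section \<open>Tracial von Neumann algebras\<close>

definition commutant :: "('h::chilbert_space \<Rightarrow> 'h) set \<Rightarrow> ('h \<Rightarrow> 'h) set" where
  "commutant S = {T. bounded_op T \<and> (\<forall>s\<in>S. T \<circ> s = s \<circ> T)}"

definition von_neumann_algebra :: "('h::chilbert_space \<Rightarrow> 'h) set \<Rightarrow> bool" where
  "von_neumann_algebra M \<longleftrightarrow>
     (\<forall>T\<in>M. bounded_op T) \<and> (\<forall>T\<in>M. \<exists>S\<in>M. is_adj T S) \<and> commutant (commutant M) = M"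

definition op_linear_on ::
  "('h::chilbert_space \<Rightarrow> 'h) set \<Rightarrow> (('h \<Rightarrow> 'h) \<Rightarrow> ('h \<Rightarrow> 'h)) \<Rightarrow> bool" where
  "op_linear_on M F \<longleftrightarrow>
     (\<forall>S\<in>M. \<forall>T\<in>M. F (\<lambda>x. S x + T x) = (\<lambda>x. F S x + F T x)) \<and>
     (\<forall>c. \<forall>T\<in>M. F (\<lambda>x. c *\<^sub>C T x) = (\<lambda>x. c *\<^sub>C F T x))"

definition op_functional_on ::
  "('h::chilbert_space \<Rightarrow> 'h) set \<Rightarrow> (('h \<Rightarrow> 'h) \<Rightarrow> complex) \<Rightarrow> bool" where
  "op_functional_on M \<phi> \<longleftrightarrow>
     (\<forall>S\<in>M. \<forall>T\<in>M. \<phi> (\<lambda>x. S x + T x) = \<phi> S + \<phi> T) \<and>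
     (\<forall>c. \<forall>T\<in>M. \<phi> (\<lambda>x. c *\<^sub>C T x) = c * \<phi> T)"

definition op_lub_in ::
  "('h::chilbert_space \<Rightarrow> 'h) set \<Rightarrow> ('h \<Rightarrow> 'h) set \<Rightarrow> ('h \<Rightarrow> 'h) \<Rightarrow> bool" where
  "op_lub_in M S u \<longleftrightarrow> u \<in> M \<and> adj u = u \<and> (\<forall>s\<in>S. op_le s u) \<and>
     (\<forall>v\<in>M. adj v = v \<and> (\<forall>s\<in>S. op_le s v) \<longrightarrow> op_le u v)"

text \<open>Normality: suprema of bounded upward directed sets of selfadjoint elements are preserved.
  The inequality \<open>\<tau> s \<le> \<tau> u\<close> is automatic by positivity, so only the other one is demanded.\<close>

definition normal_on ::
  "('h::chilbert_space \<Rightarrow> 'h) set \<Rightarrow> (('h \<Rightarrow> 'h) \<Rightarrow> complex) \<Rightarrow> bool" where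
  "normal_on M \<tau> \<longleftrightarrow>
     (\<forall>S u. S \<noteq> {} \<and> S \<subseteq> M \<and> (\<forall>s\<in>S. adj s = s) \<and>
        (\<forall>s\<in>S. \<forall>t\<in>S. \<exists>r\<in>S. op_le s r \<and> op_le t r) \<and> op_lub_in M S u \<longrightarrow>
        (\<forall>c. (\<forall>s\<in>S. Re (\<tau> s) \<le> c) \<longrightarrow> Re (\<tau> u) \<le> c))"

definition tracial_vN_algebra ::
  "('h::chilbert_space \<Rightarrow> 'h) set \<Rightarrow> (('h \<Rightarrow> 'h) \<Rightarrow> complex) \<Rightarrow> bool" where
  "tracial_vN_algebra M \<tau> \<longleftrightarrow>
     von_neumann_algebra M \<and> op_functional_on M \<tau> \<and> \<tau> id = 1 \<and>
     (\<forall>T\<in>M. \<tau> (adj T \<circ> T) \<in> \<real>\<^sub>\<ge>\<^sub>0) \<and>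
     (\<forall>T\<in>M. \<tau> (adj T \<circ> T) = 0 \<longrightarrow> T = (\<lambda>_. 0)) \<and>
     (\<forall>S\<in>M. \<forall>T\<in>M. \<tau> (S \<circ> T) = \<tau> (T \<circ> S)) \<and>
     normal_on M \<tau>"


section \<open>The copy of \<open>L\<^sup>\<infinity>[0,1]\<close> and the conditional expectation\<close>

text \<open>Elements of \<open>L\<^sup>\<infinity>[0,1]\<close> are represented by functions on the real line, of which only the
  restriction to \<open>[0,1]\<close> matters.\<close>

definition Linf :: "(real \<Rightarrow> complex) set" where
  "Linf = {f. f \<in> borel_measurable (lebesgue_on {0..1}) \<and>
              (\<exists>C. AE t in lebesgue_on {0..1}. norm (f t) \<le> C)}"

text \<open>A unital trace-preserving \<open>*\<close>-homomorphism. As the trace is faithful and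
  \<open>\<tau> (\<iota> (\<bar>f - g\<bar>\<^sup>2)) = \<integral>\<bar>f - g\<bar>\<^sup>2\<close>, \<open>\<iota> f = \<iota> g\<close> holds exactly if \<open>f = g\<close> almost everywhere on
  \<open>[0,1]\<close>: \<open>\<iota>\<close> is well defined on classes and injective, and its image is a von Neumann
  subalgebra.\<close>

definition Linf_copy ::
  "('h::chilbert_space \<Rightarrow> 'h) set \<Rightarrow> (('h \<Rightarrow> 'h) \<Rightarrow> complex) \<Rightarrow>
   ((real \<Rightarrow> complex) \<Rightarrow> ('h \<Rightarrow> 'h)) \<Rightarrow> bool" where
  "Linf_copy M \<tau> \<iota> \<longleftrightarrow>
     (\<forall>f\<in>Linf. \<iota> f \<in> M) \<and>
     (\<forall>f\<in>Linf. \<forall>g\<in>Linf. \<iota> (\<lambda>t. f t + g t) = (\<lambda>x. \<iota> f x + \<iota> g x)) \<and>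
     (\<forall>c. \<forall>f\<in>Linf. \<iota> (\<lambda>t. c * f t) = (\<lambda>x. c *\<^sub>C \<iota> f x)) \<and>
     (\<forall>f\<in>Linf. \<forall>g\<in>Linf. \<iota> (\<lambda>t. f t * g t) = \<iota> f \<circ> \<iota> g) \<and>
     (\<forall>f\<in>Linf. \<iota> (\<lambda>t. cnj (f t)) = adj (\<iota> f)) \<and>
     \<iota> (\<lambda>_. 1) = id \<and>
     (\<forall>f\<in>Linf. \<tau> (\<iota> f) = (\<integral>t. f t \<partial>lebesgue_on {0..1}))"

definition cond_expectation ::
  "('h::chilbert_space \<Rightarrow> 'h) set \<Rightarrow> (('h \<Rightarrow> 'h) \<Rightarrow> complex) \<Rightarrow> ('h \<Rightarrow> 'h) set \<Rightarrow>
   (('h \<Rightarrow> 'h) \<Rightarrow> ('h \<Rightarrow> 'h)) \<Rightarrow> bool" where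
  "cond_expectation M \<tau> A E \<longleftrightarrow>
     (\<forall>T\<in>M. E T \<in> A) \<and> op_linear_on M E \<and> (\<forall>a\<in>A. E a = a) \<and>
     (\<forall>T\<in>M. op_le (\<lambda>_. 0) T \<longrightarrow> op_le (\<lambda>_. 0) (E T)) \<and>
     (\<forall>a\<in>A. \<forall>b\<in>A. \<forall>T\<in>M. E (a \<circ> T \<circ> b) = a \<circ> E T \<circ> b) \<and>
     (\<forall>T\<in>M. \<tau> (E T) = \<tau> T)"


section \<open>Operator-valued free cumulants\<close>

definition noncrossing :: "nat set set \<Rightarrow> bool" where
  "noncrossing P \<longleftrightarrow> (\<forall>U\<in>P. \<forall>V\<in>P. U \<noteq> V \<longrightarrow>
     \<not> (\<exists>a\<in>U. \<exists>b\<in>V. \<exists>c\<in>U. \<exists>d\<in>V. a < b \<and> b < c \<and> c < d))"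

definition NC :: "nat \<Rightarrow> nat set set set" where
  "NC n = {P. partition_on {..<n} P \<and> noncrossing P}"

definition same_block :: "nat set set \<Rightarrow> nat \<Rightarrow> nat set" where
  "same_block P i = {j. j = i \<or> (\<exists>B\<in>P. i \<in> B \<and> j \<in> B)}"

text \<open>The multiplicative extension \<open>\<kappa>\<^sub>\<pi>\<close> of a family \<open>\<kappa>\<close> to a noncrossing partition \<open>P\<close>, read on
  the positions in \<open>I\<close>: if \<open>v\<^sub>1 < \<dots> < v\<^sub>k\<close> is the block of the first position, then
  \<open>\<kappa>\<^sub>\<pi>[x] = \<kappa>\<^sub>k(x\<^bsub>v\<^sub>1\<^esub> g\<^sub>1, \<dots>, x\<^bsub>v\<^sub>k\<^sub>-\<^sub>1\<^esub> g\<^sub>k\<^sub>-\<^sub>1, x\<^bsub>v\<^sub>k\<^esub>) g\<^sub>k\<close>, where \<open>g\<^sub>j\<close> is the value of the part of the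
  partition strictly between \<open>v\<^sub>j\<close> and \<open>v\<^bsub>j+1\<^esub>\<close>, and \<open>g\<^sub>k\<close> that of the part after \<open>v\<^sub>k\<close>.\<close>

function nc_eval ::
  "(('h \<Rightarrow> 'h) list \<Rightarrow> ('h \<Rightarrow> 'h)) \<Rightarrow> (nat \<Rightarrow> ('h \<Rightarrow> 'h)) \<Rightarrow> nat set set \<Rightarrow> nat set \<Rightarrow> ('h \<Rightarrow> 'h)"
where
  "nc_eval \<kappa> x P I =
     (if I = {} \<or> infinite I then id
      else let vs = sorted_list_of_set (I \<inter> same_block P (Min I)) in
        \<kappa> (map (\<lambda>(v, w). x v \<circ> nc_eval \<kappa> x P (I \<inter> {v<..<w})) (zip (butlast vs) (tl vs))
             @ [x (last vs)])
        \<circ> nc_eval \<kappa> x P (I \<inter> {last vs<..}))"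
  by pat_completeness auto
termination
proof (relation "Wellfounded.measure (\<lambda>(_, _, _, I). card I)", goal_cases)
  case 1
  show ?case by simp
next
  case (2 \<kappa> x P I vs)
  have fin: "finite I" and ne: "I \<noteq> {}" using 2(1) by simp_all
  have "Min I \<in> set vs" using 2(2) fin ne by (simp add: same_block_def)
  then have "last vs \<in> set vs" by (intro last_in_set) auto
  then have "last vs \<in> I" using 2(2) fin by simp
  then have "I \<inter> {last vs<..} \<subset> I" by auto
  then show ?case using fin by (simp add: psubset_card_mono)
next
  case (3 \<kappa> x P I vs z vw v w)
  have fin: "finite I" using 3(1) by simp
  have "v \<in> set vs"
    using 3(4,5) by (metis in_set_butlastD set_zip_leftD)
  then have "v \<in> I" using 3(2) fin by simp
  then have "I \<inter> {v<..<w} \<subset> I" by auto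
  then show ?case using fin by (simp add: psubset_card_mono)
qed

declare nc_eval.simps [simp del]

text \<open>The moment-cumulant formula \<open>E(x\<^sub>1\<cdots>x\<^sub>n) = \<Sum>\<^bsub>\<pi>\<in>NC(n)\<^esub> \<kappa>\<^sub>\<pi>[x\<^sub>1,\<dots>,x\<^sub>n]\<close>. The one-block partition
  contributes \<open>\<kappa>\<^sub>n(x\<^sub>1,\<dots>,x\<^sub>n)\<close>, so that the formula determines all cumulants recursively.\<close>

definition free_cumulants ::
  "('h::chilbert_space \<Rightarrow> 'h) set \<Rightarrow> (('h \<Rightarrow> 'h) \<Rightarrow> ('h \<Rightarrow> 'h)) \<Rightarrow>
   (('h \<Rightarrow> 'h) list \<Rightarrow> ('h \<Rightarrow> 'h)) \<Rightarrow> bool" where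
  "free_cumulants M E \<kappa> \<longleftrightarrow>
     (\<forall>xs. xs \<noteq> [] \<and> set xs \<subseteq> M \<longrightarrow>
        E (op_prod xs) =
          (\<lambda>v. \<Sum>P\<in>NC (length xs). nc_eval \<kappa> (\<lambda>i. xs ! i) P {..<length xs} v))"

definition star_letter :: "('h::chilbert_space \<Rightarrow> 'h) \<Rightarrow> bool \<Rightarrow> ('h \<Rightarrow> 'h)" where
  "star_letter a s = (if s then adj a else a)"

text \<open>The covariance maps act on representatives of elements of \<open>L\<^sup>\<infinity>[0,1]\<close>.\<close>

definition A_circular ::
  "('h::chilbert_space \<Rightarrow> 'h) set \<Rightarrow> ((real \<Rightarrow> complex) \<Rightarrow> ('h \<Rightarrow> 'h)) \<Rightarrow>
   (('h \<Rightarrow> 'h) \<Rightarrow> ('h \<Rightarrow> 'h)) \<Rightarrow> ('h \<Rightarrow> 'h) \<Rightarrow>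
   ((real \<Rightarrow> complex) \<Rightarrow> (real \<Rightarrow> complex)) \<Rightarrow> ((real \<Rightarrow> complex) \<Rightarrow> (real \<Rightarrow> complex)) \<Rightarrow> bool"
where
  "A_circular M \<iota> E a \<alpha> \<beta> \<longleftrightarrow> a \<in> M \<and>
     (\<exists>\<kappa>. free_cumulants M E \<kappa> \<and>
        (\<forall>ps. ps \<noteq> [] \<and> snd ` set ps \<subseteq> Linf \<and>
              map fst ps \<noteq> [True, False] \<and> map fst ps \<noteq> [False, True] \<longrightarrow>
              \<kappa> (map (\<lambda>(s, f). star_letter a s \<circ> \<iota> f) ps) = (\<lambda>_. 0))) \<and>
     (\<forall>f\<in>Linf. E (adj a \<circ> \<iota> f \<circ> a) = \<iota> (\<alpha> f)) \<and>
     (\<forall>f\<in>Linf. E (a \<circ> \<iota> f \<circ> adj a) = \<iota> (\<beta> f))"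

definition alpha :: "(real \<times> real \<Rightarrow> real) \<Rightarrow> (real \<Rightarrow> complex) \<Rightarrow> (real \<Rightarrow> complex)" where
  "alpha H f = (\<lambda>x. \<integral>t. complex_of_real (H (t, x)) * f t \<partial>lebesgue_on {0..1})"

definition beta :: "(real \<times> real \<Rightarrow> real) \<Rightarrow> (real \<Rightarrow> complex) \<Rightarrow> (real \<Rightarrow> complex)" where
  "beta H f = (\<lambda>x. \<integral>t. complex_of_real (H (x, t)) * f t \<partial>lebesgue_on {0..1})"

definition CE1 :: "(real \<times> real \<Rightarrow> real) \<Rightarrow> real \<Rightarrow> real" where
  "CE1 H x = (\<integral>y. H (x, y) \<partial>lebesgue_on {0..1})"

definition CE2 :: "(real \<times> real \<Rightarrow> real) \<Rightarrow> real \<Rightarrow> real" where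
  "CE2 H y = (\<integral>x. H (x, y) \<partial>lebesgue_on {0..1})"

definition ess_bounded :: "(real \<Rightarrow> real) \<Rightarrow> bool" where
  "ess_bounded g \<longleftrightarrow> (\<exists>C. AE t in lebesgue_on {0..1}. \<bar>g t\<bar> \<le> C)"

definition supp :: "(real \<times> real \<Rightarrow> real) \<Rightarrow> (real \<times> real) set" where
  "supp H = {p \<in> {0..1} \<times> {0..1}. 0 < H p}"


section \<open>Matricial microstates and free entropy\<close>

text \<open>A law is a family of moments indexed by words in the letters \<open>0, 1, 2, \<dots>\<close>. For an \<open>n\<close>-tuple
  \<open>X\<close> and a \<open>q\<close>-tuple \<open>W\<close>, the letters below \<open>n\<close> stand for the elements of \<open>X\<close> and the letters from
  \<open>n\<close> to \<open>n + q - 1\<close> for those of \<open>W\<close>.\<close>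

type_synonym law = "nat list \<Rightarrow> complex"

definition law_of :: "(('h \<Rightarrow> 'h) \<Rightarrow> complex) \<Rightarrow> ('h \<Rightarrow> 'h) list \<Rightarrow> law" where
  "law_of \<tau> xs w = \<tau> (op_prod (map (\<lambda>i. xs ! i) w))"

definition tr :: "nat \<Rightarrow> complex mat \<Rightarrow> complex" where
  "tr k A = (\<Sum>i<k. A $$ (i, i)) / of_nat k"

definition selfadjoint_mat :: "nat \<Rightarrow> complex mat \<Rightarrow> bool" where
  "selfadjoint_mat k A \<longleftrightarrow>
     A \<in> carrier_mat k k \<and> (\<forall>i<k. \<forall>j<k. A $$ (j, i) = cnj (A $$ (i, j)))"

definition opnorm_le :: "nat \<Rightarrow> complex mat \<Rightarrow> real \<Rightarrow> bool" where
  "opnorm_le k A R \<longleftrightarrow> (\<forall>v\<in>carrier_vec k.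
     sqrt (\<Sum>i<k. (cmod (vec_index (A *\<^sub>v v) i))\<^sup>2) \<le> R * sqrt (\<Sum>i<k. (cmod (vec_index v i))\<^sup>2))"

text \<open>Microstates for an \<open>N\<close>-tuple with law \<open>\<mu>\<close>, with cutoff \<open>R\<close> on the operator norms.\<close>

definition microstates ::
  "nat \<Rightarrow> law \<Rightarrow> real \<Rightarrow> nat \<Rightarrow> nat \<Rightarrow> real \<Rightarrow> complex mat list set" where
  "microstates N \<mu> R m k \<gamma> =
     {As. length As = N \<and> (\<forall>A\<in>set As. selfadjoint_mat k A \<and> opnorm_le k A R) \<and>
        (\<forall>w. set w \<subseteq> {..<N} \<and> length w \<le> m \<longrightarrow>
           cmod (tr k (foldr (*) (map (\<lambda>i. As ! i) w) (1\<^sub>m k)) - \<mu> w) < \<gamma>)}"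

text \<open>The set \<open>\<Gamma>\<^sub>R(X : W; m, k, \<gamma>)\<close>.\<close>

definition microstates_pres ::
  "nat \<Rightarrow> nat \<Rightarrow> law \<Rightarrow> real \<Rightarrow> nat \<Rightarrow> nat \<Rightarrow> real \<Rightarrow> complex mat list set" where
  "microstates_pres n q \<mu> R m k \<gamma> =
     {As. length As = n \<and> (\<exists>Bs. length Bs = q \<and> As @ Bs \<in> microstates (n + q) \<mu> R m k \<gamma>)}"

text \<open>Coordinates of a selfadjoint matrix in a basis that is orthonormal for the norm
  \<open>k\<^sup>1\<^sup>/\<^sup>2 \<bar>A\<bar>\<^sub>2 = (Tr A\<^sup>2)\<^sup>1\<^sup>/\<^sup>2\<close>, i.e. \<open>Tr A\<^sup>2 = \<Sum>\<^sub>i\<^sub>j c(i,j)\<^sup>2\<close>. Volume is therefore Lebesgue measure in these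
  coordinates.\<close>

definition sa_mat :: "nat \<Rightarrow> (nat \<times> nat \<Rightarrow> real) \<Rightarrow> complex mat" where
  "sa_mat k c = mat k k (\<lambda>(i, j).
     if i = j then complex_of_real (c (i, i))
     else if i < j then Complex (c (i, j) / sqrt 2) (c (j, i) / sqrt 2)
     else Complex (c (j, i) / sqrt 2) (- (c (i, j) / sqrt 2)))"

definition mat_vol :: "nat \<Rightarrow> nat \<Rightarrow> complex mat list set \<Rightarrow> ennreal" where
  "mat_vol n k G =
     (let V = (\<Pi>\<^sub>M p\<in>{..<n} \<times> ({..<k} \<times> {..<k}). (lborel :: real measure)) in
      emeasure V {c \<in> space V. map (\<lambda>l. sa_mat k (\<lambda>p. c (l, p))) [0..<n] \<in> G})"

definition elog :: "ennreal \<Rightarrow> ereal" where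
  "elog v = (if v = 0 then -\<infinity> else if v = \<infinity> then \<infinity> else ereal (ln (enn2real v)))"

definition chi :: "nat \<Rightarrow> nat \<Rightarrow> law \<Rightarrow> ereal" where
  "chi n q \<mu> = (SUP R\<in>{0<..}. INF m. INF \<gamma>\<in>{0<..}.
     limsup (\<lambda>k. ereal (1 / (real k)\<^sup>2) * elog (mat_vol n k (microstates_pres n q \<mu> R m k \<gamma>))
                 + ereal (real n / 2 * ln (real k))))"


section \<open>Free entropy dimension\<close>

text \<open>The noncommutative polynomials form the monoid algebra of the free monoid of words.\<close>

instantiation list :: (type) monoid_add
begin

definition zero_list :: "'a list" where "0 = []"
definition plus_list :: "'a list \<Rightarrow> 'a list \<Rightarrow> 'a list" where "xs + ys = xs @ ys"

instance by standard (simp_all add: zero_list_def plus_list_def)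

end

type_synonym ncpoly = "nat list \<Rightarrow>\<^sub>0 complex"

definition letter :: "nat \<Rightarrow> ncpoly" where
  "letter i = Poly_Mapping.single [i] 1"

definition law_lin :: "law \<Rightarrow> ncpoly \<Rightarrow> complex" where
  "law_lin \<nu> p = (\<Sum>w\<in>Poly_Mapping.keys p. Poly_Mapping.lookup p w * \<nu> w)"

definition polys_in :: "nat set \<Rightarrow> ncpoly set" where
  "polys_in L = {p. \<forall>w\<in>Poly_Mapping.keys p. set w \<subseteq> L}"

definition free_family :: "law \<Rightarrow> nat set \<Rightarrow> (nat \<Rightarrow> ncpoly set) \<Rightarrow> bool" where
  "free_family \<nu> J B \<longleftrightarrow>
     (\<forall>ps. ps \<noteq> [] \<and> (\<forall>(j, p)\<in>set ps. j \<in> J \<and> p \<in> B j \<and> law_lin \<nu> p = 0) \<and>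
           distinct_adj (map fst ps) \<longrightarrow>
           law_lin \<nu> (prod_list (map snd ps)) = 0)"

definition semicircular :: "law \<Rightarrow> nat \<Rightarrow> bool" where
  "semicircular \<nu> i \<longleftrightarrow> (\<forall>m. \<nu> (replicate m i) =
     complex_of_real (integral {-2..2} (\<lambda>t. t ^ m * (sqrt (4 - t\<^sup>2) / (2 * pi)))))"

text \<open>\<open>\<nu>\<close> is a joint law of \<open>(X, W, s\<^sub>1, \<dots>, s\<^sub>n)\<close> in an enlargement of the noncommutative
  probability space generated by \<open>(X, W)\<close>, the letter of \<open>s\<^sub>i\<close> being \<open>n + q + i\<close> (\<open>i\<close> counted from
  0): the \<open>s\<^sub>i\<close> are free standard semicircular elements, free from \<open>X \<union> W\<close>.\<close>

definition semicircular_extension :: "nat \<Rightarrow> nat \<Rightarrow> law \<Rightarrow> law \<Rightarrow> bool" where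
  "semicircular_extension n q \<mu> \<nu> \<longleftrightarrow>
     (\<forall>w. set w \<subseteq> {..<n + q} \<longrightarrow> \<nu> w = \<mu> w) \<and>
     (\<forall>i<n. semicircular \<nu> (n + q + i)) \<and>
     free_family \<nu> {..n} (\<lambda>j. if j = 0 then polys_in {..<n + q} else polys_in {n + q + (j - 1)})"

text \<open>The law of \<open>(x\<^sub>1 + \<epsilon> s\<^sub>1, \<dots>, x\<^sub>n + \<epsilon> s\<^sub>n, w\<^sub>1, \<dots>, w\<^sub>q, s\<^sub>1, \<dots>, s\<^sub>n)\<close>.\<close>

definition perturbed_law :: "nat \<Rightarrow> nat \<Rightarrow> real \<Rightarrow> law \<Rightarrow> law" where
  "perturbed_law n q \<epsilon> \<nu> w = law_lin \<nu> (prod_list (map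
     (\<lambda>i. if i < n then letter i + Poly_Mapping.single [n + q + i] (complex_of_real \<epsilon>)
          else letter i) w))"

text \<open>Freeness determines \<open>\<nu>\<close> on all words in the letters that matter (and \<open>\<nu>\<close> exists by the free
  product construction), so the supremum is over a single value; it only serves to speak of the
  value at the law \<open>\<nu>\<close>.\<close>

definition delta0_law :: "nat \<Rightarrow> nat \<Rightarrow> law \<Rightarrow> ereal" where
  "delta0_law n q \<mu> = (SUP \<nu>\<in>{\<nu>. semicircular_extension n q \<mu> \<nu>}.
     ereal (real n) +
     Limsup (at_right 0) (\<lambda>\<epsilon>. chi n (q + n) (perturbed_law n q \<epsilon> \<nu>) / ereal \<bar>ln \<epsilon>\<bar>))"

definition delta0 ::
  "(('h \<Rightarrow> 'h) \<Rightarrow> complex) \<Rightarrow> ('h \<Rightarrow> 'h) list \<Rightarrow> ('h \<Rightarrow> 'h) list \<Rightarrow> ereal" where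
  "delta0 \<tau> X W = delta0_law (length X) (length W) (law_of \<tau> (X @ W))"

definition delta0_nonsa ::
  "(('h::chilbert_space \<Rightarrow> 'h) \<Rightarrow> complex) \<Rightarrow> ('h \<Rightarrow> 'h) \<Rightarrow> ('h \<Rightarrow> 'h) list \<Rightarrow> ereal" where
  "delta0_nonsa \<tau> y W = delta0 \<tau> [op_Re y, op_Im y] W"

end

theory Submission
  imports Defs "HOL-Probability.Probability" "Jordan_Normal_Form.Spectral_Radius"
begin

text \<open>Diagonalize a microstate of \<open>D\<close> by a unitary \<open>U\<close>. In that basis a microstate \<open>A\<close> of
  \<open>Z\<^sub>H + \<epsilon>(s\<^sub>1 + i s\<^sub>2)\<close> is within \<open>O(\<epsilon>)\<close>, in the normalized Hilbert-Schmidt norm, of a coordinate subspace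
  indexed by some \<open>K \<subseteq> [k]\<^sup>2\<close> with \<open>card K \<le> (area(supp H) + \<eta>) k\<^sup>2\<close>: a continuous function vanishing on
  most of \<open>supp H\<close> and equal to one off a neighbourhood of it can be tested against the eigenvalues of
  \<open>D\<close>, because \<open>\<tau>(f(D) Z\<^sub>H g(D) Z\<^sub>H\<^sup>*) = \<integral>\<integral> f(x) g(y) H(x, y)\<close>. Covering \<open>U(k)\<close> costs
  \<open>(C/\<epsilon>)\<close> to the power \<open>k\<^sup>2\<close>, covering the subspace \<open>(C/\<epsilon>)\<close> to the power \<open>2 card K\<close>, and the choice of \<open>K\<close>
  only \<open>2\<close> to the power \<open>k\<^sup>2\<close>. Multiplied by the volume of an \<open>\<epsilon>\<close>-ball in real dimension \<open>2k\<^sup>2\<close>, this bounds \<open>\<chi>\<close>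
  by \<open>C + (2 area(supp H) + \<eta> - 1) \<bar>log \<epsilon>\<bar>\<close>. Covering by one ball gives the bound \<open>2\<close>.\<close>

section \<open>Volume and packing in finite coordinate spaces\<close>

text \<open>Two points shape the estimate. First, \<open>chi\<close> is evaluated at one \<epsilon>
  at a time, so the test function on the square, and with it the order \<open>m\<close> and the
  tolerance \<open>\<gamma>\<close>, may depend on \<epsilon>; only the additive constant in the
  bound for \<open>chi\<close> may not. Hence the test function is chosen with integral at most
  \<epsilon>^2 against \<open>H\<close>, which makes the part of a microstate outside K of order
  \<epsilon> and not merely small. Second, the entropy concerns the perturbed tuple. The
  semicircular elements belong to the tuple in whose presence \<open>chi\<close> is taken, so every
  microstate comes with matrices for them; subtracting \<epsilon> times these matrices gives a
  microstate of the unperturbed tuple. The exponent of 1/\<epsilon> is k^2 for U(k), plus 2 (area +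
  small) k^2 for the subspace, minus 2 k^2 for the volume of a ball; the summand n = 2 of
  \<open>delta0_law\<close> turns the resulting 2 area - 1 into 2 area + 1. Counting U(k) with all 2
  k^2 real coordinates of a matrix would lose exactly 1.\<close>

lemma emeasure_PiM_lborel_affine:
  fixes t :: "'i \<Rightarrow> real"
  assumes I: "finite I" and s: "s > 0" and B: "B \<in> sets (PiM I (\<lambda>_. lborel))"
  shows "emeasure (PiM I (\<lambda>_. lborel)) B =
    ennreal (s ^ card I) *
      emeasure (PiM I (\<lambda>_. lborel)) ((\<lambda>c. \<lambda>i\<in>I. t i + s * c i) -` B \<inter> space (PiM I (\<lambda>_. lborel)))"
proof -
  interpret product_sigma_finite "\<lambda>_::'i. lborel :: real measure" ..
  let ?P = "PiM I (\<lambda>_. lborel :: real measure)"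
  let ?T = "\<lambda>c. \<lambda>i\<in>I. t i + s * c i"
  have T[measurable]: "?T \<in> measurable ?P ?P"
    by (intro measurable_restrict) (auto intro!: borel_measurable_add borel_measurable_times
        measurable_component_singleton[THEN measurable_compose])
  \<comment> \<open>A measure on a finite product is determined by its values on boxes, where the
    one-dimensional substitution applies factor by factor.\<close>
  have "?P = scale_measure (ennreal (s ^ card I)) (distr ?P ?P ?T)"
  proof (rule PiM_eqI[OF I, symmetric])
    fix A :: "'i \<Rightarrow> real set" assume A: "\<And>i. i \<in> I \<Longrightarrow> A i \<in> sets lborel"
    have vim: "?T -` Pi\<^sub>E I A \<inter> space ?P = Pi\<^sub>E I (\<lambda>i. (\<lambda>x. t i + s * x) -` A i)"
      by (auto simp: space_PiM PiE_iff)
    have ms: "(\<lambda>x. t i + s * x) -` A i \<in> sets lborel" if "i \<in> I" for i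
      using measurable_sets[of "\<lambda>x. t i + s * x" borel borel "A i"] A[OF that] by simp
    have one: "emeasure lborel (A i) = ennreal s * emeasure lborel ((\<lambda>x. t i + s * x) -` A i)"
      if "i \<in> I" for i
      using A[OF that] s
      by (subst lborel_real_affine[of s "t i"])
        (auto simp: emeasure_density_const emeasure_distr)
    have Am: "Pi\<^sub>E I A \<in> sets ?P" using A I by (intro sets_PiM_I_finite) auto
    have "emeasure (scale_measure (ennreal (s ^ card I)) (distr ?P ?P ?T)) (Pi\<^sub>E I A)
      = ennreal (s ^ card I) * emeasure ?P (Pi\<^sub>E I (\<lambda>i. (\<lambda>x. t i + s * x) -` A i))"
      using Am by (simp add: emeasure_distr vim)
    also have "\<dots> = (\<Prod>i\<in>I. ennreal s * emeasure lborel ((\<lambda>x. t i + s * x) -` A i))"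
      using ms I s by (subst emeasure_PiM) (auto simp: prod.distrib ennreal_power)
    also have "\<dots> = (\<Prod>i\<in>I. emeasure lborel (A i))"
      using one by simp
    finally show "emeasure (scale_measure (ennreal (s ^ card I)) (distr ?P ?P ?T)) (Pi\<^sub>E I A)
      = (\<Prod>i\<in>I. emeasure lborel (A i))" .
  qed simp_all
  then have "emeasure ?P B = emeasure (scale_measure (ennreal (s ^ card I)) (distr ?P ?P ?T)) B"
    by metis
  also have "\<dots> = ennreal (s ^ card I) * emeasure ?P (?T -` B \<inter> space ?P)"
    using B by (simp add: emeasure_distr)
  finally show ?thesis .
qed

text \<open>Discretization replaces continuity: rounding the coordinates down to a grid of mesh
  1/(n+1) factors \<open>N\<close> through the countable set of integer points, on which every
  function is measurable, and the Lipschitz bound gives pointwise convergence to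
  \<open>N\<close>.\<close>

lemma borel_measurable_PiM_Lipschitz:
  fixes N :: "('i \<Rightarrow> real) \<Rightarrow> real"
  assumes I: "finite I"
    and lip: "\<And>c c'. c \<in> extensional I \<Longrightarrow> c' \<in> extensional I \<Longrightarrow> \<bar>N c - N c'\<bar> \<le> L * (\<Sum>i\<in>I. \<bar>c i - c' i\<bar>)"
  shows "N \<in> borel_measurable (PiM I (\<lambda>_. lborel))"
proof -
  let ?P = "PiM I (\<lambda>_. lborel :: real measure)"
  define g where "g n c = (\<lambda>i\<in>I. real_of_int \<lfloor>real (Suc n) * c i\<rfloor> / real (Suc n))" for n and c :: "'i \<Rightarrow> real"
  let ?Z = "Pi\<^sub>E I (\<lambda>_. UNIV :: int set)"
  have cZ: "countable ?Z" using I by (intro countable_PiE) auto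
  have meas: "(\<lambda>c. N (g n c)) \<in> borel_measurable ?P" for n
  proof -
    let ?f = "\<lambda>c::'i \<Rightarrow> real. \<lambda>i\<in>I. \<lfloor>real (Suc n) * c i\<rfloor>"
    have f: "?f \<in> measurable ?P (count_space ?Z)"
    proof (rule measurable_count_space_eq_countable[THEN iffD2, OF cZ], intro conjI ballI)
      show "?f \<in> space ?P \<rightarrow> ?Z" by auto
      fix z assume z: "z \<in> ?Z"
      have "?f -` {z} \<inter> space ?P = Pi\<^sub>E I (\<lambda>i. {x. \<lfloor>real (Suc n) * x\<rfloor> = z i})"
        using z by (auto simp: space_PiM PiE_iff extensional_def restrict_def fun_eq_iff)
      also have "\<dots> \<in> sets ?P"
      proof (intro sets_PiM_I_finite[OF I])
        fix i
        have "(\<lambda>x. \<lfloor>real (Suc n) * x\<rfloor>) \<in> measurable borel (count_space UNIV)" by measurable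
        from measurable_sets[OF this, of "{z i}"]
        show "{x. \<lfloor>real (Suc n) * x\<rfloor> = z i} \<in> sets lborel" by (simp add: vimage_def)
      qed
      finally show "?f -` {z} \<inter> space ?P \<in> sets ?P" .
    qed
    have "(\<lambda>z. N (\<lambda>i\<in>I. real_of_int (z i) / real (Suc n))) \<in> measurable (count_space ?Z) borel" by simp
    from measurable_compose[OF f this]
    show ?thesis by (simp add: g_def restrict_def cong: if_cong)
  qed
  show ?thesis
  proof (rule borel_measurable_LIMSEQ_real[OF _ meas])
    fix c assume "c \<in> space ?P"
    then have c: "c \<in> extensional I" by (simp add: space_PiM PiE_iff)
    have b: "\<bar>N (g n c) - N c\<bar> \<le> \<bar>L\<bar> * real (card I) * inverse (real (Suc n))" for n
    proof -
      have *: "\<bar>g n c i - c i\<bar> \<le> inverse (real (Suc n))" if "i \<in> I" for i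
      proof -
        let ?m = "real (Suc n)"
        have m: "?m > 0" by simp
        have "g n c i - c i = (real_of_int \<lfloor>?m * c i\<rfloor> - ?m * c i) / ?m"
          using that m by (simp add: g_def field_simps)
        also have "\<bar>\<dots>\<bar> \<le> 1 / ?m"
          using m by (simp only: abs_divide) (intro divide_mono; linarith)
        finally show ?thesis by (simp add: inverse_eq_divide)
      qed
      have "\<bar>N (g n c) - N c\<bar> \<le> L * (\<Sum>i\<in>I. \<bar>g n c i - c i\<bar>)"
        using lip[of "g n c" c] c by (simp add: g_def)
      also have "\<dots> \<le> \<bar>L\<bar> * (\<Sum>i\<in>I. \<bar>g n c i - c i\<bar>)"
        by (intro mult_right_mono sum_nonneg) auto
      also have "\<dots> \<le> \<bar>L\<bar> * (\<Sum>i\<in>I. inverse (real (Suc n)))"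
        using * by (intro mult_left_mono sum_mono) auto
      finally show ?thesis by simp
    qed
    show "(\<lambda>n. N (g n c)) \<longlonglongrightarrow> N c"
    proof (rule LIM_zero_cancel, rule Lim_null_comparison)
      show "\<forall>\<^sub>F n in sequentially. norm (N (g n c) - N c) \<le> \<bar>L\<bar> * real (card I) * inverse (real (Suc n))"
        using b by (auto intro: always_eventually)
      show "(\<lambda>n. \<bar>L\<bar> * real (card I) * inverse (real (Suc n))) \<longlonglongrightarrow> 0"
        using tendsto_mult_left[OF LIMSEQ_inverse_real_of_nat, of "\<bar>L\<bar> * real (card I)"] by simp
    qed
  qed
qed

text \<open>The norm is a locale parameter and not a type class, because the Hilbert-Schmidt norm
  and the operator norm are both needed on one type of matrices. Assumption \<open>coord\<close>
  makes the vectors \<open>b i\<close> independent and bounds the unit ball in coordinates, which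
  keeps its volume finite.\<close>

locale coord_norm =
  fixes I :: "'i set" and b :: "'i \<Rightarrow> 'v::real_vector" and q :: "'v \<Rightarrow> real" and L :: real
  assumes fin: "finite I"
    and tri: "q (x + y) \<le> q x + q y"
    and scl: "q (r *\<^sub>R x) = \<bar>r\<bar> * q x"
    and coord: "i \<in> I \<Longrightarrow> \<bar>c i\<bar> \<le> L * q (\<Sum>i\<in>I. c i *\<^sub>R b i)"
begin

definition lc :: "('i \<Rightarrow> real) \<Rightarrow> 'v" where "lc c = (\<Sum>i\<in>I. c i *\<^sub>R b i)"

abbreviation "V \<equiv> PiM I (\<lambda>_. lborel :: real measure)"

lemma q0: "q 0 = 0" using scl[of 0 0] by simp

lemma q_minus: "q (- x) = q x" using scl[of "-1" x] by simp

lemma q_nonneg: "q x \<ge> 0"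
  using tri[of x "-x"] by (simp add: q_minus q0)

lemma q_diff: "\<bar>q x - q y\<bar> \<le> q (x - y)"
  using tri[of "x - y" y] tri[of "y - x" x] q_minus[of "x - y"] by simp

lemma q_sum: "finite J \<Longrightarrow> q (\<Sum>j\<in>J. f j) \<le> (\<Sum>j\<in>J. q (f j))"
  by (induction J rule: finite_induct) (auto simp: q0 intro: order_trans[OF tri])

lemma lc_affine: "lc (\<lambda>i\<in>I. t i + s * c i) = lc t + s *\<^sub>R lc c"
  by (simp add: lc_def scaleR_add_left sum.distrib scaleR_sum_right)

lemma q_lc_le: "q (lc c) \<le> (\<Sum>i\<in>I. q (b i)) * (\<Sum>i\<in>I. \<bar>c i\<bar>)"
proof -
  have "q (lc c) \<le> (\<Sum>i\<in>I. \<bar>c i\<bar> * q (b i))"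
    unfolding lc_def using q_sum[OF fin, of "\<lambda>i. c i *\<^sub>R b i"] by (simp add: scl)
  also have "\<dots> \<le> (\<Sum>i\<in>I. \<bar>c i\<bar> * (\<Sum>i\<in>I. q (b i)))"
    using fin q_nonneg by (intro sum_mono mult_left_mono member_le_sum) auto
  finally show ?thesis by (simp add: sum_distrib_right mult.commute)
qed

lemma lc_diff: "lc c - lc c' = lc (\<lambda>i. c i - c' i)"
  by (simp add: lc_def scaleR_diff_left sum_subtractf)

lemma meas: "(\<lambda>c. q (lc c - x)) \<in> borel_measurable V"
proof (rule borel_measurable_PiM_Lipschitz[OF fin])
  fix c c' :: "'i \<Rightarrow> real"
  have "\<bar>q (lc c - x) - q (lc c' - x)\<bar> \<le> q (lc (\<lambda>i. c i - c' i))"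
    using q_diff[of "lc c - x" "lc c' - x"] by (simp add: lc_diff)
  then show "\<bar>q (lc c - x) - q (lc c' - x)\<bar> \<le> (\<Sum>i\<in>I. q (b i)) * (\<Sum>i\<in>I. \<bar>c i - c' i\<bar>)"
    using q_lc_le order_trans by blast
qed

definition qball :: "'v \<Rightarrow> real \<Rightarrow> ('i \<Rightarrow> real) set" where
  "qball x r = {c \<in> space V. q (lc c - x) < r}"

lemma qball_sets[measurable]: "qball x r \<in> sets V"
  unfolding qball_def using meas[of x] by measurable

text \<open>Translation by the coordinates t and scaling by r carry the unit ball to this ball;
  hence the form \<open>lc t\<close> of the centre.\<close>

lemma emeasure_qball:
  assumes "r > 0"
  shows "emeasure V (qball (lc t) r) = ennreal (r ^ card I) * emeasure V (qball 0 1)"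
proof -
  have "(\<lambda>c. \<lambda>i\<in>I. t i + r * c i) -` qball (lc t) r \<inter> space V = qball 0 1"
    using assms by (auto simp: qball_def lc_affine scl space_PiM)
  then show ?thesis
    by (subst emeasure_PiM_lborel_affine[OF fin assms qball_sets, where t = t]) simp
qed

lemma qball_pos: "emeasure V (qball 0 1) > 0"
proof -
  interpret product_sigma_finite "\<lambda>_::'i. lborel :: real measure" ..
  let ?S = "(\<Sum>i\<in>I. q (b i)) * real (card I)"
  have S: "?S \<ge> 0" using q_nonneg by (intro mult_nonneg_nonneg sum_nonneg) auto
  define r where "r = 1 / (1 + ?S)"
  have r: "r > 0" "?S * r < 1" using S by (auto simp: r_def field_simps)
  let ?B = "Pi\<^sub>E I (\<lambda>_. {-r..r})"
  have "?B \<subseteq> qball 0 1"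
  proof
    fix c assume c: "c \<in> ?B"
    have "(\<Sum>i\<in>I. \<bar>c i\<bar>) \<le> (\<Sum>i\<in>I. r)"
      using c by (intro sum_mono) (auto simp: PiE_iff abs_le_iff; force)
    then have "(\<Sum>i\<in>I. q (b i)) * (\<Sum>i\<in>I. \<bar>c i\<bar>) \<le> (\<Sum>i\<in>I. q (b i)) * (real (card I) * r)"
      using q_nonneg by (intro mult_left_mono sum_nonneg) auto
    from order_trans[OF q_lc_le this]
    have "q (lc c) \<le> (\<Sum>i\<in>I. q (b i)) * (real (card I) * r)" .
    also have "\<dots> < 1" using r by (simp add: mult.assoc)
    finally show "c \<in> qball 0 1" using c by (auto simp: qball_def space_PiM PiE_iff)
  qed
  then have "emeasure V ?B \<le> emeasure V (qball 0 1)" by (intro emeasure_mono) auto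
  moreover have "emeasure V ?B > 0"
  proof -
    have "emeasure V ?B = (\<Prod>i\<in>I. ennreal (2 * r))"
      using fin r by (subst emeasure_PiM) auto
    also have "\<dots> > 0" using r
      by (simp add: ennreal_power)
    finally show ?thesis .
  qed
  ultimately show ?thesis by order
qed

lemma qball_fin: "emeasure V (qball 0 1) < \<infinity>"
proof -
  interpret product_sigma_finite "\<lambda>_::'i. lborel :: real measure" ..
  let ?B = "Pi\<^sub>E I (\<lambda>_. {-\<bar>L\<bar>..\<bar>L\<bar>})"
  have "qball 0 1 \<subseteq> ?B"
  proof
    fix c assume c: "c \<in> qball 0 1"
    then have 1: "q (lc c) < 1" by (simp add: qball_def)
    have "\<bar>c i\<bar> \<le> \<bar>L\<bar>" if "i \<in> I" for i
    proof -
      have "\<bar>c i\<bar> \<le> L * q (lc c)" using coord[OF that, of c] by (simp add: lc_def)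
      also have "\<dots> \<le> \<bar>L\<bar> * 1" using 1 q_nonneg by (intro mult_mono) auto
      finally show ?thesis by simp
    qed
    then show "c \<in> ?B" using c by (force simp: qball_def space_PiM PiE_iff abs_le_iff)
  qed
  then have "emeasure V (qball 0 1) \<le> emeasure V ?B"
    by (intro emeasure_mono sets_PiM_I_finite fin) auto
  also have "\<dots> = (\<Prod>i\<in>I. ennreal (2 * \<bar>L\<bar>))"
    using fin by (subst emeasure_PiM) auto
  also have "\<dots> < \<infinity>" by (simp add: ennreal_power power_less_top_ennreal flip: ennreal_mult)
  finally show ?thesis .
qed

text \<open>Balls of radius \<delta>/2 about \<delta>-separated points are disjoint and lie in the
  ball of radius \<rho> + \<delta>/2. The volume of the unit ball cancels, so only the real
  dimension \<open>card I\<close> remains, whatever the norm.\<close>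

theorem packing:
  assumes F: "finite F" "F \<subseteq> range lc" and \<delta>: "\<delta> > 0" and \<rho>: "\<rho> \<ge> 0"
    and bd: "\<And>x. x \<in> F \<Longrightarrow> q x \<le> \<rho>"
    and sep: "\<And>x y. x \<in> F \<Longrightarrow> y \<in> F \<Longrightarrow> x \<noteq> y \<Longrightarrow> q (x - y) \<ge> \<delta>"
  shows "real (card F) \<le> (1 + 2 * \<rho> / \<delta>) ^ card I"
proof -
  let ?v = "measure V (qball 0 1)"
  have v: "emeasure V (qball 0 1) = ennreal ?v" "?v > 0"
    using qball_pos qball_fin by (auto simp: measure_def enn2real_positive_iff)
  have dj: "disjoint_family_on (\<lambda>x. qball x (\<delta>/2)) F"
  proof (unfold disjoint_family_on_def, intro ballI impI equals0I)
    fix x y c assume xy: "x \<in> F" "y \<in> F" "x \<noteq> y" "c \<in> qball x (\<delta> / 2) \<inter> qball y (\<delta> / 2)"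
    then have "q (lc c - x) < \<delta>/2" "q (lc c - y) < \<delta>/2" by (auto simp: qball_def)
    moreover have "q (x - y) \<le> q (x - lc c) + q (lc c - y)" using tri[of "x - lc c" "lc c - y"] by simp
    ultimately show False using sep[OF xy(1-3)] q_minus[of "lc c - x"] by simp
  qed
  have e: "emeasure V (qball x r) = ennreal (r ^ card I * ?v)" if "x \<in> range lc" "r > 0" for x r
    using emeasure_qball[OF that(2)] that v by (auto simp: ennreal_mult)
  have "ennreal (real (card F) * ((\<delta>/2) ^ card I * ?v)) = (\<Sum>x\<in>F. emeasure V (qball x (\<delta>/2)))"
    using e \<delta> F v by (subst sum.cong[OF refl e]) (auto simp: ennreal_of_nat_eq_real_of_nat ennreal_mult)
  also have "\<dots> = emeasure V (\<Union>x\<in>F. qball x (\<delta>/2))"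
    using F dj by (intro sum_emeasure) auto
  also have "\<dots> \<le> emeasure V (qball 0 (\<rho> + \<delta>/2))"
  proof (intro emeasure_mono qball_sets UN_least subsetI)
    fix x c assume "x \<in> F" "c \<in> qball x (\<delta>/2)"
    then show "c \<in> qball 0 (\<rho> + \<delta>/2)"
      using tri[of "lc c - x" x] bd[of x] by (auto simp: qball_def)
  qed
  also have "\<dots> = ennreal ((\<rho> + \<delta>/2) ^ card I * ?v)"
  proof (rule e)
    show "0 \<in> range lc" by (rule image_eqI[of _ _ "\<lambda>_. 0"]) (auto simp: lc_def)
  qed (use \<delta> \<rho> in auto)
  finally have "real (card F) * ((\<delta>/2) ^ card I * ?v) \<le> (\<rho> + \<delta>/2) ^ card I * ?v"
    using v \<delta> \<rho> by (subst (asm) ennreal_le_iff) auto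
  then have "real (card F) * (\<delta>/2) ^ card I \<le> (\<rho> + \<delta>/2) ^ card I"
    using v(2) by (simp flip: mult.assoc)
  then have "real (card F) \<le> ((\<rho> + \<delta>/2) / (\<delta>/2)) ^ card I"
    unfolding power_divide[of "\<rho> + \<delta>/2"] using \<delta> by (subst pos_le_divide_eq) auto
  also have "(\<rho> + \<delta>/2) / (\<delta>/2) = 1 + 2 * \<rho> / \<delta>" using \<delta> by (simp add: field_simps)
  finally show ?thesis .
qed

end

section \<open>Volume of Euclidean balls and maximal separated sets\<close>

lemma emeasure_PiM_ball_le:
  fixes a :: "'i \<Rightarrow> real"
  assumes I: "finite I" "I \<noteq> {}" and r: "r > 0"
  shows "emeasure (PiM I (\<lambda>_. lborel)) {c \<in> space (PiM I (\<lambda>_. lborel)). (\<Sum>i\<in>I. (c i - a i)\<^sup>2) \<le> r\<^sup>2}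
     \<le> ennreal ((exp (1/2) * sqrt (2 * pi * (r\<^sup>2 / real (card I)))) ^ card I)"
proof -
  interpret product_sigma_finite "\<lambda>_::'i. lborel :: real measure" ..
  let ?P = "PiM I (\<lambda>_. lborel :: real measure)"
  let ?d = "real (card I)"
  have d: "?d > 0" using I by (simp add: card_gt_0_iff)
  \<comment> \<open>The indicator of the ball is dominated by a multiple of a Gaussian density of
    variance r^2/d per coordinate: times the d-th power of \<open>K\<close>, the density is exp (d/2
    - |c - a|^2 / (2 s^2)), which is at least 1 on the ball because d s^2 = r^2. This gives the
    right decay in d without the Gamma function.\<close>
  define s where "s = r / sqrt ?d"
  have s: "s > 0" "s\<^sup>2 = r\<^sup>2 / ?d" using r d by (auto simp: s_def power_divide)
  define K where "K = exp (1/2) * sqrt (2 * pi * s\<^sup>2)"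
  have K: "K > 0" unfolding K_def using s(1) by (intro mult_pos_pos) (auto intro!: mult_pos_pos)
  let ?S = "{c \<in> space ?P. (\<Sum>i\<in>I. (c i - a i)\<^sup>2) \<le> r\<^sup>2}"
  have S: "?S \<in> sets ?P" by measurable
  have pt: "indicator ?S c \<le> (\<Prod>i\<in>I. ennreal (K * normal_density (a i) s (c i)))" for c
  proof (cases "c \<in> ?S")
    case True
    have f: "K * normal_density (a i) s x = exp (1/2 - (x - a i)\<^sup>2 / (2 * s\<^sup>2))" for i x
      using s(1) by (simp add: K_def normal_density_def flip: exp_add)
    have "(\<Prod>i\<in>I. ennreal (K * normal_density (a i) s (c i)))
       = ennreal (exp (\<Sum>i\<in>I. 1/2 - (c i - a i)\<^sup>2 / (2 * s\<^sup>2)))"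
      unfolding f by (subst prod_ennreal) (auto simp: exp_sum I)
    moreover have "(\<Sum>i\<in>I. 1/2 - (c i - a i)\<^sup>2 / (2 * s\<^sup>2)) \<ge> 0"
    proof -
      have "(\<Sum>i\<in>I. 1/2 - (c i - a i)\<^sup>2 / (2 * s\<^sup>2)) = ?d / 2 - (\<Sum>i\<in>I. (c i - a i)\<^sup>2) / (2 * s\<^sup>2)"
        by (simp add: sum_subtractf sum_divide_distrib)
      also have "\<dots> \<ge> ?d / 2 - r\<^sup>2 / (2 * s\<^sup>2)"
        using True s by (intro diff_left_mono divide_right_mono) auto
      also have "?d / 2 - r\<^sup>2 / (2 * s\<^sup>2) = 0" using s d r by (simp add: field_simps)
      finally show ?thesis .
    qed
    ultimately show ?thesis using True by simp
  qed simp
  have "emeasure ?P ?S = (\<integral>\<^sup>+c. indicator ?S c \<partial>?P)" using S by simp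
  also have "\<dots> \<le> (\<integral>\<^sup>+c. (\<Prod>i\<in>I. ennreal (K * normal_density (a i) s (c i))) \<partial>?P)"
    using pt by (intro nn_integral_mono)
  also have "\<dots> = (\<Prod>i\<in>I. (\<integral>\<^sup>+x. ennreal (K * normal_density (a i) s x) \<partial>lborel))"
    using I by (intro product_nn_integral_prod) auto
  also have "\<dots> = (\<Prod>i\<in>I. ennreal K)"
  proof (rule prod.cong[OF refl])
    fix i
    have "(\<integral>\<^sup>+x. ennreal (K * normal_density (a i) s x) \<partial>lborel)
      = ennreal K * (\<integral>\<^sup>+x. ennreal (normal_density (a i) s x) \<partial>lborel)"
      using K by (subst nn_integral_cmult[symmetric]) (auto simp: ennreal_mult)
    also have "(\<integral>\<^sup>+x. ennreal (normal_density (a i) s x) \<partial>lborel) = 1"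
      using s by (simp add: nn_integral_eq_integral integrable_normal_density integral_normal_density)
    finally show "(\<integral>\<^sup>+x. ennreal (K * normal_density (a i) s x) \<partial>lborel) = ennreal K" by simp
  qed
  also have "\<dots> = ennreal (K ^ card I)" using K by (simp add: ennreal_power)
  finally show ?thesis unfolding K_def s(2) .
qed

text \<open>A separated set of largest cardinality covers, since an uncovered point could be added
  to it. The alternative \<open>x = y\<close> is stated because nothing is assumed about
  \<open>d x x\<close>.\<close>

lemma ex_maximal_separated:
  assumes bd: "\<And>F. finite F \<Longrightarrow> F \<subseteq> S \<Longrightarrow> (\<forall>x\<in>F. \<forall>y\<in>F. x \<noteq> y \<longrightarrow> \<delta> \<le> d x y) \<Longrightarrow> real (card F) \<le> m"
    and sym: "\<And>x y. d x y = d y x"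
  shows "\<exists>F. finite F \<and> F \<subseteq> S \<and> real (card F) \<le> m \<and> (\<forall>x\<in>S. \<exists>y\<in>F. x = y \<or> d x y < (\<delta>::real))"
proof -
  let ?Q = "\<lambda>F. finite F \<and> F \<subseteq> S \<and> (\<forall>x\<in>F. \<forall>y\<in>F. x \<noteq> y \<longrightarrow> \<delta> \<le> d x y)"
  have "card F < Suc (nat \<lfloor>m\<rfloor>)" if "?Q F" for F
    using bd[of F] that by (simp add: less_Suc_eq_le le_nat_floor)
  then have "\<exists>F. ?Q F \<and> (\<forall>G. ?Q G \<longrightarrow> card G \<le> card F)"
    by (intro ex_has_greatest_nat[of ?Q "{}" card "Suc (nat \<lfloor>m\<rfloor>)"]) auto
  then obtain F where F: "?Q F" and mx: "\<And>G. ?Q G \<Longrightarrow> card G \<le> card F"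
    by (elim exE conjE) simp
  have "\<exists>y\<in>F. x = y \<or> d x y < \<delta>" if x: "x \<in> S" for x
  proof (rule ccontr)
    assume "\<not> ?thesis"
    then have n: "x \<notin> F" "\<And>y. y \<in> F \<Longrightarrow> \<delta> \<le> d x y" by force+
    then have n': "\<And>y. y \<in> F \<Longrightarrow> \<delta> \<le> d y x" by (subst sym)
    have "?Q (insert x F)" using F x n n' by simp
    then have "card (insert x F) \<le> card F" by (rule mx)
    moreover have "card (insert x F) = Suc (card F)"
      using conjunct1[OF F] n(1) by (rule card_insert_disjoint)
    ultimately show False by linarith
  qed
  moreover have "real (card F) \<le> m" using F by (intro bd) simp_all
  ultimately show ?thesis using F by (intro exI[of _ F] conjI ballI) simp_all
qed

section \<open>Finitely supported matrices\<close>

text \<open>One type for matrices of all sizes: the size k of the microstates tends to infinity,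
  while rings and norms are type classes. A k x k matrix is an element with \<open>bd k\<close>,
  supported in the upper left corner, and \<open>idm k\<close> acts as the unit there.\<close>

typedef fmat = "{f :: nat \<times> nat \<Rightarrow> complex. finite {p. f p \<noteq> 0}}"
  by (rule exI[of _ "\<lambda>_. 0"]) simp

setup_lifting type_definition_fmat

lift_definition ent :: "fmat \<Rightarrow> nat \<Rightarrow> nat \<Rightarrow> complex" is "\<lambda>f i j. f (i, j)" .

lemma fmat_eqI: "(\<And>i j. ent A i j = ent B i j) \<Longrightarrow> A = B"
  by transfer (auto simp: fun_eq_iff)

definition bd :: "nat \<Rightarrow> fmat \<Rightarrow> bool" where
  "bd n A \<longleftrightarrow> (\<forall>i j. n \<le> i \<or> n \<le> j \<longrightarrow> ent A i j = 0)"

lemma bdD: "bd n A \<Longrightarrow> n \<le> i \<or> n \<le> j \<Longrightarrow> ent A i j = 0"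
  by (auto simp: bd_def)

lemma ex_bd: "\<exists>n0. \<forall>n\<ge>n0. bd n A"
proof -
  have f: "finite {p. ent A (fst p) (snd p) \<noteq> 0}" (is "finite ?S") by transfer simp
  then obtain n where n: "\<And>p. p \<in> ?S \<Longrightarrow> fst p < n \<and> snd p < n"
    using finite_nat_set_iff_bounded[of "fst ` ?S \<union> snd ` ?S"] by auto
  have "bd m A" if "m \<ge> n" for m
    unfolding bd_def using n that by (metis (mono_tags, lifting) fst_conv le_trans linorder_not_le mem_Collect_eq snd_conv)
  then show ?thesis by blast
qed

lemma eventually_bd: "eventually (\<lambda>n. bd n A) sequentially"
  using ex_bd[of A] by (simp add: eventually_sequentially)

lift_definition fmat_of :: "nat \<Rightarrow> (nat \<Rightarrow> nat \<Rightarrow> complex) \<Rightarrow> fmat" is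
  "\<lambda>n f (i, j). if i < n \<and> j < n then f i j else 0"
  subgoal for n f
    by (rule finite_subset[of _ "{..<n} \<times> {..<n}"]) (auto split: if_splits)
  done

lemma ent_fmat_of: "ent (fmat_of n f) i j = (if i < n \<and> j < n then f i j else 0)"
  by transfer simp

lemma bd_fmat_of [simp]: "bd n (fmat_of n f)"
  by (auto simp: bd_def ent_fmat_of)

instantiation fmat :: ab_group_add
begin
lift_definition zero_fmat :: fmat is "\<lambda>_. 0" by simp
lift_definition plus_fmat :: "fmat \<Rightarrow> fmat \<Rightarrow> fmat" is "\<lambda>f g p. f p + g p"
  subgoal for f g
    by (rule finite_subset[of _ "{p. f p \<noteq> 0} \<union> {p. g p \<noteq> 0}"]) auto
  done
lift_definition minus_fmat :: "fmat \<Rightarrow> fmat \<Rightarrow> fmat" is "\<lambda>f g p. f p - g p"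
  subgoal for f g
    by (rule finite_subset[of _ "{p. f p \<noteq> 0} \<union> {p. g p \<noteq> 0}"]) auto
  done
lift_definition uminus_fmat :: "fmat \<Rightarrow> fmat" is "\<lambda>f p. - f p" by simp
instance by standard (transfer; simp add: fun_eq_iff algebra_simps)+
end

lift_definition cscale :: "complex \<Rightarrow> fmat \<Rightarrow> fmat" is "\<lambda>c f p. c * f p"
  subgoal for c f by (rule finite_subset[of _ "{p. f p \<noteq> 0}"]) auto
  done

lift_definition adj_fmat :: "fmat \<Rightarrow> fmat" is "\<lambda>f (i, j). cnj (f (j, i))"
  subgoal for f by (rule finite_subset[of _ "prod.swap ` {p. f p \<noteq> 0}"]) force+
  done

lemma ent_simps [simp]: "ent 0 i j = 0" "ent (A + B) i j = ent A i j + ent B i j"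
  "ent (A - B) i j = ent A i j - ent B i j" "ent (- A) i j = - ent A i j"
  "ent (cscale c A) i j = c * ent A i j" "ent (adj_fmat A) i j = cnj (ent A j i)"
  by (transfer; simp)+

lemma ent_sum: "ent (\<Sum>x\<in>S. f x) i j = (\<Sum>x\<in>S. ent (f x) i j)"
  by (induction S rule: infinite_finite_induct) auto

instantiation fmat :: ring
begin
lift_definition times_fmat :: "fmat \<Rightarrow> fmat \<Rightarrow> fmat" is
  "\<lambda>f g (i, j). \<Sum>l\<in>{l. f (i, l) \<noteq> 0}. f (i, l) * g (l, j)"
  subgoal premises prems for f g
  proof (rule finite_subset)
    show "{p. (case p of (i, j) \<Rightarrow> \<Sum>l\<in>{l. f (i, l) \<noteq> 0}. f (i, l) * g (l, j)) \<noteq> 0}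
      \<subseteq> fst ` {p. f p \<noteq> 0} \<times> snd ` {p. g p \<noteq> 0}"
      by (auto elim!: sum.not_neutral_contains_not_neutral intro: rev_image_eqI)
  qed (use prems in auto)
  done

lemma ent_times_raw: "ent (A * B) i j = (\<Sum>l\<in>{l. ent A i l \<noteq> 0}. ent A i l * ent B l j)"
  by transfer simp

lemma ent_times: "bd n A \<Longrightarrow> ent (A * B) i j = (\<Sum>l<n. ent A i l * ent B l j)"
  unfolding ent_times_raw by (rule sum.mono_neutral_left) (auto simp: bd_def not_le[symmetric])

instance
proof
  fix A B C :: fmat
  have "eventually (\<lambda>n. bd n A \<and> bd n B \<and> bd n (A * B) \<and> bd n (A + B)) sequentially"
    by (intro eventually_conj eventually_bd)
  then obtain n where n: "bd n A" "bd n B" "bd n (A * B)" "bd n (A + B)"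
    using eventually_happens'[OF sequentially_bot] by blast
  show "A * B * C = A * (B * C)"
  proof (rule fmat_eqI)
    fix i j
    have "ent (A * B * C) i j = (\<Sum>l<n. \<Sum>m<n. ent A i m * ent B m l * ent C l j)"
      by (simp add: ent_times[OF n(3)] ent_times[OF n(1)] sum_distrib_right)
    also have "\<dots> = (\<Sum>m<n. \<Sum>l<n. ent A i m * ent B m l * ent C l j)"
      by (rule sum.swap)
    also have "\<dots> = ent (A * (B * C)) i j"
      by (simp add: ent_times[OF n(2)] ent_times[OF n(1)] sum_distrib_left mult.assoc)
    finally show "ent (A * B * C) i j = ent (A * (B * C)) i j" .
  qed
  show "(A + B) * C = A * C + B * C"
    by (rule fmat_eqI) (simp add: ent_times[OF n(4)] ent_times[OF n(1)] ent_times[OF n(2)] distrib_right sum.distrib)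
  show "A * (B + C) = A * B + A * C"
    by (rule fmat_eqI) (simp add: ent_times[OF n(1)] ent_times[OF n(2)] distrib_left sum.distrib)
qed
end

lemma ex_bd2: obtains n where "bd n A" "bd n B"
  using eventually_happens'[OF sequentially_bot eventually_conj[OF eventually_bd[of A] eventually_bd[of B]]]
  by blast

lemma bd_0 [simp]: "bd n 0" by (simp add: bd_def)
lemma bd_add: "bd n A \<Longrightarrow> bd n B \<Longrightarrow> bd n (A + B)" by (auto simp: bd_def)
lemma bd_diff: "bd n A \<Longrightarrow> bd n B \<Longrightarrow> bd n (A - B)" by (auto simp: bd_def)
lemma bd_cscale: "bd n A \<Longrightarrow> bd n (cscale c A)" by (auto simp: bd_def)
lemma bd_adj: "bd n A \<Longrightarrow> bd n (adj_fmat A)" by (auto simp: bd_def)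
lemma bd_mult: "bd n A \<Longrightarrow> bd n B \<Longrightarrow> bd n (A * B)"
  unfolding bd_def[of n "A * B"] by (auto simp: ent_times bdD)

lemma adj_adj [simp]: "adj_fmat (adj_fmat A) = A" by (rule fmat_eqI) simp
lemma adj_add: "adj_fmat (A + B) = adj_fmat A + adj_fmat B" by (rule fmat_eqI) simp
lemma adj_diff: "adj_fmat (A - B) = adj_fmat A - adj_fmat B" by (rule fmat_eqI) simp
lemma adj_cscale: "adj_fmat (cscale c A) = cscale (cnj c) (adj_fmat A)" by (rule fmat_eqI) simp
lemma adj_mult: "adj_fmat (A * B) = adj_fmat B * adj_fmat A"
proof -
  obtain n where n: "bd n A" "bd n B" by (rule ex_bd2)
  show ?thesis
    by (rule fmat_eqI)
      (simp add: ent_times[OF n(1)] ent_times[OF bd_adj[OF n(2)]] cnj_sum mult.commute)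
qed

lemma cscale_mult_left: "cscale c A * B = cscale c (A * B)"
proof -
  obtain n where n: "bd n A" "bd n B" by (rule ex_bd2)
  show ?thesis
    by (rule fmat_eqI) (simp add: ent_times[OF n(1)] ent_times[OF bd_cscale[OF n(1)]] sum_distrib_left mult.assoc)
qed

lemma cscale_mult_right: "A * cscale c B = cscale c (A * B)"
proof -
  obtain n where n: "bd n A" "bd n B" by (rule ex_bd2)
  show ?thesis
    by (rule fmat_eqI) (simp add: ent_times[OF n(1)] sum_distrib_left mult.left_commute)
qed

lemma cscale_simps: "cscale c (A + B) = cscale c A + cscale c B" "cscale c (A - B) = cscale c A - cscale c B"
  "cscale (c + d) A = cscale c A + cscale d A" "cscale c (cscale d A) = cscale (c * d) A"
  "cscale 1 A = A" "cscale 0 A = 0" "cscale (- c) A = - cscale c A"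
  by (rule fmat_eqI, simp add: algebra_simps)+

section \<open>The trace, the Hilbert-Schmidt norm and the operator norm\<close>

definition ftr :: "fmat \<Rightarrow> complex" where
  "ftr A = (\<Sum>i\<in>{i. ent A i i \<noteq> 0}. ent A i i)"

lemma ftr_bd: "bd n A \<Longrightarrow> ftr A = (\<Sum>i<n. ent A i i)"
  unfolding ftr_def by (rule sum.mono_neutral_left) (auto simp: bd_def not_le[symmetric])

lemma ftr_add: "ftr (A + B) = ftr A + ftr B"
proof -
  obtain n where n: "bd n A" "bd n B" by (rule ex_bd2)
  show ?thesis by (simp add: ftr_bd[OF n(1)] ftr_bd[OF n(2)] ftr_bd[OF bd_add[OF n]] sum.distrib)
qed

lemma ftr_cscale: "ftr (cscale c A) = c * ftr A"
proof -
  obtain n where n: "bd n A" "bd n A" by (rule ex_bd2)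
  show ?thesis by (simp add: ftr_bd[OF n(1)] ftr_bd[OF bd_cscale[OF n(1)]] sum_distrib_left)
qed

lemma ftr_commute: "ftr (A * B) = ftr (B * A)"
proof -
  obtain n where n: "bd n A" "bd n B" by (rule ex_bd2)
  show ?thesis
    by (simp add: ftr_bd[OF bd_mult[OF n]] ftr_bd[OF bd_mult[OF n(2,1)]] ent_times[OF n(1)] ent_times[OF n(2)])
      (subst sum.swap, simp add: mult.commute)
qed

text \<open>The norm is the unnormalized Hilbert-Schmidt norm, which is k^(1/2) times |A|_2 on k x k
  matrices, the Euclidean norm in which \<open>chi\<close> measures volume.\<close>

instantiation fmat :: real_normed_algebra
begin
definition "scaleR r A = cscale (complex_of_real r) A"
definition "norm A = L2_set (\<lambda>p. cmod (ent A (fst p) (snd p))) {p. ent A (fst p) (snd p) \<noteq> 0}"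
definition "dist A B = norm (A - B :: fmat)"
definition "sgn A = scaleR (inverse (norm A)) (A :: fmat)"
definition "uniformity = (INF e\<in>{0 <..}. principal {(x, y). dist (x::fmat) y < e})"
definition "open U = (\<forall>x\<in>U. eventually (\<lambda>(x', y). x' = x \<longrightarrow> y \<in> U) (uniformity :: (fmat \<times> fmat) filter))"

lemma norm_fmat_bd: "bd n A \<Longrightarrow> norm A = L2_set (\<lambda>p. cmod (ent A (fst p) (snd p))) ({..<n} \<times> {..<n})"
  unfolding norm_fmat_def L2_set_def
  by (rule arg_cong[where f = sqrt], rule sum.mono_neutral_left)
    (auto simp: bd_def not_le[symmetric])

lemma norm_sq_bd: "bd n A \<Longrightarrow> (norm A)\<^sup>2 = (\<Sum>i<n. \<Sum>j<n. (cmod (ent A i j))\<^sup>2)"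
  by (simp add: norm_fmat_bd L2_set_def sum_nonneg sum.cartesian_product split_beta)

instance
proof
  fix A B C :: fmat and r s :: real
  show "r *\<^sub>R (A + B) = r *\<^sub>R A + r *\<^sub>R B" "(r + s) *\<^sub>R A = r *\<^sub>R A + s *\<^sub>R A"
    "r *\<^sub>R s *\<^sub>R A = (r * s) *\<^sub>R A" "1 *\<^sub>R A = A"
    by (simp_all add: scaleR_fmat_def cscale_simps)
  show "r *\<^sub>R A * B = r *\<^sub>R (A * B)" "A * r *\<^sub>R B = r *\<^sub>R (A * B)"
    by (simp_all add: scaleR_fmat_def cscale_mult_left cscale_mult_right)
  obtain n where n: "bd n A" "bd n B" by (rule ex_bd2)
  show "(norm A = 0) = (A = 0)"
  proof
    assume "norm A = 0"
    then have z: "\<forall>p\<in>{..<n} \<times> {..<n}. cmod (ent A (fst p) (snd p)) = 0"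
      using n(1) by (simp add: norm_fmat_bd L2_set_eq_0_iff)
    have "ent A i j = 0" for i j
      using z bdD[OF n(1), of i j] by (cases "i < n \<and> j < n") (auto simp: not_less)
    then show "A = 0" by (intro fmat_eqI) simp
  qed (use n in \<open>simp add: norm_fmat_bd L2_set_eq_0_iff\<close>)
  show "norm (A + B) \<le> norm A + norm B"
    unfolding norm_fmat_bd[OF bd_add[OF n]] norm_fmat_bd[OF n(1)] norm_fmat_bd[OF n(2)]
    by (rule order_trans[OF L2_set_mono L2_set_triangle_ineq]; simp add: norm_triangle_ineq)
  show "norm (r *\<^sub>R A) = \<bar>r\<bar> * norm A"
    unfolding scaleR_fmat_def norm_fmat_bd[OF bd_cscale[OF n(1)]] norm_fmat_bd[OF n(1)]
    by (simp add: norm_mult L2_set_right_distrib)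
  show "norm (A * B) \<le> norm A * norm B"
  proof -
    have "(norm (A * B))\<^sup>2 = (\<Sum>i<n. \<Sum>j<n. (cmod (\<Sum>l<n. ent A i l * ent B l j))\<^sup>2)"
      by (simp only: norm_sq_bd[OF bd_mult[OF n]] ent_times[OF n(1)])
    also have "\<dots> \<le> (\<Sum>i<n. \<Sum>j<n. (\<Sum>l<n. (cmod (ent A i l))\<^sup>2) * (\<Sum>l<n. (cmod (ent B l j))\<^sup>2))"
    proof (intro sum_mono)
      fix i j
      have "(cmod (\<Sum>l<n. ent A i l * ent B l j))\<^sup>2 \<le> (\<Sum>l<n. cmod (ent A i l) * cmod (ent B l j))\<^sup>2"
        by (intro power_mono order_trans[OF norm_sum]) (simp_all add: norm_mult)
      also have "\<dots> \<le> (\<Sum>l<n. (cmod (ent A i l))\<^sup>2) * (\<Sum>l<n. (cmod (ent B l j))\<^sup>2)"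
        by (rule Cauchy_Schwarz_ineq_sum)
      finally show "(cmod (\<Sum>l<n. ent A i l * ent B l j))\<^sup>2 \<le> \<dots>" .
    qed
    also have "\<dots> = (norm A)\<^sup>2 * (\<Sum>j<n. \<Sum>l<n. (cmod (ent B l j))\<^sup>2)"
      by (simp only: norm_sq_bd[OF n(1)] sum_product)
    also have "(\<Sum>j<n. \<Sum>l<n. (cmod (ent B l j))\<^sup>2) = (norm B)\<^sup>2"
      by (subst sum.swap) (simp only: norm_sq_bd[OF n(2)])
    finally show ?thesis
      unfolding power_mult_distrib[symmetric]
      by (rule power2_le_imp_le) (simp add: norm_fmat_bd[OF n(1)] norm_fmat_bd[OF n(2)])
  qed
qed (rule dist_fmat_def open_fmat_def uniformity_fmat_def sgn_fmat_def)+
end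

lemma norm_entry_le: "cmod (ent A i j) \<le> norm A"
proof -
  have "eventually (\<lambda>n. bd n A \<and> i < n \<and> j < n) sequentially"
    by (intro eventually_conj eventually_bd eventually_gt_at_top)
  then obtain n where n: "bd n A" "i < n" "j < n"
    using eventually_happens'[OF sequentially_bot] by blast
  then show ?thesis
    using member_le_L2_set[of "{..<n} \<times> {..<n}" "(i, j)" "\<lambda>p. cmod (ent A (fst p) (snd p))"]
    by (simp add: norm_fmat_bd)
qed

lemma norm_sq_ftr: "complex_of_real ((norm A)\<^sup>2) = ftr (adj_fmat A * A)"
proof -
  obtain n where n: "bd n A" "bd n A" by (rule ex_bd2)
  have "complex_of_real ((norm A)\<^sup>2) = (\<Sum>i<n. \<Sum>j<n. complex_of_real ((cmod (ent A i j))\<^sup>2))"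
    by (simp only: norm_sq_bd[OF n(1)] of_real_sum)
  also have "\<dots> = (\<Sum>j<n. \<Sum>i<n. cnj (ent A i j) * ent A i j)"
    unfolding complex_norm_square by (subst sum.swap) (simp add: mult.commute)
  also have "\<dots> = ftr (adj_fmat A * A)"
    using n by (simp add: ftr_bd[OF bd_mult[OF bd_adj]] ent_times[OF bd_adj])
  finally show ?thesis .
qed

lemma norm_adj [simp]: "norm (adj_fmat A) = norm A"
proof -
  have "complex_of_real ((norm (adj_fmat A))\<^sup>2) = complex_of_real ((norm A)\<^sup>2)"
    by (simp only: norm_sq_ftr adj_adj ftr_commute[of A])
  then show ?thesis by (simp only: of_real_eq_iff power2_eq_iff_nonneg norm_ge_zero)
qed

lemma norm_ftr_le: "cmod (ftr (adj_fmat A * B)) \<le> norm A * norm B"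
proof -
  obtain n where n: "bd n A" "bd n B" by (rule ex_bd2)
  have "cmod (ftr (adj_fmat A * B)) = cmod (\<Sum>p\<in>{..<n}\<times>{..<n}. cnj (ent A (snd p) (fst p)) * ent B (snd p) (fst p))"
    using n by (simp add: ftr_bd[OF bd_mult[OF bd_adj]] ent_times[OF bd_adj] sum.cartesian_product split_beta)
  also have "\<dots> \<le> (\<Sum>p\<in>{..<n}\<times>{..<n}. \<bar>cmod (ent A (snd p) (fst p))\<bar> * \<bar>cmod (ent B (snd p) (fst p))\<bar>)"
    by (rule order_trans[OF norm_sum]) (simp add: norm_mult)
  also have "\<dots> \<le> L2_set (\<lambda>p. cmod (ent A (snd p) (fst p))) ({..<n}\<times>{..<n}) * L2_set (\<lambda>p. cmod (ent B (snd p) (fst p))) ({..<n}\<times>{..<n})"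
    by (rule L2_set_mult_ineq)
  also have "\<dots> = norm (adj_fmat A) * norm (adj_fmat B)"
    using n by (simp del: norm_adj add: norm_fmat_bd[OF bd_adj])
  finally show ?thesis by simp
qed

text \<open>The usual operator norm: left multiplication acts on the columns of X separately, so its
  norm with respect to the Hilbert-Schmidt norm is the norm on column vectors.\<close>

definition opn :: "fmat \<Rightarrow> real" where "opn A = onorm (\<lambda>X. A * X)"

lemma norm_mult_opn: "norm (A * X) \<le> opn A * norm X"
  unfolding opn_def by (rule onorm[OF bounded_linear_mult_right])

lemma opn_le: "0 \<le> c \<Longrightarrow> (\<And>X. norm (A * X) \<le> c * norm X) \<Longrightarrow> opn A \<le> c"
  unfolding opn_def by (rule onorm_bound)

lemma opn_nonneg [simp]: "0 \<le> opn A"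
  unfolding opn_def by (rule onorm_pos_le[OF bounded_linear_mult_right])

lemma opn_triangle: "opn (A + B) \<le> opn A + opn B"
  by (rule opn_le) (auto simp: distrib_right intro: order_trans[OF norm_triangle_ineq] add_mono norm_mult_opn)

lemma opn_scaleR: "opn (r *\<^sub>R A) = \<bar>r\<bar> * opn A"
proof -
  have "(\<lambda>X. (r *\<^sub>R A) * X) = (\<lambda>X. r *\<^sub>R (A * X))" by simp
  then show ?thesis
    unfolding opn_def using onorm_scaleR[OF bounded_linear_mult_right[of A], of r] by metis
qed

lemma opn_mult: "opn (A * B) \<le> opn A * opn B"
proof (rule opn_le)
  fix X
  have "norm (A * B * X) \<le> opn A * norm (B * X)" by (simp add: mult.assoc norm_mult_opn)
  also have "\<dots> \<le> opn A * (opn B * norm X)" by (intro mult_left_mono norm_mult_opn) simp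
  finally show "norm (A * B * X) \<le> opn A * opn B * norm X" by (simp add: mult.assoc)
qed simp

text \<open>With Y = A^* X, the squared norm of Y is the trace of X^* A Y; Cauchy-Schwarz bounds it
  by \<open>norm X * (opn A * norm Y)\<close>, and one factor \<open>norm Y\<close> cancels.\<close>

lemma opn_adj_le: "opn (adj_fmat A) \<le> opn A"
proof (rule opn_le)
  fix X
  let ?Y = "adj_fmat A * X"
  have "(norm ?Y)\<^sup>2 = cmod (ftr (adj_fmat X * (A * ?Y)))"
    unfolding arg_cong[OF norm_sq_ftr, of cmod ?Y, unfolded norm_of_real, symmetric]
    using arg_cong[OF norm_sq_ftr[of ?Y], of cmod] by (simp add: adj_mult mult.assoc del: of_real_power)
  also have "\<dots> \<le> norm X * norm (A * ?Y)" by (rule norm_ftr_le)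
  also have "\<dots> \<le> norm X * (opn A * norm ?Y)" by (intro mult_left_mono norm_mult_opn) simp
  finally have "norm ?Y * norm ?Y \<le> (opn A * norm X) * norm ?Y" by (simp add: power2_eq_square mult_ac)
  then show "norm ?Y \<le> opn A * norm X"
    by (cases "norm ?Y = 0") auto
qed simp

lemma opn_adj [simp]: "opn (adj_fmat A) = opn A"
  using opn_adj_le[of A] opn_adj_le[of "adj_fmat A"] by simp

lemma norm_mult_opn_right: "norm (X * A) \<le> norm X * opn A"
proof -
  have "norm (X * A) = norm (adj_fmat A * adj_fmat X)"
    using norm_adj[of "X * A"] by (simp only: adj_mult)
  also have "\<dots> \<le> opn (adj_fmat A) * norm (adj_fmat X)" by (rule norm_mult_opn)
  also have "\<dots> = norm X * opn A" by (simp only: opn_adj norm_adj mult.commute)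
  finally show ?thesis .
qed

lemma opn_minus: "opn (- A) = opn A" using opn_scaleR[of "-1" A] by simp

lemma opn_diff: "opn (A - B) \<le> opn A + opn B"
  using opn_triangle[of A "- B"] by (simp add: opn_minus)

lemma opn_diff_commute: "opn (A - B) = opn (B - A)"
  using opn_minus[of "A - B"] by simp

definition idm :: "nat \<Rightarrow> fmat" where "idm k = fmat_of k (\<lambda>i j. if i = j then 1 else 0)"

lemma bd_idm [simp]: "bd k (idm k)" by (simp add: idm_def)
lemma adj_idm [simp]: "adj_fmat (idm k) = idm k" by (rule fmat_eqI) (auto simp: idm_def ent_fmat_of)

lemma ent_idm: "ent (idm k) i j = (if i = j \<and> i < k then 1 else 0)"
  by (simp add: idm_def ent_fmat_of)

lemma ent_idm_mult: "ent (idm k * A) i j = (if i < k then ent A i j else 0)"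
proof -
  have "ent (idm k * A) i j = (\<Sum>l<k. if l = i then ent A i j else 0)"
    unfolding ent_times[OF bd_idm] by (rule sum.cong) (auto simp: ent_idm)
  then show ?thesis by simp
qed

lemma idm_mult: "bd k A \<Longrightarrow> idm k * A = A"
  by (rule fmat_eqI) (auto simp: ent_idm_mult bdD)

lemma mult_idm: "bd k A \<Longrightarrow> A * idm k = A"
  using idm_mult[of k "adj_fmat A"] adj_mult[of A "idm k"] by (metis adj_adj adj_idm bd_adj)

definition unit_mat :: "nat \<Rightarrow> nat \<Rightarrow> fmat" where
  "unit_mat i j = fmat_of (Suc (max i j)) (\<lambda>m n. if m = i \<and> n = j then 1 else 0)"

lemma ent_unit_mat: "ent (unit_mat i j) m n = (if m = i \<and> n = j then 1 else 0)"
  by (auto simp: unit_mat_def ent_fmat_of)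

lemma norm_unit_mat: "norm (unit_mat i j) = 1"
proof -
  have "{p. ent (unit_mat i j) (fst p) (snd p) \<noteq> 0} = {(i, j)}" by (auto simp: ent_unit_mat)
  then show ?thesis by (simp add: norm_fmat_def L2_set_def ent_unit_mat)
qed

lemma opn_entry_le: "cmod (ent A i j) \<le> opn A"
proof -
  have b: "\<forall>\<^sub>F n in sequentially. bd n A \<and> j < n" by (intro eventually_conj eventually_bd eventually_gt_at_top)
  then obtain n where n: "bd n A" "j < n" using eventually_happens'[OF sequentially_bot b] by blast
  have "ent (A * unit_mat j j) i j = ent A i j"
    using n by (simp add: ent_times[OF n(1)] ent_unit_mat if_distrib cong: if_cong)
  then show ?thesis
    using norm_entry_le[of "A * unit_mat j j" i j] norm_mult_opn[of A "unit_mat j j"] by (simp add: norm_unit_mat)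
qed

section \<open>Unitary matrices and their antihermitian parts\<close>

definition unitary_fmat :: "nat \<Rightarrow> fmat \<Rightarrow> bool" where
  "unitary_fmat k U \<longleftrightarrow> bd k U \<and> adj_fmat U * U = idm k \<and> U * adj_fmat U = idm k"

lemma norm_le_idm_mult: "norm (idm k * A) \<le> norm A"
proof -
  have "\<forall>\<^sub>F n in sequentially. bd n A \<and> k \<le> n" by (intro eventually_conj eventually_bd eventually_ge_at_top)
  then obtain n where n: "bd n A" "k \<le> n" using eventually_happens'[OF sequentially_bot] by blast
  have bk: "bd n (idm k)" using n bd_idm[of k] by (auto simp: bd_def)
  have "(norm (idm k * A))\<^sup>2 \<le> (norm A)\<^sup>2"
    unfolding norm_sq_bd[OF n(1)] norm_sq_bd[OF bd_mult[OF bk n(1)]] ent_idm_mult by (intro sum_mono) auto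
  then show ?thesis by (rule power2_le_imp_le) simp
qed

text \<open>The product of the adjoint of U with U is the projection onto the corner, so
  \<open>U * X\<close> has the same norm as \<open>idm k * X\<close>.\<close>

lemma opn_unitary_le: assumes "unitary_fmat k U" shows "opn U \<le> 1"
proof (rule opn_le)
  fix X
  have "complex_of_real ((norm (U * X))\<^sup>2) = ftr (adj_fmat X * (adj_fmat U * U) * X)"
    unfolding norm_sq_ftr by (simp add: adj_mult mult.assoc)
  also have "adj_fmat U * U = idm k * idm k" using assms by (simp add: unitary_fmat_def idm_mult)
  also have "ftr (adj_fmat X * (idm k * idm k) * X) = complex_of_real ((norm (idm k * X))\<^sup>2)"
    unfolding norm_sq_ftr by (simp add: adj_mult mult.assoc)
  finally have "norm (U * X) = norm (idm k * X)"
    by (simp only: of_real_eq_iff power2_eq_iff_nonneg norm_ge_zero)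
  then show "norm (U * X) \<le> 1 * norm X" using norm_le_idm_mult by simp
qed simp

lemma unitary_adj: "unitary_fmat k U \<Longrightarrow> unitary_fmat k (adj_fmat U)"
  by (simp add: unitary_fmat_def bd_adj)

lemma unitary_mult:
  assumes "unitary_fmat k U" "unitary_fmat k V" shows "unitary_fmat k (U * V)"
proof -
  have "adj_fmat (U * V) * (U * V) = adj_fmat V * (adj_fmat U * U) * V" by (simp add: adj_mult mult.assoc)
  moreover have "U * V * adj_fmat (U * V) = U * (V * adj_fmat V) * adj_fmat U" by (simp add: adj_mult mult.assoc)
  ultimately show ?thesis using assms by (simp add: unitary_fmat_def bd_mult idm_mult mult_idm bd_adj)
qed

definition anti :: "fmat \<Rightarrow> fmat" where "anti W = (1/2) *\<^sub>R (W - adj_fmat W)"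

text \<open>The hermitian part \<open>h\<close> of a unitary with antihermitian part \<open>T\<close> satisfies \<open>h\<^sup>2 = 1 + T\<^sup>2\<close>, which near
  the identity determines \<open>h\<close>. This is why \<open>U(k)\<close> costs only \<open>k\<^sup>2\<close> real dimensions instead of \<open>2k\<^sup>2\<close>.\<close>

lemma unitary_chart:
  assumes U: "unitary_fmat k W1" "unitary_fmat k W2"
    and near: "opn (W1 - idm k) \<le> 1/2" "opn (W2 - idm k) \<le> 1/2"
  shows "opn (W1 - W2) \<le> 2 * opn (anti W1 - anti W2)"
proof -
  define h where "h W = (1/2) *\<^sub>R (W + adj_fmat W)" for W
  let ?I = "idm k" and ?X = "h W1 - h W2" and ?T = "anti W1 - anti W2"
  have sq: "h W * h W - anti W * anti W = ?I" if "unitary_fmat k W" for W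
  proof -
    have "h W * h W - anti W * anti W = (1/2) *\<^sub>R (W * adj_fmat W + adj_fmat W * W)"
      by (simp add: h_def anti_def algebra_simps) (simp flip: scaleR_add_left)
    also have "\<dots> = ?I" using that by (simp add: unitary_fmat_def flip: scaleR_2)
    finally show ?thesis .
  qed
  have a: "opn (anti W) \<le> 1/2" and hI: "opn (h W - ?I) \<le> 1/2" if "opn (W - ?I) \<le> 1/2" for W
  proof -
    have e1: "anti W = (1/2) *\<^sub>R ((W - ?I) - adj_fmat (W - ?I))" by (simp add: anti_def adj_diff)
    have e2: "h W - ?I = (1/2) *\<^sub>R ((W - ?I) + adj_fmat (W - ?I))"
      by (simp add: h_def adj_diff algebra_simps) (simp flip: scaleR_add_left)
    show "opn (anti W) \<le> 1/2"
      unfolding e1 opn_scaleR using opn_diff[of "W - ?I" "adj_fmat (W - ?I)"] that by (simp del: opn_adj add: opn_adj[of "W - ?I"])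
    show "opn (h W - ?I) \<le> 1/2"
      unfolding e2 opn_scaleR using opn_triangle[of "W - ?I" "adj_fmat (W - ?I)"] that by (simp del: opn_adj add: opn_adj[of "W - ?I"])
  qed
  have bX: "bd k ?X" using U by (auto simp: h_def unitary_fmat_def scaleR_fmat_def bd_diff bd_cscale bd_add bd_adj)
  \<comment> \<open>The two instances of \<open>sq\<close> are subtracted, and h1^2 - h2^2 = h1 X +
    X h2 is expanded about the identity. Within distance 1/2 of the identity the correction costs
    only one of the two copies of X on the left, so X is controlled by the antihermitian
    parts.\<close>
  have "2 *\<^sub>R ?X = (anti W1 * ?T + ?T * anti W2) - ((h W1 - ?I) * ?X + ?X * (h W2 - ?I))"
  proof -
    have "(h W1 - ?I) * ?X + ?X * (h W2 - ?I) = (h W1 * h W1 - h W2 * h W2) - (?I * ?X + ?X * ?I)"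
      by (simp add: algebra_simps)
    moreover have "?I * ?X = ?X" "?X * ?I = ?X" using bX by (simp_all only: idm_mult mult_idm)
    moreover have "h W1 * h W1 - h W2 * h W2 = anti W1 * anti W1 - anti W2 * anti W2"
      using sq[OF U(1)] sq[OF U(2)] by (simp add: algebra_simps)
    moreover have "anti W1 * ?T + ?T * anti W2 = anti W1 * anti W1 - anti W2 * anti W2"
      by (simp add: algebra_simps)
    ultimately show ?thesis by (simp only: scaleR_2) simp
  qed
  then have "2 * opn ?X = opn ((anti W1 * ?T + ?T * anti W2) - ((h W1 - ?I) * ?X + ?X * (h W2 - ?I)))"
    using opn_scaleR[of 2 ?X] by simp
  also have "\<dots> \<le> (opn (anti W1 * ?T) + opn (?T * anti W2)) + (opn ((h W1 - ?I) * ?X) + opn (?X * (h W2 - ?I)))"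
    by (intro order_trans[OF opn_diff] add_mono opn_triangle)
  also have "\<dots> \<le> (1/2 * opn ?T + opn ?T * (1/2)) + (1/2 * opn ?X + opn ?X * (1/2))"
    by (intro add_mono order_trans[OF opn_mult] mult_mono a hI near) auto
  finally have "opn ?X \<le> opn ?T" by simp
  moreover have "W1 - W2 = ?X + ?T"
    by (simp add: h_def anti_def algebra_simps) (simp flip: scaleR_add_left)
  ultimately show ?thesis using opn_triangle[of ?X ?T] by simp
qed

section \<open>Nets of unitary matrices and of coordinate subspaces\<close>

text \<open>A real basis: the Boolean marks the multiple by the imaginary unit, so a set K of
  positions spans a space of real dimension 2 card K.\<close>

definition cmat_basis :: "bool \<times> nat \<times> nat \<Rightarrow> fmat" where
  "cmat_basis = (\<lambda>(s, i, j). cscale (if s then \<i> else 1) (unit_mat i j))"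

lemma ent_scaleR [simp]: "ent (r *\<^sub>R A) i j = complex_of_real r * ent A i j"
  by (simp add: scaleR_fmat_def)

lemma ent_cmat_basis_sum:
  assumes "finite K"
  shows "ent (\<Sum>p\<in>UNIV \<times> K. c p *\<^sub>R cmat_basis p) m n =
    (if (m, n) \<in> K then Complex (c (False, m, n)) (c (True, m, n)) else 0)"
proof -
  have "ent (\<Sum>p\<in>UNIV \<times> K. c p *\<^sub>R cmat_basis p) m n = (\<Sum>s\<in>UNIV. \<Sum>q\<in>K. ent (c (s, q) *\<^sub>R cmat_basis (s, q)) m n)"
    by (simp add: ent_sum sum.cartesian_product split_beta)
  also have "\<dots> = (\<Sum>s\<in>UNIV. \<Sum>q\<in>K. if q = (m, n) then complex_of_real (c (s, q)) * (if s then \<i> else 1) else 0)"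
    by (intro sum.cong refl) (auto simp: cmat_basis_def ent_unit_mat split: if_splits)
  also have "\<dots> = (if (m, n) \<in> K then Complex (c (False, m, n)) (c (True, m, n)) else 0)"
    using assms by (simp add: UNIV_bool complex_eq_iff)
  finally show ?thesis .
qed

lemma cmat_basis_range:
  assumes "finite K" "\<And>i j. (i, j) \<notin> K \<Longrightarrow> ent A i j = 0"
  shows "A \<in> range (\<lambda>c. \<Sum>p\<in>UNIV \<times> K. c p *\<^sub>R cmat_basis p)"
proof (rule range_eqI)
  show "A = (\<Sum>p\<in>UNIV \<times> K. (\<lambda>(s, i, j). if s then Im (ent A i j) else Re (ent A i j)) p *\<^sub>R cmat_basis p)"
    by (rule fmat_eqI) (subst ent_cmat_basis_sum[OF assms(1)], use assms in auto)
qed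

lemma coord_norm_cmat:
  assumes K: "finite K" and tri: "\<And>x y. q (x + y) \<le> q x + q y" and scl: "\<And>r x. q (r *\<^sub>R x) = \<bar>r\<bar> * q x"
    and le: "\<And>A i j. cmod (ent A i j) \<le> q A"
  shows "coord_norm (UNIV \<times> K) cmat_basis q 1"
proof
  fix p c assume "p \<in> (UNIV :: bool set) \<times> K"
  then obtain s i j where p: "p = (s, i, j)" "(i, j) \<in> K" by (cases p) auto
  let ?A = "\<Sum>p\<in>UNIV \<times> K. c p *\<^sub>R cmat_basis p"
  have "ent ?A i j = Complex (c (False, i, j)) (c (True, i, j))"
    using p by (simp add: ent_cmat_basis_sum[OF K])
  then have "\<bar>c (s, i, j)\<bar> \<le> cmod (ent ?A i j)"
    using abs_Re_le_cmod[of "ent ?A i j"] abs_Im_le_cmod[of "ent ?A i j"] by (cases s) simp_all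
  then show "\<bar>c p\<bar> \<le> 1 * q ?A" using le[of ?A i j] p by simp
qed (use assms in auto)

text \<open>An antihermitian matrix \<open>T\<close> is encoded by the real matrix \<open>Re T + Im T\<close>, whose antisymmetric part is
  \<open>Re T\<close> and whose symmetric part is \<open>Im T\<close>.\<close>

definition anti_basis :: "nat \<times> nat \<Rightarrow> fmat" where
  "anti_basis = (\<lambda>(i, j). (1/2) *\<^sub>R (cscale (1 + \<i>) (unit_mat i j) + cscale (\<i> - 1) (unit_mat j i)))"

lemma ent_anti_basis_sum:
  "ent (\<Sum>p\<in>{..<k}\<times>{..<k}. c p *\<^sub>R anti_basis p) m n =
    (if m < k \<and> n < k then Complex ((c (m, n) - c (n, m)) / 2) ((c (m, n) + c (n, m)) / 2) else 0)"
proof -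
  have "ent (\<Sum>p\<in>{..<k}\<times>{..<k}. c p *\<^sub>R anti_basis p) m n =
     (\<Sum>p\<in>{..<k}\<times>{..<k}. (if p = (m, n) then c p * ((1 + \<i>) / 2) else 0) + (if p = (n, m) then c p * ((\<i> - 1) / 2) else 0))"
    unfolding ent_sum
  proof (rule sum.cong[OF refl])
    fix p :: "nat \<times> nat"
    obtain a b where p: "p = (a, b)" by (cases p)
    have if_sum: "x * (1/2 * ((1 + \<i>) * (if P then 1 else 0) + (\<i> - 1) * (if Q then 1 else 0)))
        = (if P then x * ((1 + \<i>) / 2) else 0) + (if Q then x * ((\<i> - 1) / 2) else 0)" for P Q x
      by (cases P; cases Q) (simp_all add: field_simps)
    have "ent (unit_mat a b) m n = (if p = (m, n) then 1 else 0)" "ent (unit_mat b a) m n = (if p = (n, m) then 1 else 0)"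
      by (auto simp: ent_unit_mat p)
    then have "ent (c p *\<^sub>R anti_basis p) m n = complex_of_real (c p) *
      (1/2 * ((1 + \<i>) * (if p = (m, n) then 1 else 0) + (\<i> - 1) * (if p = (n, m) then 1 else 0)))"
      by (simp only: p anti_basis_def prod.case ent_scaleR ent_simps) simp
    then show "ent (c p *\<^sub>R anti_basis p) m n =
      (if p = (m, n) then c p * ((1 + \<i>) / 2) else 0) + (if p = (n, m) then c p * ((\<i> - 1) / 2) else 0)"
      unfolding if_sum .
  qed
  also have "\<dots> = (if m < k \<and> n < k then c (m, n) * ((1 + \<i>) / 2) + c (n, m) * ((\<i> - 1) / 2) else 0)"
    unfolding sum.distrib by (subst (1 2) sum.delta) auto
  also have "\<dots> = (if m < k \<and> n < k then Complex ((c (m, n) - c (n, m)) / 2) ((c (m, n) + c (n, m)) / 2) else 0)"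
    by (simp add: complex_eq_iff add_divide_distrib diff_divide_distrib)
  finally show ?thesis .
qed

lemma anti_basis_range:
  assumes "bd k A" "adj_fmat A = - A"
  shows "A \<in> range (\<lambda>c. \<Sum>p\<in>{..<k}\<times>{..<k}. c p *\<^sub>R anti_basis p)"
proof (rule range_eqI)
  let ?c = "\<lambda>(i, j). Re (ent A i j) + Im (ent A i j)"
  have s: "Re (ent A j i) = - Re (ent A i j)" "Im (ent A j i) = Im (ent A i j)" for i j
  proof -
    have "cnj (ent A i j) = - ent A j i" using arg_cong[OF assms(2), of "\<lambda>B. ent B j i"] by simp
    then show "Re (ent A j i) = - Re (ent A i j)" "Im (ent A j i) = Im (ent A i j)"
      by (auto simp: complex_eq_iff)
  qed
  show "A = (\<Sum>p\<in>{..<k}\<times>{..<k}. ?c p *\<^sub>R anti_basis p)"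
  proof (rule fmat_eqI)
    fix i j
    show "ent A i j = ent (\<Sum>p\<in>{..<k}\<times>{..<k}. ?c p *\<^sub>R anti_basis p) i j"
      unfolding ent_anti_basis_sum using bdD[OF assms(1), of i j] s[of j i]
      by (auto simp: complex_eq_iff not_less)
  qed
qed

lemma coord_norm_anti: "coord_norm ({..<k} \<times> {..<k}) anti_basis opn 2"
proof
  fix p c assume p: "p \<in> {..<k} \<times> {..<k}"
  let ?A = "\<Sum>p\<in>{..<k}\<times>{..<k}. c p *\<^sub>R anti_basis p"
  obtain i j where ij: "p = (i, j)" "i < k" "j < k" using p by (cases p) auto
  \<comment> \<open>A coordinate is the sum of the real and the imaginary part of one entry, whence
    the constant 2.\<close>
  have "c p = Re (ent ?A i j) + Im (ent ?A i j)"
    using ij by (simp add: ent_anti_basis_sum add_divide_distrib diff_divide_distrib)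
  then have "\<bar>c p\<bar> \<le> 2 * cmod (ent ?A i j)"
    using abs_Re_le_cmod[of "ent ?A i j"] abs_Im_le_cmod[of "ent ?A i j"] by linarith
  then show "\<bar>c p\<bar> \<le> 2 * opn ?A" using opn_entry_le[of ?A i j] by linarith
qed (simp_all add: opn_triangle opn_scaleR)

text \<open>At a fixed scale the full real dimension 2 k^2 of the complex matrices is affordable: it
  costs a constant to the power k^2. Here 25 is the square of 1 + 2 / (1/2).\<close>

lemma unitary_coarse_packing:
  assumes F: "finite F" "\<And>U. U \<in> F \<Longrightarrow> unitary_fmat k U"
    and sep: "\<And>U V. U \<in> F \<Longrightarrow> V \<in> F \<Longrightarrow> U \<noteq> V \<Longrightarrow> 1/2 \<le> opn (U - V)"
  shows "real (card F) \<le> 25 ^ (k\<^sup>2)"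
proof -
  interpret coord_norm "UNIV \<times> ({..<k} \<times> {..<k})" cmat_basis opn 1
    by (rule coord_norm_cmat) (simp_all add: opn_triangle opn_entry_le opn_scaleR)
  have "F \<subseteq> range lc"
    unfolding lc_def using F(2)
    by (intro subsetI cmat_basis_range) (auto simp: unitary_fmat_def bd_def not_less)
  then have "real (card F) \<le> (1 + 2 * 1 / (1/2)) ^ card (UNIV \<times> ({..<k} \<times> {..<k}) :: (bool \<times> nat \<times> nat) set)"
    using F sep by (intro packing) (auto intro: opn_unitary_le)
  also have "\<dots> = (5\<^sup>2) ^ (k\<^sup>2)"
    unfolding power_mult[symmetric] by (simp add: power2_eq_square)
  finally show ?thesis by simp
qed

lemma bd_anti: "bd k W \<Longrightarrow> bd k (anti W)"
  by (simp add: anti_def scaleR_fmat_def bd_cscale bd_diff bd_adj)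

text \<open>Multiplication by the adjoint of \<open>V\<close> moves the points close to the
  identity, where \<open>unitary_chart\<close> makes their antihermitian parts e/2-separated; these
  live in real dimension k^2.\<close>

lemma unitary_local_packing:
  assumes V: "unitary_fmat k V" and F: "finite F" "\<And>U. U \<in> F \<Longrightarrow> unitary_fmat k U"
    and near: "\<And>U. U \<in> F \<Longrightarrow> opn (U - V) \<le> 1/2" and e: "0 < e" "e \<le> 1"
    and sep: "\<And>U V. U \<in> F \<Longrightarrow> V \<in> F \<Longrightarrow> U \<noteq> V \<Longrightarrow> e \<le> opn (U - V)"
  shows "real (card F) \<le> (3 / e) ^ (k\<^sup>2)"
proof -
  interpret coord_norm "{..<k} \<times> {..<k}" anti_basis opn 2 by (rule coord_norm_anti)
  let ?W = "\<lambda>U. adj_fmat V * U"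
  let ?T = "\<lambda>U. anti (?W U)"
  have uW: "unitary_fmat k (?W U)" if "U \<in> F" for U
    using unitary_mult[OF unitary_adj[OF V] F(2)[OF that]] .
  have nearW: "opn (?W U - idm k) \<le> 1/2" if "U \<in> F" for U
  proof -
    have "?W U - idm k = adj_fmat V * (U - V)" using V by (simp add: unitary_fmat_def right_diff_distrib)
    then have "opn (?W U - idm k) \<le> opn (adj_fmat V) * opn (U - V)" by (simp only: opn_mult)
    also have "\<dots> \<le> 1 * (1/2)" using opn_unitary_le[OF V] near[OF that] by (intro mult_mono) auto
    finally show ?thesis by simp
  qed
  have sepT: "e / 2 \<le> opn (?T U - ?T U')" if "U \<in> F" "U' \<in> F" "U \<noteq> U'" for U U'
  proof -
    have "V * (?W U - ?W U') = (V * adj_fmat V) * (U - U')" by (simp add: right_diff_distrib mult.assoc)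
    also have "\<dots> = U - U'" using V F(2)[OF that(1)] F(2)[OF that(2)]
      by (simp add: unitary_fmat_def idm_mult bd_diff)
    finally have "opn (U - U') \<le> opn V * opn (?W U - ?W U')" by (metis opn_mult)
    also have "\<dots> \<le> 1 * opn (?W U - ?W U')" using opn_unitary_le[OF V] by (intro mult_right_mono) auto
    also have "opn (?W U - ?W U') \<le> 2 * opn (?T U - ?T U')"
      using unitary_chart[OF uW[OF that(1)] uW[OF that(2)] nearW[OF that(1)] nearW[OF that(2)]] .
    finally show ?thesis using sep[OF that] by linarith
  qed
  have inj: "inj_on ?T F"
    using sepT e by (intro inj_onI) (metis half_gt_zero leD diff_self opn_scaleR abs_zero mult_zero_left scaleR_zero_left)
  have T2: "opn (?T U) \<le> 1/2" if "U \<in> F" for U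
  proof -
    have e1: "?T U = (1/2) *\<^sub>R ((?W U - idm k) - adj_fmat (?W U - idm k))" by (simp add: anti_def adj_diff)
    show ?thesis unfolding e1 opn_scaleR
      using opn_diff[of "?W U - idm k" "adj_fmat (?W U - idm k)"] nearW[OF that] opn_adj[of "?W U - idm k"] by (simp del: opn_adj)
  qed
  have "?T ` F \<subseteq> range lc"
  proof (rule image_subsetI)
    fix U assume U: "U \<in> F"
    have "adj_fmat (?T U) = - ?T U"
      by (rule fmat_eqI) (simp add: anti_def field_simps)
    moreover have "bd k (?T U)" using uW[OF U] by (simp add: bd_anti unitary_fmat_def)
    ultimately show "?T U \<in> range lc" unfolding lc_def by (intro anti_basis_range)
  qed
  \<comment> \<open>Radius 1/2 and separation e/2 give the base 1 + 2/e, which is at most 3/e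
    because e is at most 1.\<close>
  then have "real (card (?T ` F)) \<le> (1 + 2 * (1/2) / (e/2)) ^ card ({..<k} \<times> {..<k})"
    using F(1) e T2 sepT by (intro packing) auto
  also have "\<dots> \<le> (3 / e) ^ card ({..<k} \<times> {..<k})"
    using e by (intro power_mono) (auto simp: field_simps)
  finally show ?thesis using inj by (simp add: card_image power2_eq_square)
qed

lemma opn_0 [simp]: "opn 0 = 0" using opn_scaleR[of 0 0] by simp

text \<open>Two scales are used since the chart is only local: a net at distance 1/2, with at most
  25 to the power k^2 points, and within each of its balls an e-separated set of at most 3/e to the
  power k^2 points. The product of the bases is 75/e.\<close>

lemma unitary_net:
  assumes e: "0 < e" "e \<le> 1"
  shows "\<exists>F. finite F \<and> (\<forall>U\<in>F. unitary_fmat k U) \<and> real (card F) \<le> (75 / e) ^ (k\<^sup>2) \<and>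
    (\<forall>U. unitary_fmat k U \<longrightarrow> (\<exists>V\<in>F. opn (U - V) \<le> e))"
proof -
  let ?S = "{U. unitary_fmat k U}"
  have "real (card F) \<le> 25 ^ (k\<^sup>2)"
    if "finite F" "F \<subseteq> ?S" "\<forall>x\<in>F. \<forall>y\<in>F. x \<noteq> y \<longrightarrow> 1/2 \<le> opn (x - y)" for F
    by (rule unitary_coarse_packing) (use that in blast)+
  from ex_maximal_separated[of ?S "1/2" "\<lambda>U V. opn (U - V)", OF this opn_diff_commute]
  obtain G where G: "finite G \<and> G \<subseteq> ?S \<and> real (card G) \<le> 25 ^ (k\<^sup>2) \<and> (\<forall>U\<in>?S. \<exists>V\<in>G. U = V \<or> opn (U - V) < 1/2)"
    by (rule exE)
  then have Gc: "\<And>U. U \<in> ?S \<Longrightarrow> \<exists>V\<in>G. U = V \<or> opn (U - V) < 1/2" by simp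
  have "real (card F) \<le> (75 / e) ^ (k\<^sup>2)"
    if F: "finite F" "F \<subseteq> ?S" "\<forall>x\<in>F. \<forall>y\<in>F. x \<noteq> y \<longrightarrow> e \<le> opn (x - y)" for F
  proof -
    let ?F = "\<lambda>V. {U\<in>F. opn (U - V) \<le> 1/2}"
    have "\<exists>V\<in>G. opn (U - V) \<le> 1/2" if "U \<in> F" for U
    proof -
      obtain V where "V \<in> G" "U = V \<or> opn (U - V) < 1/2" using Gc[of U] F(2) \<open>U \<in> F\<close> by auto
      then show ?thesis by (intro bexI[of _ V]) auto
    qed
    then have "F = (\<Union>V\<in>G. ?F V)" by auto
    then have "card F \<le> (\<Sum>V\<in>G. card (?F V))" using card_UN_le[of G ?F] G by simp
    then have "real (card F) \<le> (\<Sum>V\<in>G. real (card (?F V)))" unfolding of_nat_sum[symmetric] of_nat_le_iff .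
    also have "\<dots> \<le> (\<Sum>V\<in>G. (3 / e) ^ (k\<^sup>2))"
      using F G e by (intro sum_mono unitary_local_packing) auto
    also have "\<dots> \<le> 25 ^ (k\<^sup>2) * (3 / e) ^ (k\<^sup>2)"
      using G e by (simp add: mult_right_mono)
    also have "\<dots> = (75 / e) ^ (k\<^sup>2)" by (simp add: power_mult_distrib[symmetric])
    finally show ?thesis .
  qed
  from ex_maximal_separated[of ?S e "\<lambda>U V. opn (U - V)", OF this opn_diff_commute]
  obtain F where F: "finite F \<and> F \<subseteq> ?S \<and> real (card F) \<le> (75 / e) ^ (k\<^sup>2) \<and> (\<forall>U\<in>?S. \<exists>V\<in>F. U = V \<or> opn (U - V) < e)"
    by (rule exE)
  show ?thesis
  proof (intro exI[of _ F] conjI allI impI)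
    fix U assume "unitary_fmat k U"
    then obtain V where "V \<in> F" "U = V \<or> opn (U - V) < e" using F by auto
    then show "\<exists>V\<in>F. opn (U - V) \<le> e" using e by (intro bexI[of _ V]) auto
  qed (use F in auto)
qed

section \<open>Nets in coordinate subspaces and in their unitary orbits\<close>

lift_definition restr :: "(nat \<times> nat) set \<Rightarrow> fmat \<Rightarrow> fmat" is "\<lambda>K f p. if p \<in> K then f p else 0"
  subgoal for K f by (rule finite_subset[of _ "{p. f p \<noteq> 0}"]) auto
  done

lemma ent_restr: "ent (restr K A) i j = (if (i, j) \<in> K then ent A i j else 0)"
  by transfer simp

lemma norm_restr_le: "norm (restr K A) \<le> norm A"
proof -
  obtain n where n: "bd n A" "bd n (restr K A)" by (rule ex_bd2)
  have "(norm (restr K A))\<^sup>2 \<le> (norm A)\<^sup>2"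
    unfolding norm_sq_bd[OF n(1)] norm_sq_bd[OF n(2)] by (intro sum_mono) (auto simp: ent_restr)
  then show ?thesis by (rule power2_le_imp_le) simp
qed

text \<open>Restriction to K does not increase the norm, so it stays in the ball of radius r of a
  space of real dimension 2 card K; separation e r there gives the base 1 + 2/e.\<close>

lemma coord_net:
  assumes K: "finite K" and r: "0 < r" and e: "0 < e" "e \<le> 1"
  shows "\<exists>F. finite F \<and> real (card F) \<le> (3 / e) ^ (2 * card K) \<and>
    (\<forall>A. norm A \<le> r \<longrightarrow> (\<exists>C\<in>F. norm (restr K A - C) \<le> e * r))"
proof -
  interpret coord_norm "UNIV \<times> K" cmat_basis norm 1
    by (rule coord_norm_cmat[OF K]) (simp_all add: norm_triangle_ineq norm_entry_le)
  let ?S = "{C. (\<forall>i j. (i, j) \<notin> K \<longrightarrow> ent C i j = 0) \<and> norm C \<le> r}"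
  have "real (card F) \<le> (3 / e) ^ (2 * card K)"
    if F: "finite F" "F \<subseteq> ?S" "\<forall>x\<in>F. \<forall>y\<in>F. x \<noteq> y \<longrightarrow> e * r \<le> norm (x - y)" for F
  proof -
    have "F \<subseteq> range lc" unfolding lc_def using F(2) by (auto intro!: cmat_basis_range[OF K])
    then have "real (card F) \<le> (1 + 2 * r / (e * r)) ^ card (UNIV \<times> K :: (bool \<times> nat \<times> nat) set)"
      using F r e by (intro packing) auto
    also have "\<dots> \<le> (3 / e) ^ card (UNIV \<times> K :: (bool \<times> nat \<times> nat) set)"
      using r e by (intro power_mono) (auto simp: field_simps)
    finally show ?thesis by (simp add: card_cartesian_product)
  qed
  from ex_maximal_separated[of ?S "e * r" "\<lambda>U V. norm (U - V)", OF this norm_minus_commute]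
  obtain F where F: "finite F \<and> F \<subseteq> ?S \<and> real (card F) \<le> (3 / e) ^ (2 * card K) \<and>
     (\<forall>C\<in>?S. \<exists>D\<in>F. C = D \<or> norm (C - D) < e * r)"
    by (rule exE)
  show ?thesis
  proof (intro exI[of _ F] conjI allI impI)
    fix A :: fmat assume "norm A \<le> r"
    then have "restr K A \<in> ?S" using norm_restr_le[of K A] by (auto simp: ent_restr)
    then obtain C where C: "C \<in> F" "restr K A = C \<or> norm (restr K A - C) < e * r"
      using F by meson
    then show "\<exists>C\<in>F. norm (restr K A - C) \<le> e * r"
      using e r by (intro bexI[of _ C]) auto
  qed (use F in auto)
qed

lemma norm_sandwich_le:
  assumes "opn X \<le> 1" "opn Z \<le> 1" shows "norm (X * Y * Z) \<le> norm Y"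
proof -
  have "norm (X * Y * Z) \<le> norm (X * Y) * opn Z" by (rule norm_mult_opn_right)
  also have "\<dots> \<le> norm (X * Y) * 1" using assms by (intro mult_left_mono) auto
  also have "norm (X * Y) * 1 \<le> opn X * norm Y" using norm_mult_opn[of X Y] by simp
  also have "\<dots> \<le> 1 * norm Y" using assms by (intro mult_right_mono) auto
  finally show ?thesis by simp
qed

text \<open>Replace B by R, then U by V on each side, then R by C. The Hilbert-Schmidt norm is an
  ideal norm, so replacing U costs the operator norm of U - V times the Hilbert-Schmidt norm of R;
  this is why the net of unitaries is one in operator norm.\<close>

lemma norm_conj_diff_le:
  assumes U: "opn U \<le> 1" and V: "opn V \<le> 1"
  shows "norm (U * B * adj_fmat U - V * C * adj_fmat V)
    \<le> norm (B - R) + 2 * (opn (U - V) * norm R) + norm (R - C)"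
proof -
  let ?a = "U * (B - R) * adj_fmat U" and ?b = "(U - V) * R * adj_fmat U"
    and ?c = "V * R * adj_fmat (U - V)" and ?d = "V * (R - C) * adj_fmat V"
  have eq: "U * B * adj_fmat U - V * C * adj_fmat V = ?a + (?b + ?c) + ?d"
    by (simp add: algebra_simps adj_diff)
  have a: "norm ?a \<le> norm (B - R)" using U by (intro norm_sandwich_le) simp_all
  have d: "norm ?d \<le> norm (R - C)" using V by (intro norm_sandwich_le) simp_all
  have "norm ?b \<le> norm ((U - V) * R) * opn (adj_fmat U)" by (rule norm_mult_opn_right)
  also have "\<dots> \<le> norm ((U - V) * R) * 1" using U by (intro mult_left_mono) simp_all
  finally have b: "norm ?b \<le> opn (U - V) * norm R" using norm_mult_opn[of "U - V" R] by linarith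
  have "norm ?c \<le> norm (V * R) * opn (U - V)"
    using norm_mult_opn_right[of "V * R" "adj_fmat (U - V)"] unfolding opn_adj .
  also have "norm (V * R) \<le> opn V * norm R" by (rule norm_mult_opn)
  also have "\<dots> \<le> 1 * norm R" using V by (intro mult_right_mono) simp_all
  finally have c: "norm ?c \<le> opn (U - V) * norm R" by (simp add: mult_right_mono mult.commute)
  have "norm (?a + (?b + ?c) + ?d) \<le> norm ?a + (norm ?b + norm ?c) + norm ?d"
    by (intro order_trans[OF norm_triangle_ineq] add_mono order_refl)
  with a b c d show ?thesis unfolding eq by linarith
qed

definition near_sparse :: "nat \<Rightarrow> real \<Rightarrow> real \<Rightarrow> fmat \<Rightarrow> bool" where
  "near_sparse k b d A \<longleftrightarrow> (\<exists>U K. unitary_fmat k U \<and> K \<subseteq> {..<k} \<times> {..<k} \<and>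
    real (card K) \<le> b * (real k)\<^sup>2 \<and> norm (adj_fmat U * A * U - restr K (adj_fmat U * A * U)) \<le> d)"

text \<open>The set K varies with A, so the cover is a union over all admissible K; their number, at
  most 2 to the power k^2, turns the base 75 into 150. The error 4 e r consists of e r off K, 2 e r
  for replacing U on both sides, and e r for the net in the subspace.\<close>

theorem sparse_orbit_cover:
  assumes r: "0 < r" and e: "0 < e" "e \<le> 1" and b: "0 \<le> b"
  shows "\<exists>F. finite F \<and> real (card F) \<le> (150 / e) ^ (k\<^sup>2) * (3 / e) powr (2 * b * (real k)\<^sup>2) \<and>
    (\<forall>A. bd k A \<longrightarrow> norm A \<le> r \<longrightarrow> near_sparse k b (e * r) A \<longrightarrow> (\<exists>X\<in>F. norm (A - X) \<le> 4 * e * r))"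
proof -
  from unitary_net[OF e, of k]
  obtain N where N: "finite N \<and> (\<forall>U\<in>N. unitary_fmat k U) \<and> real (card N) \<le> (75 / e) ^ (k\<^sup>2) \<and>
    (\<forall>U. unitary_fmat k U \<longrightarrow> (\<exists>V\<in>N. opn (U - V) \<le> e))"
    by (rule exE)
  let ?KK = "{K. K \<subseteq> {..<k} \<times> {..<k} \<and> real (card K) \<le> b * (real k)\<^sup>2}"
  have "\<forall>K\<in>?KK. \<exists>F. finite F \<and> real (card F) \<le> (3 / e) ^ (2 * card K) \<and>
     (\<forall>A. norm A \<le> r \<longrightarrow> (\<exists>C\<in>F. norm (restr K A - C) \<le> e * r))"
    by (intro ballI coord_net r e) (auto intro: finite_subset)
  from bchoice[OF this] obtain G where "\<forall>K\<in>?KK. finite (G K) \<and> real (card (G K)) \<le> (3 / e) ^ (2 * card K) \<and>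
     (\<forall>A. norm A \<le> r \<longrightarrow> (\<exists>C\<in>G K. norm (restr K A - C) \<le> e * r))"
    by (rule exE)
  then have G: "\<And>K. K \<in> ?KK \<Longrightarrow> finite (G K)" "\<And>K. K \<in> ?KK \<Longrightarrow> real (card (G K)) \<le> (3 / e) ^ (2 * card K)"
     "\<And>K A. K \<in> ?KK \<Longrightarrow> norm A \<le> r \<Longrightarrow> \<exists>C\<in>G K. norm (restr K A - C) \<le> e * r"
    by simp_all
  let ?p = "(3 / e) powr (2 * b * (real k)\<^sup>2)"
  have fKK: "finite ?KK" by (rule finite_subset[of _ "Pow ({..<k} \<times> {..<k})"]) auto
  have cKK: "real (card ?KK) \<le> 2 ^ (k\<^sup>2)"
  proof -
    have "card ?KK \<le> card (Pow ({..<k} \<times> {..<k}))" by (intro card_mono) auto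
    also have "\<dots> = 2 ^ (k\<^sup>2)" by (simp add: card_Pow power2_eq_square)
    finally have c: "card ?KK \<le> 2 ^ (k\<^sup>2)" .
    have "real (card ?KK) \<le> real (2 ^ (k\<^sup>2))" using c by (rule of_nat_mono)
    then show ?thesis by (simp only: of_nat_power of_nat_numeral)
  qed
  have cG: "real (card (G K)) \<le> ?p" if "K \<in> ?KK" for K
  proof -
    have "real (card (G K)) \<le> (3 / e) powr real (2 * card K)"
      using G(2)[OF that] e by (subst powr_realpow) simp_all
    also have "\<dots> \<le> ?p" using that e by (intro powr_mono) (auto simp: field_simps)
    finally show ?thesis .
  qed
  define F where "F = (\<Union>K\<in>?KK. (\<lambda>(V, C). V * C * adj_fmat V) ` (N \<times> G K))"
  have fin: "finite F" unfolding F_def using fKK N G(1) by (intro finite_UN_I finite_imageI finite_cartesian_product) simp_all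
  have crd: "real (card F) \<le> (150 / e) ^ (k\<^sup>2) * ?p"
  proof -
    have "card F \<le> (\<Sum>K\<in>?KK. card ((\<lambda>(V, C). V * C * adj_fmat V) ` (N \<times> G K)))"
      unfolding F_def by (rule card_UN_le[OF fKK])
    also have "\<dots> \<le> (\<Sum>K\<in>?KK. card N * card (G K))"
      using N G(1) by (intro sum_mono order_trans[OF card_image_le]) (simp_all add: card_cartesian_product)
    finally have "real (card F) \<le> (\<Sum>K\<in>?KK. real (card N) * real (card (G K)))"
      unfolding of_nat_mult[symmetric] of_nat_sum[symmetric] of_nat_le_iff .
    also have "\<dots> \<le> (\<Sum>K\<in>?KK. (75 / e) ^ (k\<^sup>2) * ?p)"
      using N cG e by (intro sum_mono mult_mono) auto
    also have "\<dots> \<le> 2 ^ (k\<^sup>2) * ((75 / e) ^ (k\<^sup>2) * ?p)"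
      using cKK e by (simp add: mult_right_mono)
    also have "\<dots> = (150 / e) ^ (k\<^sup>2) * ?p" by (simp add: power_mult_distrib[symmetric])
    finally show ?thesis .
  qed
  have main: "\<exists>X\<in>F. norm (A - X) \<le> 4 * e * r"
    if A: "bd k A" "norm A \<le> r" and U: "unitary_fmat k U"
      and KK: "K \<subseteq> {..<k} \<times> {..<k}" "real (card K) \<le> b * (real k)\<^sup>2"
      and off: "norm (adj_fmat U * A * U - restr K (adj_fmat U * A * U)) \<le> e * r" for A U K
  proof -
    have K: "K \<in> ?KK" using KK by simp
    let ?U' = "adj_fmat U"
    let ?B = "?U' * A * U"
    have u1: "opn U \<le> 1" "opn ?U' \<le> 1" using opn_unitary_le[OF U] by auto
    have nB: "norm ?B \<le> r" using order_trans[OF norm_sandwich_le[OF u1(2,1)] A(2)] .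
    obtain V where V: "V \<in> N" "opn (U - V) \<le> e" using N U by auto
    have v1: "opn V \<le> 1" using opn_unitary_le[of k V] N V(1) by simp
    obtain C where C: "C \<in> G K" "norm (restr K ?B - C) \<le> e * r" using G(3)[OF K nB] by blast
    let ?R = "restr K ?B"
    have AU: "A = U * ?B * ?U'"
    proof -
      have "U * ?B * ?U' = (U * ?U') * A * (U * ?U')" by (simp add: mult.assoc)
      then show ?thesis using U A(1) by (simp add: unitary_fmat_def idm_mult mult_idm)
    qed
    have "norm (U * ?B * ?U' - V * C * adj_fmat V) \<le> norm (?B - ?R) + 2 * (opn (U - V) * norm ?R) + norm (?R - C)"
      by (rule norm_conj_diff_le[OF u1(1) v1])
    moreover have "opn (U - V) * norm ?R \<le> e * r"
      using V(2) order_trans[OF norm_restr_le nB] e by (intro mult_mono) simp_all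
    ultimately have "norm (A - V * C * adj_fmat V) \<le> 4 * e * r"
      unfolding AU[symmetric] using off C(2) by linarith
    moreover have "V * C * adj_fmat V \<in> F"
      unfolding F_def by (rule UN_I[OF K], rule image_eqI[of _ _ "(V, C)"]) (simp_all add: V(1) C(1))
    ultimately show ?thesis by (rule bexI)
  qed
  show ?thesis using fin crd main unfolding near_sparse_def by (intro exI[of _ F] conjI allI impI) auto
qed

section \<open>The spectral theorem\<close>

definition diagf :: "nat \<Rightarrow> (nat \<Rightarrow> real) \<Rightarrow> fmat" where
  "diagf k l = fmat_of k (\<lambda>i j. if i = j then complex_of_real (l i) else 0)"

lemma ent_mult_unit: "ent (A * unit_mat n m) i j = (if j = m then ent A i n else 0)"
proof -
  have b: "\<forall>\<^sub>F N in sequentially. bd N A \<and> n < N" by (intro eventually_conj eventually_bd eventually_gt_at_top)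
  then obtain N where N: "bd N A" "n < N" using eventually_happens'[OF sequentially_bot b] by blast
  have "ent (A * unit_mat n m) i j = (\<Sum>l<N. if l = n then (if j = m then ent A i n else 0) else 0)"
    unfolding ent_times[OF N(1)] by (rule sum.cong) (auto simp: ent_unit_mat)
  then show ?thesis using N by simp
qed

lemma adj_unit: "adj_fmat (unit_mat n m) = unit_mat m n"
  by (rule fmat_eqI) (auto simp: ent_unit_mat)

lemma ent_unit_mult: "ent (unit_mat n m * A) i j = (if i = n then ent A m j else 0)"
proof -
  have "ent (unit_mat n m * A) i j = cnj (ent (adj_fmat A * unit_mat m n) j i)"
    by (metis adj_adj adj_mult adj_unit ent_simps(6))
  then show ?thesis by (simp add: ent_mult_unit)
qed

lemma bd_unit: "n < k \<Longrightarrow> m < k \<Longrightarrow> bd k (unit_mat n m)"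
  by (auto simp: bd_def ent_unit_mat)

text \<open>The Householder reflection exchanging the unit vectors \<open>e\<^sub>n\<close> and \<open>v\<close>, both encoded as
  matrices with the single nonzero column \<open>n\<close>. For \<open>v = e\<^sub>n\<close> the junk value \<open>1 / 0 = 0\<close> makes it the
  identity.\<close>

lemma householder:
  assumes n: "n < k" and V: "bd k V" "V * unit_mat n n = V" "adj_fmat V * V = unit_mat n n"
    and u: "ent V n n = complex_of_real u"
  obtains Q where "unitary_fmat k Q" "adj_fmat Q = Q" "Q * unit_mat n n = V" "Q * V = unit_mat n n"
    "\<And>F. adj_fmat V * F = 0 \<Longrightarrow> unit_mat n n * F = 0 \<Longrightarrow> Q * F = idm k * F"
proof -
  let ?E = "unit_mat n n"
  define W where "W = V - ?E"
  \<comment> \<open>Since \<open>adj_fmat W * W\<close> is 2 (1 - u) times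
    \<open>unit_mat n n\<close>, this is the usual factor 2 / |v - e|^2 of a reflection. The reality
    of u is what makes the reflection along v - e exchange the two vectors.\<close>
  define s where "s = 1 / (1 - u)"
  define Q where "Q = idm k - s *\<^sub>R (W * adj_fmat W)"
  have EE: "?E * ?E = ?E" by (rule fmat_eqI) (auto simp: ent_mult_unit ent_unit_mat)
  have EV: "?E * V = u *\<^sub>R ?E"
  proof (rule fmat_eqI)
    fix i j
    have "ent V n j = (if j = n then complex_of_real u else 0)"
      using ent_mult_unit[of V n n n j] unfolding V(2) u .
    then show "ent (?E * V) i j = ent (u *\<^sub>R ?E) i j"
      by (simp add: ent_unit_mult ent_unit_mat)
  qed
  have VE: "adj_fmat V * ?E = u *\<^sub>R ?E"
    using arg_cong[OF EV, of adj_fmat] by (simp add: adj_mult adj_unit scaleR_fmat_def adj_cscale)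
  have bW: "bd k W" using V n by (simp add: W_def bd_diff bd_unit)
  have aW: "adj_fmat W = adj_fmat V - ?E" by (simp add: W_def adj_diff adj_unit)
  have WW: "adj_fmat W * W = (2 * (1 - u)) *\<^sub>R ?E"
  proof -
    have "adj_fmat W * W = adj_fmat V * V - adj_fmat V * ?E - ?E * V + ?E * ?E"
      unfolding aW by (simp add: W_def algebra_simps)
    also have "\<dots> = (2 * (1 - u)) *\<^sub>R ?E"
      unfolding V(3) VE EV EE by (rule fmat_eqI) (simp add: algebra_simps)
    finally show ?thesis .
  qed
  have WE: "W * ?E = W" by (simp add: W_def left_diff_distrib V(2) EE)
  have aWE: "adj_fmat W * ?E = (u - 1) *\<^sub>R ?E" by (simp add: aW left_diff_distrib VE EE scaleR_left_diff_distrib)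
  have s: "s * (1 - u) = 1 \<or> W = 0 \<and> V = ?E"
  proof (cases "u = 1")
    case True
    then have "complex_of_real ((norm W)\<^sup>2) = 0" unfolding norm_sq_ftr WW by (simp add: ftr_def)
    then show ?thesis by (simp add: W_def)
  qed (simp add: s_def)
  have aQ: "adj_fmat Q = Q"
    by (simp add: Q_def adj_diff adj_mult scaleR_fmat_def adj_cscale)
  have bQ: "bd k Q" unfolding Q_def scaleR_fmat_def by (intro bd_diff bd_cscale bd_mult bd_adj bW bd_idm)
  have bWW: "bd k (W * adj_fmat W)" by (intro bd_mult bW bd_adj)
  have WWWW: "W * adj_fmat W * (W * adj_fmat W) = (2 * (1 - u)) *\<^sub>R (W * adj_fmat W)"
  proof -
    have "W * adj_fmat W * (W * adj_fmat W) = W * (adj_fmat W * W) * adj_fmat W" by (simp add: mult.assoc)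
    also have "\<dots> = (2 * (1 - u)) *\<^sub>R (W * ?E * adj_fmat W)" by (simp add: WW)
    finally show ?thesis by (simp add: WE)
  qed
  have QQ: "Q * Q = idm k"
  proof -
    have "Q * Q = idm k - (2 * s) *\<^sub>R (W * adj_fmat W) + (s * s) *\<^sub>R (W * adj_fmat W * (W * adj_fmat W))"
      by (simp add: Q_def left_diff_distrib right_diff_distrib idm_mult mult_idm bWW bd_idm scaleR_2 flip: scaleR_scaleR)
        (simp add: algebra_simps)
    also have "\<dots> = idm k - (2 * s * (1 - s * (1 - u))) *\<^sub>R (W * adj_fmat W)"
      unfolding WWWW by (simp add: algebra_simps)
    also have "\<dots> = idm k" using s by auto
    finally show ?thesis .
  qed
  have QE: "Q * ?E = V"
  proof -
    have "Q * ?E = ?E - s *\<^sub>R (W * (adj_fmat W * ?E))"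
      using n by (simp add: Q_def left_diff_distrib idm_mult bd_unit mult.assoc)
    also have "\<dots> = ?E + (s * (1 - u)) *\<^sub>R W" by (simp add: aWE WE algebra_simps)
    also have "\<dots> = V" using s by (auto simp: W_def)
    finally show ?thesis .
  qed
  have QV: "Q * V = ?E"
  proof -
    have "Q * V = Q * Q * ?E" by (simp add: QE mult.assoc)
    then show ?thesis using n by (simp add: QQ idm_mult bd_unit)
  qed
  show thesis
  proof (rule that[OF _ aQ QE QV])
    show "unitary_fmat k Q" using QQ bQ by (simp add: unitary_fmat_def aQ)
    fix F assume "adj_fmat V * F = 0" "?E * F = 0"
    then show "Q * F = idm k * F" by (simp add: Q_def left_diff_distrib mult.assoc aW)
  qed
qed

text \<open>Selfadjointness turns the eigenvector relations for the first n unit vectors into the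
  vanishing of the off-diagonal entries in the first n rows, so an eigenvector of the lower right
  block extends by zeros to one of C.\<close>

lemma block_eigenvector:
  assumes n: "n < k" and C: "bd k C" "adj_fmat C = C"
    and d: "\<And>i. i < n \<Longrightarrow> \<exists>c. C * unit_mat i i = cscale c (unit_mat i i)"
  obtains V l u where "bd k V" "V * unit_mat n n = V" "adj_fmat V * V = unit_mat n n"
    "ent V n n = complex_of_real u" "C * V = cscale l V" "\<And>i j. i < n \<Longrightarrow> ent V i j = 0"
proof -
  define M where "M = mat (k - n) (k - n) (\<lambda>(i, j). ent C (n + i) (n + j))"
  have M: "M \<in> carrier_mat (k - n) (k - n)" by (simp add: M_def)
  have "spectrum M \<noteq> {}" using n by (intro spectrum_non_empty[OF M]) simp
  then obtain l where "eigenvalue M l" by (auto simp: spectrum_def)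
  then obtain w where "eigenvector M w l" unfolding eigenvalue_def by (rule exE)
  moreover have "dim_row M = k - n" by (simp add: M_def)
  ultimately have w: "w \<in> carrier_vec (k - n)" "w \<noteq> 0\<^sub>v (k - n)" "M *\<^sub>v w = l \<cdot>\<^sub>v w"
    by (simp_all add: eigenvector_def)
  define v where "v i = (if n \<le> i \<and> i < k then vec_index w (i - n) else 0)" for i
  have C0: "ent C i j = 0" if "i < n" "i \<noteq> j" for i j
  proof -
    obtain c where "C * unit_mat i i = cscale c (unit_mat i i)" using d \<open>i < n\<close> by auto
    then have "ent (C * unit_mat i i) j i = 0" using that by (simp add: ent_unit_mat)
    then have "ent C j i = 0" by (simp add: ent_mult_unit)
    then have "ent (adj_fmat C) i j = 0" by simp
    then show ?thesis unfolding C(2) .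
  qed
  have Cv: "(\<Sum>j<k. ent C i j * v j) = l * v i" if "i < k" for i
  proof (cases "i < n")
    case True
    have "(\<Sum>j<k. ent C i j * v j) = 0"
      using C0[OF True] True by (intro sum.neutral) (auto simp: v_def)
    then show ?thesis using True by (simp add: v_def)
  next
    case False
    have "(\<Sum>j<k. ent C i j * v j) = (\<Sum>j\<in>{n..<k}. ent C i j * v j)"
      by (rule sum.mono_neutral_right) (auto simp: v_def)
    also have "\<dots> = (\<Sum>j<k - n. ent C i (n + j) * vec_index w j)"
      by (rule sum.reindex_bij_witness[of _ "\<lambda>j. n + j" "\<lambda>j. j - n"]) (auto simp: v_def)
    also have "\<dots> = vec_index (M *\<^sub>v w) (i - n)"
      using w(1) False that by (simp add: M_def scalar_prod_def lessThan_atLeast0)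
    also have "\<dots> = l * v i" using w False that by (simp add: v_def)
    finally show ?thesis .
  qed
  define V0 where "V0 = fmat_of k (\<lambda>i j. if j = n then v i else 0)"
  have e0: "ent V0 i j = (if j = n then v i else 0)" for i j
    using n by (auto simp: V0_def ent_fmat_of v_def)
  have "V0 \<noteq> 0"
  proof
    assume "V0 = 0"
    then have v0: "v i = 0" for i using e0[of i n] by simp
    have "vec_index w i = 0" if "i < k - n" for i
      using v0[of "n + i"] that unfolding v_def by (simp add: less_diff_conv add.commute)
    then have "w = 0\<^sub>v (k - n)"
      using w(1) by (intro eq_vecI) simp_all
    with w(2) show False by simp
  qed
  then have nz: "norm V0 \<noteq> 0" by simp
  \<comment> \<open>The phase makes entry n real, as the reflection in \<open>householder\<close>
    needs; if that entry is zero, any phase does.\<close>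
  define ph where "ph = (if v n = 0 then 1 else cnj (v n) / complex_of_real (cmod (v n)))"
  have ph: "cnj ph * ph = 1" "ph * v n = complex_of_real (cmod (v n))"
  proof -
    have "cnj (v n) * v n = complex_of_real (cmod (v n)) * complex_of_real (cmod (v n))"
      using complex_norm_square[of "v n"] by (simp add: power2_eq_square mult.commute)
    then show "cnj ph * ph = 1" "ph * v n = complex_of_real (cmod (v n))"
      by (simp_all add: ph_def mult.commute)
  qed
  define r where "r = ph / complex_of_real (norm V0)"
  show thesis
  proof (rule that[of "cscale r V0" "cmod (v n) / norm V0" l])
    show "bd k (cscale r V0)" by (simp add: V0_def bd_cscale)
    show "cscale r V0 * unit_mat n n = cscale r V0"
      by (rule fmat_eqI) (simp add: ent_mult_unit e0)
    show "ent (cscale r V0) n n = complex_of_real (cmod (v n) / norm V0)"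
      using ph(2) by (simp add: e0 r_def)
    show "C * cscale r V0 = cscale l (cscale r V0)"
    proof (rule fmat_eqI)
      fix i j
      have "ent (C * V0) i j = l * ent V0 i j"
      proof (cases "i < k")
        case True
        then show ?thesis using Cv[OF True] by (simp add: ent_times[OF C(1)] e0)
      next
        case False
        then show ?thesis using C(1) by (simp add: ent_times[OF C(1)] e0 bdD v_def)
      qed
      then show "ent (C * cscale r V0) i j = ent (cscale l (cscale r V0)) i j"
        by (simp add: cscale_mult_right)
    qed
    show "ent (cscale r V0) i j = 0" if "i < n" for i j
      using that by (simp add: e0 v_def)
    show "adj_fmat (cscale r V0) * cscale r V0 = unit_mat n n"
    proof (rule fmat_eqI)
      fix i j
      have b: "bd k V0" by (simp add: V0_def)
      have "(norm V0)\<^sup>2 = (\<Sum>i<k. (cmod (v i))\<^sup>2)"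
        unfolding norm_sq_bd[OF b] using n by (simp add: e0 if_distrib[of "\<lambda>x. (cmod x)\<^sup>2"] cong: if_cong)
      then have "(\<Sum>i<k. cnj (v i) * v i) = complex_of_real ((norm V0)\<^sup>2)"
        by (simp add: complex_norm_square mult.commute del: of_real_power)
      then have "ent (adj_fmat V0 * V0) i j = complex_of_real ((norm V0)\<^sup>2) * ent (unit_mat n n) i j"
        by (simp add: ent_times[OF bd_adj[OF b]] e0 ent_unit_mat del: of_real_power)
      moreover have "cnj r * r = 1 / complex_of_real ((norm V0)\<^sup>2)"
        using ph(1) by (simp add: r_def power2_eq_square)
      ultimately show "ent (adj_fmat (cscale r V0) * cscale r V0) i j = ent (unit_mat n n) i j"
        using nz by (simp add: adj_cscale cscale_mult_left cscale_mult_right mult.assoc[symmetric] mult.commute[of r])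
    qed
  qed
qed

text \<open>Induction on the number n of unit vectors that are already eigenvectors. The new
  eigenvector is orthogonal to them, so the reflection that brings it to position n fixes them, and
  the conjugation keeps what was reached.\<close>

theorem spectral_fmat:
  assumes B: "bd k B" "adj_fmat B = B"
  shows "\<exists>U l. unitary_fmat k U \<and> adj_fmat U * B * U = diagf k l"
proof -
  have "\<exists>U. unitary_fmat k U \<and> (\<forall>i<n. \<exists>c. adj_fmat U * B * U * unit_mat i i = cscale c (unit_mat i i))"
    if "n \<le> k" for n
    using that
  proof (induction n)
    case 0
    have "unitary_fmat k (idm k)" by (simp add: unitary_fmat_def idm_mult)
    then show ?case by auto
  next
    case (Suc n)
    then obtain U where U: "unitary_fmat k U"
      and d: "\<And>i. i < n \<Longrightarrow> \<exists>c. adj_fmat U * B * U * unit_mat i i = cscale c (unit_mat i i)" by auto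
    define C where "C = adj_fmat U * B * U"
    have n: "n < k" using Suc by simp
    have C: "bd k C" "adj_fmat C = C"
      using U B by (simp_all add: C_def unitary_fmat_def bd_mult bd_adj adj_mult mult.assoc)
    obtain V l u where V: "bd k V" "V * unit_mat n n = V" "adj_fmat V * V = unit_mat n n"
      "ent V n n = complex_of_real u" "C * V = cscale l V" "\<And>i j. i < n \<Longrightarrow> ent V i j = 0"
      by (rule block_eigenvector[OF n C]) (use d in \<open>auto simp: C_def\<close>)
    obtain Q where Q: "unitary_fmat k Q" "adj_fmat Q = Q" "Q * unit_mat n n = V" "Q * V = unit_mat n n"
      and Qf: "\<And>F. adj_fmat V * F = 0 \<Longrightarrow> unit_mat n n * F = 0 \<Longrightarrow> Q * F = idm k * F"
      by (rule householder[OF n V(1-4)]) blast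
    have CQ: "adj_fmat (U * Q) * B * (U * Q) = Q * C * Q"
      by (simp add: C_def adj_mult Q(2) mult.assoc)
    have "\<exists>c. Q * C * Q * unit_mat i i = cscale c (unit_mat i i)" if "i < Suc n" for i
    proof (cases "i = n")
      case True
      have "Q * C * Q * unit_mat n n = Q * (C * V)" by (simp add: Q(3) mult.assoc)
      also have "\<dots> = cscale l (unit_mat n n)" by (simp add: V(5) cscale_mult_right Q(4))
      finally show ?thesis using True by blast
    next
      case False
      then have i: "i < n" using that by simp
      then obtain c where c: "C * unit_mat i i = cscale c (unit_mat i i)" using d by (auto simp: C_def)
      have Qi: "Q * unit_mat i i = unit_mat i i"
      proof -
        have "Q * unit_mat i i = idm k * unit_mat i i"
        proof (rule Qf)
          show "adj_fmat V * unit_mat i i = 0" by (rule fmat_eqI) (simp add: ent_mult_unit V(6)[OF i])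
          show "unit_mat n n * unit_mat i i = 0"
            by (rule fmat_eqI) (use i in \<open>simp add: ent_mult_unit ent_unit_mat\<close>)
        qed
        then show ?thesis using i n by (simp add: idm_mult bd_unit)
      qed
      have "Q * C * Q * unit_mat i i = Q * (C * unit_mat i i)" by (simp add: Qi mult.assoc)
      also have "\<dots> = cscale c (unit_mat i i)" by (simp add: c cscale_mult_right Qi)
      finally show ?thesis by blast
    qed
    then show ?case using unitary_mult[OF U Q(1)] CQ by (intro exI[of _ "U * Q"]) simp
  qed
  from this[of k] obtain U where U: "unitary_fmat k U"
    and d: "\<And>i. i < k \<Longrightarrow> \<exists>c. adj_fmat U * B * U * unit_mat i i = cscale c (unit_mat i i)" by auto
  define C where "C = adj_fmat U * B * U"
  have C: "bd k C" "adj_fmat C = C"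
    using U B by (simp_all add: C_def unitary_fmat_def bd_mult bd_adj adj_mult mult.assoc)
  have "C = diagf k (\<lambda>i. Re (ent C i i))"
  proof (rule fmat_eqI)
    fix i j
    show "ent C i j = ent (diagf k (\<lambda>i. Re (ent C i i))) i j"
    proof (cases "i < k \<and> j < k")
      case True
      obtain c where "C * unit_mat j j = cscale c (unit_mat j j)" using d[of j] True by (auto simp: C_def)
      from arg_cong[OF this, of "\<lambda>A. ent A i j"] have "i \<noteq> j \<Longrightarrow> ent C i j = 0"
        by (simp add: ent_mult_unit ent_unit_mat)
      moreover have "cnj (ent C i i) = ent C i i" using arg_cong[OF C(2), of "\<lambda>A. ent A i i"] by simp
      ultimately show ?thesis using True by (auto simp: diagf_def ent_fmat_of complex_eq_iff)
    qed (use bdD[OF C(1), of i j] in \<open>auto simp: diagf_def ent_fmat_of not_less\<close>)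
  qed
  then show ?thesis using U unfolding C_def by blast
qed

section \<open>Volume of sets of selfadjoint matrices\<close>

definition fm :: "nat \<Rightarrow> complex mat \<Rightarrow> fmat" where
  "fm k A = fmat_of k (\<lambda>i j. A $$ (i, j))"

lemma bd_fm [simp]: "bd k (fm k A)" by (simp add: fm_def)

lemma ent_fm: "ent (fm k A) i j = (if i < k \<and> j < k then A $$ (i, j) else 0)"
  by (simp add: fm_def ent_fmat_of)

lemma fm_mult:
  assumes "A \<in> carrier_mat k k" "B \<in> carrier_mat k k"
  shows "fm k (A * B) = fm k A * fm k B"
proof (rule fmat_eqI)
  fix i j
  show "ent (fm k (A * B)) i j = ent (fm k A * fm k B) i j"
    using assms by (auto simp: ent_fm ent_times[OF bd_fm] scalar_prod_def lessThan_atLeast0 intro!: sum.cong)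
qed

lemma fm_one: "fm k (1\<^sub>m k) = idm k"
  by (rule fmat_eqI) (auto simp: ent_fm ent_idm)

lemma tr_fm: "tr k A = ftr (fm k A) / of_nat k"
  by (simp add: tr_def ftr_bd[OF bd_fm] ent_fm)

lemma fm_foldr:
  assumes "\<And>i. i \<in> set w \<Longrightarrow> f i \<in> carrier_mat k k"
  shows "fm k (foldr (*) (map f w) (1\<^sub>m k)) = foldr (*) (map (\<lambda>i. fm k (f i)) w) (idm k)
    \<and> foldr (*) (map f w) (1\<^sub>m k) \<in> carrier_mat k k"
  using assms
proof (induction w)
  case (Cons i w)
  then have "f i \<in> carrier_mat k k" "foldr (*) (map f w) (1\<^sub>m k) \<in> carrier_mat k k"
    and "fm k (foldr (*) (map f w) (1\<^sub>m k)) = foldr (*) (map (\<lambda>i. fm k (f i)) w) (idm k)"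
    by simp_all
  then show ?case by (simp add: fm_mult)
qed (simp add: fm_one)

lemma adj_fm:
  assumes "selfadjoint_mat k A" shows "adj_fmat (fm k A) = fm k A"
proof (rule fmat_eqI)
  fix i j
  have "\<forall>i<k. \<forall>j<k. A $$ (j, i) = cnj (A $$ (i, j))"
    using assms unfolding selfadjoint_mat_def by (rule conjunct2)
  then have "i < k \<Longrightarrow> j < k \<Longrightarrow> cnj (A $$ (j, i)) = A $$ (i, j)" by metis
  then show "ent (adj_fmat (fm k A)) i j = ent (fm k A) i j" by (simp add: ent_fm)
qed

text \<open>The cutoff is a condition on vectors while \<open>opn\<close> tests matrices, so it is
  applied to every column of X.\<close>

lemma opn_fm_le:
  assumes A: "A \<in> carrier_mat k k" and R: "0 \<le> R" and le: "opnorm_le k A R"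
  shows "opn (fm k A) \<le> R"
proof (rule opn_le[OF R])
  fix X :: fmat
  have b: "\<forall>\<^sub>F n in sequentially. bd n X \<and> k \<le> n" by (intro eventually_conj eventually_bd eventually_ge_at_top)
  then obtain n where n: "bd n X" "k \<le> n" using eventually_happens'[OF sequentially_bot b] by blast
  have bA: "bd n (fm k A)" using n by (auto simp: bd_def ent_fm)
  have col: "(\<Sum>i<n. (cmod (ent (fm k A * X) i j))\<^sup>2) \<le> R\<^sup>2 * (\<Sum>i<n. (cmod (ent X i j))\<^sup>2)" for j
  proof -
    define v where "v = vec k (\<lambda>i. ent X i j)"
    have v: "v \<in> carrier_vec k" by (simp add: v_def)
    have e: "ent (fm k A * X) i j = (if i < k then vec_index (A *\<^sub>v v) i else 0)" for i
      using A by (auto simp: ent_times[OF bd_fm] ent_fm v_def scalar_prod_def lessThan_atLeast0 intro!: sum.cong)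
    have "(\<Sum>i<n. (cmod (ent (fm k A * X) i j))\<^sup>2) = (\<Sum>i<k. (cmod (vec_index (A *\<^sub>v v) i))\<^sup>2)"
      unfolding e using n(2) by (intro sum.mono_neutral_cong_right) auto
    also have "\<dots> = (sqrt (\<Sum>i<k. (cmod (vec_index (A *\<^sub>v v) i))\<^sup>2))\<^sup>2"
      by (simp add: sum_nonneg)
    also have "\<dots> \<le> (R * sqrt (\<Sum>i<k. (cmod (vec_index v i))\<^sup>2))\<^sup>2"
      using le v by (intro power_mono) (auto simp: opnorm_le_def intro: sum_nonneg)
    also have "\<dots> = R\<^sup>2 * (\<Sum>i<k. (cmod (ent X i j))\<^sup>2)"
      by (simp add: power_mult_distrib sum_nonneg v_def)
    also have "\<dots> \<le> R\<^sup>2 * (\<Sum>i<n. (cmod (ent X i j))\<^sup>2)"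
      using n(2) by (intro mult_left_mono sum_mono2) auto
    finally show ?thesis .
  qed
  have "(norm (fm k A * X))\<^sup>2 = (\<Sum>j<n. \<Sum>i<n. (cmod (ent (fm k A * X) i j))\<^sup>2)"
    unfolding norm_sq_bd[OF bd_mult[OF bA n(1)]] by (rule sum.swap)
  also have "\<dots> \<le> (\<Sum>j<n. R\<^sup>2 * (\<Sum>i<n. (cmod (ent X i j))\<^sup>2))"
    by (intro sum_mono col)
  also have "\<dots> = (R * norm X)\<^sup>2"
    unfolding power_mult_distrib norm_sq_bd[OF n(1)] sum_distrib_left[symmetric] by (subst sum.swap) (rule refl)
  finally show "norm (fm k A * X) \<le> R * norm X"
    by (rule power2_le_imp_le) (use R in simp)
qed

section \<open>Orthonormal coordinates and the volume of covered sets\<close>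

lemma adj_sa_mat: "adj_fmat (fm k (sa_mat k c)) = fm k (sa_mat k c)"
  by (rule fmat_eqI) (auto simp: ent_fm sa_mat_def complex_eq_iff)

lemma fm_sa_mat_diff: "fm k (sa_mat k c) - fm k (sa_mat k c') = fm k (sa_mat k (\<lambda>p. c p - c' p))"
  by (rule fmat_eqI) (auto simp: ent_fm sa_mat_def complex_eq_iff diff_divide_distrib)

lemma norm_sa_mat: "(norm (fm k (sa_mat k c)))\<^sup>2 = (\<Sum>p\<in>{..<k}\<times>{..<k}. (c p)\<^sup>2)"
proof -
  have e: "(cmod (ent (fm k (sa_mat k c)) i j))\<^sup>2 = ((c (i, j))\<^sup>2 + (c (j, i))\<^sup>2) / 2" if "i < k" "j < k" for i j
    using that by (auto simp: ent_fm sa_mat_def cmod_power2 power_divide add_divide_distrib)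
  have "(norm (fm k (sa_mat k c)))\<^sup>2 = (\<Sum>i<k. \<Sum>j<k. ((c (i, j))\<^sup>2 + (c (j, i))\<^sup>2) / 2)"
    unfolding norm_sq_bd[OF bd_fm] by (intro sum.cong refl) (simp add: e)
  also have "\<dots> = ((\<Sum>i<k. \<Sum>j<k. (c (i, j))\<^sup>2) + (\<Sum>i<k. \<Sum>j<k. (c (j, i))\<^sup>2)) / 2"
    by (simp add: sum.distrib add_divide_distrib sum_divide_distrib)
  also have "(\<Sum>i<k. \<Sum>j<k. (c (j, i))\<^sup>2) = (\<Sum>i<k. \<Sum>j<k. (c (i, j))\<^sup>2)"
    by (rule sum.swap)
  finally show ?thesis by (simp add: sum.cartesian_product)
qed

lemma ftr_diff: "ftr (A - B) = ftr A - ftr B"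
  using ftr_add[of "A - B" B] by simp

text \<open>The cross terms are \<open>\<i>\<close> times the trace of X Y - Y X and vanish. Thus a
  pair of selfadjoint matrices with the Euclidean norm may be treated as one complex matrix.\<close>

lemma norm_cplx_sa:
  assumes "adj_fmat X = X" "adj_fmat Y = Y"
  shows "(norm (X + cscale \<i> Y))\<^sup>2 = (norm X)\<^sup>2 + (norm Y)\<^sup>2"
proof -
  have "complex_of_real ((norm (X + cscale \<i> Y))\<^sup>2) = ftr (X * X) + ftr (Y * Y) + \<i> * ftr (X * Y) - \<i> * ftr (Y * X)"
    unfolding norm_sq_ftr
    by (simp add: adj_add adj_cscale assms distrib_left left_diff_distrib cscale_mult_left cscale_mult_right
        ftr_add ftr_diff ftr_cscale cscale_simps algebra_simps)
  also have "\<dots> = complex_of_real ((norm X)\<^sup>2 + (norm Y)\<^sup>2)"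
    unfolding of_real_add norm_sq_ftr by (simp add: assms ftr_commute[of Y X])
  finally show ?thesis by (simp only: of_real_eq_iff)
qed

lemma mat_vol_le:
  assumes k: "0 < k" and \<rho>: "0 < \<rho>" and F: "finite F"
    and cov: "\<And>A B. [A, B] \<in> G \<Longrightarrow> \<exists>X\<in>F. norm (fm k A + cscale \<i> (fm k B) - X) \<le> \<rho>"
  shows "mat_vol 2 k G \<le> ennreal (real (card F) * (exp (1/2) * sqrt (2 * pi * ((2 * \<rho>)\<^sup>2 / (2 * (real k)\<^sup>2)))) ^ (2 * k\<^sup>2))"
proof -
  let ?I = "{..<2::nat} \<times> ({..<k} \<times> {..<k})"
  let ?V = "PiM ?I (\<lambda>_. lborel :: real measure)"
  define \<Phi> where "\<Phi> c = fm k (sa_mat k (\<lambda>p. c (0, p))) + cscale \<i> (fm k (sa_mat k (\<lambda>p. c (1, p))))" for c :: "nat \<times> nat \<times> nat \<Rightarrow> real"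
  let ?S = "{c \<in> space ?V. map (\<lambda>l. sa_mat k (\<lambda>p. c (l, p))) [0..<2] \<in> G}"
  have dist: "(norm (\<Phi> c - \<Phi> c'))\<^sup>2 = (\<Sum>i\<in>?I. (c i - c' i)\<^sup>2)" for c c'
  proof -
    have "\<Phi> c - \<Phi> c' = fm k (sa_mat k (\<lambda>p. c (0, p) - c' (0, p))) + cscale \<i> (fm k (sa_mat k (\<lambda>p. c (1, p) - c' (1, p))))"
      unfolding \<Phi>_def fm_sa_mat_diff[symmetric] by (simp add: cscale_simps)
    then have "(norm (\<Phi> c - \<Phi> c'))\<^sup>2 = (\<Sum>p\<in>{..<k}\<times>{..<k}. (c (0, p) - c' (0, p))\<^sup>2) + (\<Sum>p\<in>{..<k}\<times>{..<k}. (c (1, p) - c' (1, p))\<^sup>2)"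
      by (simp only: norm_cplx_sa[OF adj_sa_mat adj_sa_mat] norm_sa_mat)
    also have "\<dots> = (\<Sum>l<2. \<Sum>p\<in>{..<k}\<times>{..<k}. (c (l, p) - c' (l, p))\<^sup>2)"
      by (simp add: numeral_2_eq_2)
    finally show ?thesis by (simp add: sum.cartesian_product split_beta)
  qed
  \<comment> \<open>The volume bound for balls needs a centre given by coordinates, which a point X
    of the cover may lack. A point of the set within \<rho> of X replaces it, at the price of
    doubling the radius.\<close>
  define F' where "F' = {X\<in>F. \<exists>c\<in>?S. norm (\<Phi> c - X) \<le> \<rho>}"
  have "\<forall>X\<in>F'. \<exists>c. c \<in> ?S \<and> norm (\<Phi> c - X) \<le> \<rho>" unfolding F'_def by blast
  from bchoice[OF this] obtain a where a: "\<forall>X\<in>F'. a X \<in> ?S \<and> norm (\<Phi> (a X) - X) \<le> \<rho>" by (rule exE)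
  let ?B = "\<lambda>X. {c \<in> space ?V. (\<Sum>i\<in>?I. (c i - a X i)\<^sup>2) \<le> (2 * \<rho>)\<^sup>2}"
  have B: "?B X \<in> sets ?V" for X by measurable
  have fF: "finite F'" using F by (simp add: F'_def)
  have "?S \<subseteq> (\<Union>X\<in>F'. ?B X)"
  proof
    fix c assume c: "c \<in> ?S"
    then have "[sa_mat k (\<lambda>p. c (0, p)), sa_mat k (\<lambda>p. c (1, p))] \<in> G"
      by (simp add: numeral_2_eq_2)
    from cov[OF this] obtain X where X: "X \<in> F" "norm (\<Phi> c - X) \<le> \<rho>" unfolding \<Phi>_def by (rule bexE)
    then have X': "X \<in> F'" using c unfolding F'_def by blast
    have "norm (\<Phi> c - \<Phi> (a X)) \<le> 2 * \<rho>"
      using norm_triangle_ineq[of "\<Phi> c - X" "X - \<Phi> (a X)"] X(2) a X' norm_minus_commute[of X "\<Phi> (a X)"] by fastforce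
    then have "(norm (\<Phi> c - \<Phi> (a X)))\<^sup>2 \<le> (2 * \<rho>)\<^sup>2" by (intro power_mono) auto
    then have "c \<in> ?B X" using c by (simp add: dist)
    then show "c \<in> (\<Union>X\<in>F'. ?B X)" using X' by blast
  qed
  \<comment> \<open>Monotonicity asks for measurability of the larger set only, so G may be
    arbitrary.\<close>
  then have "emeasure ?V ?S \<le> emeasure ?V (\<Union>X\<in>F'. ?B X)"
    using B fF by (intro emeasure_mono) auto
  also have "\<dots> \<le> (\<Sum>X\<in>F'. emeasure ?V (?B X))"
    using B fF by (intro emeasure_subadditive_finite) auto
  also have "\<dots> \<le> (\<Sum>X\<in>F'. ennreal ((exp (1/2) * sqrt (2 * pi * ((2 * \<rho>)\<^sup>2 / real (card ?I)))) ^ card ?I))"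
    using k \<rho> by (intro sum_mono emeasure_PiM_ball_le) (auto simp: lessThan_empty_iff)
  also have "\<dots> = ennreal (real (card F') * (exp (1/2) * sqrt (2 * pi * ((2 * \<rho>)\<^sup>2 / (2 * (real k)\<^sup>2)))) ^ (2 * k\<^sup>2))"
    by (simp add: ennreal_mult power2_eq_square ennreal_of_nat_eq_real_of_nat)
  also have "\<dots> \<le> ennreal (real (card F) * (exp (1/2) * sqrt (2 * pi * ((2 * \<rho>)\<^sup>2 / (2 * (real k)\<^sup>2)))) ^ (2 * k\<^sup>2))"
    using F by (intro ennreal_leI mult_right_mono) (auto simp: F'_def intro: card_mono)
  finally show ?thesis unfolding mat_vol_def Let_def .
qed

section \<open>Undoing the semicircular perturbation\<close>

text \<open>\<open>shift_words e f w\<close> is the value at the word \<open>w\<close> of the linear functional \<open>f\<close> after the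
  substitution \<open>x\<^sub>i \<mapsto> x\<^sub>i + e s\<^sub>i\<close> (\<open>i < 2\<close>), where \<open>s\<^sub>i\<close> has the letter \<open>3 + i\<close>.\<close>

fun shift_words :: "complex \<Rightarrow> (nat list \<Rightarrow> complex) \<Rightarrow> nat list \<Rightarrow> complex" where
  "shift_words e f [] = f []"
| "shift_words e f (i # w) = shift_words e (\<lambda>v. f (i # v)) w +
     (if i < 2 then e * shift_words e (\<lambda>v. f ((3 + i) # v)) w else 0)"

lemma shift_words_add: "shift_words e (\<lambda>v. f v + c * g v) w = shift_words e f w + c * shift_words e g w"
proof (induction w arbitrary: f g)
  case (Cons i w)
  show ?case using Cons[of "\<lambda>v. f (i # v)" "\<lambda>v. g (i # v)"] Cons[of "\<lambda>v. f ((3 + i) # v)" "\<lambda>v. g ((3 + i) # v)"]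
    by (simp add: algebra_simps)
qed simp

text \<open>The inversion is exact because the inserted letters 3 and 4 are not themselves
  substituted.\<close>

lemma shift_words_inverse: "shift_words (- e) (shift_words e f) w = f w"
proof (induction w arbitrary: f)
  case (Cons i w)
  let ?f = "\<lambda>j v. f (j # v)"
  have s: "shift_words e f (j # v) = shift_words e (?f j) v + (if j < 2 then e else 0) * shift_words e (?f (3 + j)) v" for j v
    by simp
  have "shift_words (- e) (shift_words e f) (i # w) = shift_words (-e) (\<lambda>v. shift_words e f (i # v)) w
     + (if i < 2 then - e * shift_words (-e) (\<lambda>v. shift_words e f ((3 + i) # v)) w else 0)"
    by (rule shift_words.simps(2))
  also have "\<dots> = f (i # w)"
    unfolding s shift_words_add Cons by simp
  finally show ?case .
qed simp

text \<open>Each letter at most doubles the number of words, whence the power of 2; words in the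
  letters below 3 expand into words in the letters below 5.\<close>

lemma shift_words_bound:
  assumes "\<And>v. length v = length w \<Longrightarrow> set v \<subseteq> {..<5} \<Longrightarrow> cmod (f v) \<le> B" "set w \<subseteq> {..<3}" "cmod e \<le> 1" "0 \<le> B"
  shows "cmod (shift_words e f w) \<le> 2 ^ length w * B"
  using assms
proof (induction w arbitrary: f)
  case (Cons i w)
  have 1: "cmod (shift_words e (\<lambda>v. f (i # v)) w) \<le> 2 ^ length w * B"
    using Cons.prems by (intro Cons.IH) auto
  show ?case
  proof (cases "i < 2")
    case True
    have 2: "cmod (shift_words e (\<lambda>v. f ((3 + i) # v)) w) \<le> 2 ^ length w * B"
      using Cons.prems True by (intro Cons.IH) auto
    have "cmod (shift_words e f (i # w)) \<le> 2 ^ length w * B + cmod e * (2 ^ length w * B)"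
      using True by (simp add: norm_mult) (intro order_trans[OF norm_triangle_ineq] add_mono 1, simp add: norm_mult mult_left_mono[OF 2])
    also have "\<dots> \<le> 2 ^ length w * B + 1 * (2 ^ length w * B)"
      using Cons.prems by (intro add_left_mono mult_right_mono) auto
    finally show ?thesis by (simp del: shift_words.simps add: algebra_simps)
  next
    case False
    have "0 \<le> 2 ^ length w * B" using Cons.prems by simp
    moreover have "cmod (shift_words e f (i # w)) \<le> 2 ^ length w * B" using 1 False by simp
    ultimately show ?thesis unfolding length_Cons power_Suc by linarith
  qed
qed simp

section \<open>Perturbed laws and traces of substituted words\<close>

lemma law_lin_superset:
  assumes "finite S" "Poly_Mapping.keys p \<subseteq> S"
  shows "law_lin \<nu> p = (\<Sum>w\<in>S. Poly_Mapping.lookup p w * \<nu> w)"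
  unfolding law_lin_def using assms by (intro sum.mono_neutral_left) (auto simp: in_keys_iff)

lemma law_lin_add: "law_lin \<nu> (p + q) = law_lin \<nu> p + law_lin \<nu> q"
proof -
  let ?S = "Poly_Mapping.keys p \<union> Poly_Mapping.keys q"
  have "law_lin \<nu> (p + q) = (\<Sum>w\<in>?S. Poly_Mapping.lookup (p + q) w * \<nu> w)"
    using Poly_Mapping.keys_add[of p q] by (intro law_lin_superset) simp_all
  also have "\<dots> = (\<Sum>w\<in>?S. Poly_Mapping.lookup p w * \<nu> w) + (\<Sum>w\<in>?S. Poly_Mapping.lookup q w * \<nu> w)"
    by (simp add: lookup_add distrib_right sum.distrib)
  also have "\<dots> = law_lin \<nu> p + law_lin \<nu> q"
    by (simp add: law_lin_superset[of ?S])
  finally show ?thesis .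
qed

lemma law_lin_single: "law_lin \<nu> (Poly_Mapping.single w c) = c * \<nu> w"
  by (simp add: law_lin_def)

lemma perturbed_law_shift_words:
  assumes "set w \<subseteq> {..<5}"
  shows "perturbed_law 2 1 \<epsilon> \<nu> w = shift_words (complex_of_real \<epsilon>) \<nu> w"
proof -
  let ?g = "\<lambda>i. if i < 2 then letter i + Poly_Mapping.single [2 + 1 + i] (complex_of_real \<epsilon>) else letter i"
  \<comment> \<open>The induction carries the prefix v already expanded and its coefficient c,
    because a substituted letter splits the product into two terms with different prefixes.\<close>
  have "law_lin \<nu> (Poly_Mapping.single v c * prod_list (map ?g w)) = c * shift_words (complex_of_real \<epsilon>) (\<lambda>u. \<nu> (v @ u)) w"
    for v c
  proof (induction w arbitrary: v c)
    case Nil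
    show ?case by (simp add: law_lin_single)
  next
    case (Cons i w)
    show ?case
    proof (cases "i < 2")
      case True
      have "Poly_Mapping.single v c * prod_list (map ?g (i # w)) =
        Poly_Mapping.single (v @ [i]) c * prod_list (map ?g w) + Poly_Mapping.single (v @ [3 + i]) (c * complex_of_real \<epsilon>) * prod_list (map ?g w)"
        using True by (simp add: letter_def distrib_left distrib_right mult.assoc[symmetric] mult_single plus_list_def)
      then show ?thesis using True by (simp only: law_lin_add Cons) (simp add: algebra_simps)
    next
      case False
      have "Poly_Mapping.single v c * prod_list (map ?g (i # w)) = Poly_Mapping.single (v @ [i]) c * prod_list (map ?g w)"
        using False by (simp add: letter_def mult.assoc[symmetric] mult_single plus_list_def)
      then show ?thesis using False by (simp only: Cons) simp
    qed
  qed
  from this[of "[]" 1] have "law_lin \<nu> (1 * prod_list (map ?g w)) = shift_words (complex_of_real \<epsilon>) \<nu> w"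
    unfolding single_one[symmetric] zero_list_def by simp
  then show ?thesis unfolding perturbed_law_def mult_1_left .
qed

text \<open>The matrix version of the same expansion; \<open>Z\<close> collects the factors already
  read.\<close>

lemma ftr_shift_words:
  fixes X :: "nat \<Rightarrow> fmat" and e :: complex
  defines "Y \<equiv> \<lambda>i. if i < 2 then X i - cscale e (X (3 + i)) else X i"
  shows "ftr (Z * foldr (*) (map Y w) J) = shift_words (- e) (\<lambda>u. ftr (Z * foldr (*) (map X u) J)) w"
proof (induction w arbitrary: Z)
  case (Cons i w)
  show ?case
  proof (cases "i < 2")
    case True
    have "ftr (Z * foldr (*) (map Y (i # w)) J) = ftr ((Z * X i) * foldr (*) (map Y w) J) - e * ftr ((Z * X (3 + i)) * foldr (*) (map Y w) J)"
      using True by (simp add: Y_def left_diff_distrib right_diff_distrib ftr_diff ftr_cscale cscale_mult_left cscale_mult_right mult.assoc)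
    then show ?thesis using True unfolding Cons by (simp add: mult.assoc)
  next
    case False
    have "ftr (Z * foldr (*) (map Y (i # w)) J) = ftr ((Z * X i) * foldr (*) (map Y w) J)"
      using False by (simp add: Y_def mult.assoc)
    then show ?thesis using False unfolding Cons by (simp add: mult.assoc)
  qed
qed simp

lemma bd_foldr: "(\<And>i. bd k (Z i)) \<Longrightarrow> bd k (foldr (*) (map Z w) (idm k))"
  by (induction w) (simp_all add: bd_mult)

lemma microstates_close:
  assumes As: "As \<in> microstates 5 (perturbed_law 2 1 \<epsilon> \<nu>) R m k \<gamma>"
    and w: "set w \<subseteq> {..<5}" "length w \<le> m"
  shows "cmod (ftr (foldr (*) (map (\<lambda>i. fm k (As ! i)) w) (idm k)) / of_nat k - shift_words (complex_of_real \<epsilon>) \<nu> w) < \<gamma>"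
proof -
  have "As ! i \<in> carrier_mat k k" if "i < 5" for i
    using As that by (auto simp: microstates_def selfadjoint_mat_def)
  then have "fm k (foldr (*) (map (\<lambda>i. As ! i) w) (1\<^sub>m k)) = foldr (*) (map (\<lambda>i. fm k (As ! i)) w) (idm k)"
    using fm_foldr[of w "\<lambda>i. As ! i" k] w(1) by force
  moreover have "cmod (tr k (foldr (*) (map (\<lambda>i. As ! i) w) (1\<^sub>m k)) - perturbed_law 2 1 \<epsilon> \<nu> w) < \<gamma>"
    using As w by (auto simp: microstates_def)
  ultimately show ?thesis unfolding tr_fm perturbed_law_shift_words[OF w(1)] by simp
qed

text \<open>The traces of words in X are close to \<nu> after the substitution x + \<epsilon> s. The
  inverse substitution, applied to both, turns the former into traces of words in \<open>Y\<close>
  and the latter into \<nu> itself; it multiplies the tolerance by at most the number of words that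
  it produces.\<close>

lemma microstates_unperturbed:
  fixes As :: "complex mat list" and k :: nat and \<epsilon> :: real
  defines "X \<equiv> \<lambda>i. fm k (As ! i)"
  defines "Y \<equiv> \<lambda>i. if i < 2 then X i - cscale (complex_of_real \<epsilon>) (X (3 + i)) else X i"
  assumes As: "As \<in> microstates 5 (perturbed_law 2 1 \<epsilon> \<nu>) R m k \<gamma>" and eps: "0 < \<epsilon>" "\<epsilon> \<le> 1"
    and w: "set w \<subseteq> {..<3}" "length w \<le> m" and \<gamma>: "0 < \<gamma>"
  shows "cmod (ftr (foldr (*) (map Y w) (idm k)) / of_nat k - \<nu> w) \<le> 2 ^ length w * \<gamma>"
proof -
  let ?e = "complex_of_real \<epsilon>"
  let ?T = "\<lambda>u. ftr (idm k * foldr (*) (map X u) (idm k))"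
  let ?P = "shift_words ?e \<nu>"
  have bXi: "bd k (X i)" for i by (simp add: X_def)
  have bYi: "bd k (Y i)" for i using bXi by (simp add: Y_def bd_diff bd_cscale)
  have close: "cmod (inverse (of_nat k) * ?T u + (-1) * ?P u) \<le> \<gamma>" if u: "length u = length w" "set u \<subseteq> {..<5}" for u
    using microstates_close[OF As u(2)] u(1) w(2)
    by (simp add: X_def idm_mult bd_foldr divide_inverse mult.commute)
  \<comment> \<open>Linearity, from the rule for one coefficient; the last instance below says that
    the zero functional is sent to zero.\<close>
  have "shift_words (- ?e) (\<lambda>u. inverse (of_nat k) * ?T u + (-1) * ?P u) w
     = inverse (of_nat k) * shift_words (- ?e) ?T w + (-1) * shift_words (- ?e) ?P w"
    using shift_words_add[of "- ?e" "\<lambda>u. 0 + inverse (of_nat k) * ?T u" "-1" ?P w]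
      shift_words_add[of "- ?e" "\<lambda>u. 0" "inverse (of_nat k)" ?T w] shift_words_add[of "- ?e" "\<lambda>u. 0" "-1" "\<lambda>u. 0" w]
    by simp
  also have "\<dots> = ftr (foldr (*) (map Y w) (idm k)) / of_nat k - \<nu> w"
    unfolding shift_words_inverse ftr_shift_words[symmetric] Y_def[symmetric] idm_mult[OF bd_foldr[OF bYi]]
    by (simp add: divide_inverse mult.commute)
  finally have eq: "ftr (foldr (*) (map Y w) (idm k)) / of_nat k - \<nu> w = shift_words (- ?e) (\<lambda>u. inverse (of_nat k) * ?T u + (-1) * ?P u) w" by simp
  show ?thesis unfolding eq
    using close w(1) eps \<gamma> by (intro shift_words_bound) auto
qed

section \<open>Weak approximation on the unit square\<close>

abbreviation "unit_square \<equiv> lebesgue_on ({0..1::real} \<times> {0..1::real})"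

section \<open>Polynomials in two variables and their moments\<close>

definition poly2_eval :: "(real \<times> nat \<times> nat) list \<Rightarrow> real \<Rightarrow> real \<Rightarrow> real" where
  "poly2_eval as x y = (\<Sum>(a, p, q)\<leftarrow>as. a * x ^ p * y ^ q)"

lemma poly2_eval_append: "poly2_eval (as @ bs) x y = poly2_eval as x y + poly2_eval bs x y"
  by (simp add: poly2_eval_def)

lemma poly2_eval_monom_mult:
  "poly2_eval (map (\<lambda>(b, p', q'). (a * b, p + p', q + q')) bs) x y = a * x ^ p * y ^ q * poly2_eval bs x y"
  by (induction bs) (auto simp: poly2_eval_def power_add algebra_simps)

lemma poly2_eval_mult: "\<exists>cs. \<forall>x y. poly2_eval cs x y = poly2_eval as x y * poly2_eval bs x y"
proof (induction as)
  case Nil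
  show ?case by (intro exI[of _ "[]"]) (simp add: poly2_eval_def)
next
  case (Cons t as)
  obtain a p q where t: "t = (a, p, q)" by (cases t)
  obtain cs where cs: "\<forall>x y. poly2_eval cs x y = poly2_eval as x y * poly2_eval bs x y" using Cons by (rule exE)
  show ?case
  proof (intro exI allI)
    fix x y
    show "poly2_eval (map (\<lambda>(b, p', q'). (a * b, p + p', q + q')) bs @ cs) x y = poly2_eval (t # as) x y * poly2_eval bs x y"
      unfolding poly2_eval_append poly2_eval_monom_mult cs[rule_format]
      by (simp add: t poly2_eval_def algebra_simps)
  qed
qed

text \<open>Stone-Weierstrass yields a polynomial in the sense of an inductive predicate, whereas
  microstates control moments; so it has to be written out in monomials.\<close>

lemma real_polynomial_function_poly2:
  "real_polynomial_function (g :: real \<times> real \<Rightarrow> real) \<Longrightarrow> \<exists>as. \<forall>x y. g (x, y) = poly2_eval as x y"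
proof (induction rule: real_polynomial_function.induct)
  case (linear f)
  have "f (x, y) = poly2_eval [(f (1, 0), 1, 0), (f (0, 1), 0, 1)] x y" for x y
  proof -
    have "f (x, y) = f (x *\<^sub>R (1, 0) + y *\<^sub>R (0, 1))" by simp
    also have "\<dots> = x * f (1, 0) + y * f (0, 1)"
      using linear by (simp only: linear_simps real_scaleR_def)
    finally show ?thesis by (simp add: poly2_eval_def)
  qed
  then show ?case by blast
next
  case (const c)
  show ?case by (intro exI[of _ "[(c, 0, 0)]"]) (simp add: poly2_eval_def)
next
  case (add f g)
  then obtain as bs where "\<forall>x y. f (x, y) = poly2_eval as x y" "\<forall>x y. g (x, y) = poly2_eval bs x y" by blast
  then show ?case by (intro exI[of _ "as @ bs"]) (simp add: poly2_eval_append)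
next
  case (mult f g)
  then obtain as bs where 1: "\<forall>x y. f (x, y) = poly2_eval as x y" "\<forall>x y. g (x, y) = poly2_eval bs x y" by blast
  obtain cs where "\<forall>x y. poly2_eval cs x y = poly2_eval as x y * poly2_eval bs x y"
    using poly2_eval_mult by blast
  then show ?case using 1 by (intro exI[of _ cs]) simp
qed

lemma integrable_unit_square_mult:
  fixes h \<phi> :: "real \<times> real \<Rightarrow> real"
  assumes h: "integrable unit_square h" and \<phi>: "continuous_on UNIV \<phi>"
  shows "integrable unit_square (\<lambda>z. \<phi> z * h z)"
proof -
  let ?S = "{0..1::real} \<times> {0..1::real}"
  have "compact (\<phi> ` ?S)"
    using \<phi> by (intro compact_continuous_image compact_Times) (auto intro: continuous_on_subset)
  then have "bounded (\<phi> ` ?S)" by (rule compact_imp_bounded)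
  then obtain B where B: "\<And>z. z \<in> ?S \<Longrightarrow> norm (\<phi> z) \<le> B" by (auto simp: bounded_iff)
  have m: "\<phi> \<in> borel_measurable unit_square"
    using borel_measurable_continuous_onI[OF \<phi>] by (simp add: measurable_restrict_space1 measurable_completion)
  show ?thesis
  proof (rule Bochner_Integration.integrable_bound[where f = "\<lambda>z. B * h z"])
    show "integrable unit_square (\<lambda>z. B * h z)" using h by simp
    show "(\<lambda>z. \<phi> z * h z) \<in> borel_measurable unit_square" using m h by measurable
    show "AE z in unit_square. norm (\<phi> z * h z) \<le> norm (B * h z)"
    proof (rule AE_I2)
      fix z assume "z \<in> space unit_square"
      then have "norm (\<phi> z) \<le> \<bar>B\<bar>" using B[of z] by (auto intro: order_trans[OF _ abs_ge_self])
      then show "norm (\<phi> z * h z) \<le> norm (B * h z)" by (simp add: norm_mult abs_mult mult_right_mono)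
    qed
  qed
qed

lemma continuous_monom2: "continuous_on UNIV (\<lambda>z::real\<times>real. fst z ^ p * snd z ^ q)"
  by (intro continuous_intros)

lemma integral_poly2:
  assumes h: "integrable unit_square h"
  shows "(\<integral>z. poly2_eval as (fst z) (snd z) * h z \<partial>unit_square)
    = (\<Sum>(a, p, q)\<leftarrow>as. a * (\<integral>z. fst z ^ p * snd z ^ q * h z \<partial>unit_square))
    \<and> integrable unit_square (\<lambda>z. poly2_eval as (fst z) (snd z) * h z)"
proof (induction as)
  case Nil
  show ?case by (simp add: poly2_eval_def)
next
  case (Cons t as)
  obtain a p q where t: "t = (a, p, q)" by (cases t)
  have e: "poly2_eval (t # as) x y * c = a * (x ^ p * y ^ q * c) + poly2_eval as x y * c" for x y c
    by (simp add: t poly2_eval_def algebra_simps)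
  have "integrable unit_square (\<lambda>z. fst z ^ p * snd z ^ q * h z)"
    by (rule integrable_unit_square_mult[OF h continuous_monom2])
  then show ?case using Cons unfolding e by (simp add: t)
qed

text \<open>Stone-Weierstrass reduces \<phi> to a polynomial, hence to finitely many moments. The
  order m and the tolerance are fixed before the set J of atoms: J will be the set of positions of a
  k x k matrix, with atoms at pairs of eigenvalues, so nothing depends on k.\<close>

lemma weak_approximation:
  fixes \<phi> h :: "real \<times> real \<Rightarrow> real"
  assumes \<phi>: "continuous_on UNIV \<phi>" and h: "integrable unit_square h" and \<theta>: "0 < \<theta>"
  shows "\<exists>m. \<exists>\<delta>>0. \<forall>(J :: 'i set) w x y. finite J \<longrightarrow>
    (\<forall>i\<in>J. 0 \<le> w i \<and> \<bar>x i\<bar> \<le> R \<and> \<bar>y i\<bar> \<le> R) \<longrightarrow>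
    (\<forall>p q. p + q \<le> m \<longrightarrow> \<bar>(\<Sum>i\<in>J. w i * (x i ^ p * y i ^ q)) - (\<integral>z. fst z ^ p * snd z ^ q * h z \<partial>unit_square)\<bar> \<le> \<delta>) \<longrightarrow>
    (\<Sum>i\<in>J. w i * \<phi> (x i, y i)) \<le> (\<integral>z. \<phi> z * h z \<partial>unit_square) + \<theta>"
proof -
  let ?I = "\<lambda>f. \<integral>z. f z * h z \<partial>unit_square"
  define c where "c = (\<integral>z. \<bar>h z\<bar> \<partial>unit_square)"
  have c: "0 \<le> c" by (simp add: c_def)
  \<comment> \<open>The error t gets multiplied by the total mass c of |h| and by the total weight
    of the atoms, which the moment of order zero bounds by c + 1.\<close>
  define t where "t = \<theta> / 4 / (c + 1)"
  have t: "0 < t" using \<theta> c by (simp add: t_def)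
  \<comment> \<open>The region must contain both the atoms and the unit square, over which h is
    integrated.\<close>
  let ?R = "max R 1"
  let ?C = "{-?R..?R} \<times> {-?R..?R}"
  obtain g where g: "real_polynomial_function g" "\<And>z. z \<in> ?C \<Longrightarrow> \<bar>\<phi> z - g z\<bar> < t"
    by (rule Stone_Weierstrass_real_polynomial_function[of ?C \<phi> t])
      (use t \<phi> in \<open>auto intro: compact_Times continuous_on_subset\<close>)
  obtain as where as: "\<And>x y. g (x, y) = poly2_eval as x y"
    using real_polynomial_function_poly2[OF g(1)] by blast
  have gz: "g z = poly2_eval as (fst z) (snd z)" for z using as[of "fst z" "snd z"] by simp
  define A where "A = (\<Sum>(a, p, q)\<leftarrow>as. \<bar>a\<bar>)"
  have A: "0 \<le> A" unfolding A_def by (rule sum_list_nonneg) auto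
  define \<delta> where "\<delta> = min 1 (\<theta> / (4 * (A + 1)))"
  have \<delta>: "0 < \<delta>" "\<delta> \<le> 1" "A * \<delta> \<le> \<theta> / 4"
  proof -
    show "0 < \<delta>" "\<delta> \<le> 1" using \<theta> A by (auto simp: \<delta>_def)
    have "A * \<delta> \<le> A * (\<theta> / (4 * (A + 1)))" using A by (intro mult_left_mono) (simp_all add: \<delta>_def)
    also have "\<dots> \<le> \<theta> / 4" using A \<theta> by (simp add: field_simps)
    finally show "A * \<delta> \<le> \<theta> / 4" .
  qed
  define m where "m = (\<Sum>(a, p, q)\<leftarrow>as. p + q)"
  have m: "p + q \<le> m" if "(a, p, q) \<in> set as" for a p q
    using member_le_sum_list[of "p + q" "map (\<lambda>(a, p, q). p + q) as"] that by (force simp: m_def)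
  have Ig: "?I g \<le> ?I \<phi> + t * c"
  proof -
    have "?I g - ?I \<phi> = (\<integral>z. (g z - \<phi> z) * h z \<partial>unit_square)"
      using integral_poly2[OF h, of as] integrable_unit_square_mult[OF h \<phi>]
      by (subst Bochner_Integration.integral_diff[symmetric]) (simp_all add: gz left_diff_distrib)
    also have "\<dots> \<le> (\<integral>z. t * \<bar>h z\<bar> \<partial>unit_square)"
    proof (rule integral_mono)
      show "integrable unit_square (\<lambda>z. (g z - \<phi> z) * h z)"
        using integral_poly2[OF h, of as] integrable_unit_square_mult[OF h \<phi>] by (simp add: gz left_diff_distrib)
      show "integrable unit_square (\<lambda>z. t * \<bar>h z\<bar>)" using h by simp
      fix z assume "z \<in> space unit_square"
      then have "\<bar>\<phi> z - g z\<bar> < t" by (intro g) (auto simp: le_max_iff_disj)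
      then have "\<bar>g z - \<phi> z\<bar> * \<bar>h z\<bar> \<le> t * \<bar>h z\<bar>" by (intro mult_right_mono) auto
      then show "(g z - \<phi> z) * h z \<le> t * \<bar>h z\<bar>" by (metis abs_mult abs_le_D1)
    qed
    finally show ?thesis by (simp add: c_def)
  qed
  have main: "(\<Sum>i\<in>J. w i * \<phi> (x i, y i)) \<le> ?I \<phi> + \<theta>"
    if J: "finite J" and w: "\<forall>i\<in>J. 0 \<le> w i \<and> \<bar>x i\<bar> \<le> R \<and> \<bar>y i\<bar> \<le> R"
      and mom: "\<forall>p q. p + q \<le> m \<longrightarrow> \<bar>(\<Sum>i\<in>J. w i * (x i ^ p * y i ^ q)) - ?I (\<lambda>z. fst z ^ p * snd z ^ q)\<bar> \<le> \<delta>"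
    for J :: "'i set" and w x y
  proof -
    have tot: "(\<Sum>i\<in>J. w i) \<le> c + 1"
    proof -
      have "\<bar>(\<Sum>i\<in>J. w i) - (\<integral>z. h z \<partial>unit_square)\<bar> \<le> \<delta>" using mom[rule_format, of 0 0] by simp
      moreover have "(\<integral>z. h z \<partial>unit_square) \<le> c" unfolding c_def
        using h by (intro integral_mono) auto
      ultimately show ?thesis using \<delta>(2) by linarith
    qed
    have "(\<Sum>i\<in>J. w i * \<phi> (x i, y i)) \<le> (\<Sum>i\<in>J. w i * g (x i, y i) + w i * t)"
    proof (rule sum_mono)
      fix i assume i: "i \<in> J"
      have "\<bar>\<phi> (x i, y i) - g (x i, y i)\<bar> < t"
        using w i by (intro g) (auto simp: abs_le_iff le_max_iff_disj)
      then have "w i * \<phi> (x i, y i) \<le> w i * (g (x i, y i) + t)" using w i by (intro mult_left_mono) auto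
      then show "w i * \<phi> (x i, y i) \<le> w i * g (x i, y i) + w i * t" by (simp add: distrib_left)
    qed
    also have "\<dots> = (\<Sum>i\<in>J. w i * g (x i, y i)) + (\<Sum>i\<in>J. w i) * t"
      by (simp add: sum.distrib sum_distrib_right)
    also have "(\<Sum>i\<in>J. w i * g (x i, y i)) \<le> ?I g + A * \<delta>"
    proof -
      have "(\<Sum>i\<in>J. w i * poly2_eval bs (x i) (y i)) \<le> (\<Sum>(a, p, q)\<leftarrow>bs. a * ?I (\<lambda>z. fst z ^ p * snd z ^ q)) + (\<Sum>(a, p, q)\<leftarrow>bs. \<bar>a\<bar>) * \<delta>"
        if "set bs \<subseteq> set as" for bs
        using that
      proof (induction bs)
        case Nil
        show ?case by (simp add: poly2_eval_def)
      next
        case (Cons s bs)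
        obtain a p q where s: "s = (a, p, q)" by (cases s)
        let ?M = "\<Sum>i\<in>J. w i * (x i ^ p * y i ^ q)" and ?N = "?I (\<lambda>z. fst z ^ p * snd z ^ q)"
        have "p + q \<le> m" using Cons.prems s m by auto
        then have "\<bar>?M - ?N\<bar> \<le> \<delta>" using mom by blast
        then have "\<bar>a * (?M - ?N)\<bar> \<le> \<bar>a\<bar> * \<delta>" by (simp add: abs_mult mult_left_mono)
        then have 1: "a * ?M \<le> a * ?N + \<bar>a\<bar> * \<delta>" by (simp add: right_diff_distrib abs_le_iff)
        have "(\<Sum>i\<in>J. w i * poly2_eval (s # bs) (x i) (y i)) = a * ?M + (\<Sum>i\<in>J. w i * poly2_eval bs (x i) (y i))"
          by (simp add: s poly2_eval_def distrib_left sum.distrib sum_distrib_left mult_ac)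
        then show ?case using 1 Cons by (simp add: s distrib_right)
      qed
      from this[of as] show ?thesis using integral_poly2[OF h, of as] by (simp add: gz A_def)
    qed
    also have "(\<Sum>i\<in>J. w i) * t \<le> (c + 1) * t" using tot t by (intro mult_right_mono) auto
    also have "?I g + A * \<delta> + (c + 1) * t \<le> ?I \<phi> + t * c + \<theta> / 4 + (c + 1) * t"
      using Ig \<delta>(3) by linarith
    also have "\<dots> \<le> ?I \<phi> + \<theta>"
    proof -
      have "c + 1 \<noteq> 0" using c by simp
      then have "(c + 1) * (s / (c + 1)) = s" for s :: real by simp
      then have ct: "(c + 1) * t = \<theta> / 4" unfolding t_def .
      have "t * c \<le> (c + 1) * t" using t by (simp add: algebra_simps)
      then show ?thesis using ct \<theta> by linarith
    qed
    finally show ?thesis by linarith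
  qed
  show ?thesis
  proof (intro exI[of _ m] exI[of _ \<delta>] conjI \<delta>(1) allI impI, goal_cases)
    case (1 J w x y)
    then show ?case by (rule main)
  qed
qed

section \<open>A continuous function separating the support of \<open>H\<close>\<close>

lemma indicator_unit_square:
  assumes A: "A \<in> lmeasurable" "A \<subseteq> {0..1} \<times> {0..1}"
  shows "integrable unit_square (\<lambda>z. indicator A z :: real)"
    and "(\<integral>z. indicator A z \<partial>unit_square) = measure lebesgue A"
proof -
  have Q: "{0..1::real} \<times> {0..1::real} \<in> sets lebesgue"
    by (intro fmeasurableD lmeasurable_compact compact_Times) auto
  have s: "A \<in> sets unit_square" using A Q by (subst sets_restrict_space_iff) (auto simp: fmeasurableD)
  have e: "emeasure unit_square A = emeasure lebesgue A"
    using A Q by (intro emeasure_restrict_space) auto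
  show "integrable unit_square (\<lambda>z. indicator A z :: real)"
  proof (rule integrable_real_indicator[OF s])
    show "emeasure unit_square A < \<infinity>" unfolding e using fmeasurableD2[OF A(1)] by (simp add: less_top)
  qed
  have "A \<inter> space unit_square = A" by (rule Int_absorb2[OF sets.sets_into_space[OF s]])
  then show "(\<integral>z. indicator A z \<partial>unit_square) = measure lebesgue A"
    using e by (simp add: measure_def)
qed

lemma integrable_const_unit_square: "integrable unit_square (\<lambda>z. c :: real)"
proof -
  let ?Q = "{0..1::real} \<times> {0..1::real}"
  have Q: "?Q \<in> lmeasurable" by (intro lmeasurable_compact compact_Times) auto
  have "integrable unit_square (\<lambda>z. c * indicator ?Q z)"
    by (intro integrable_mult_right indicator_unit_square Q order_refl)
  moreover have "integrable unit_square (\<lambda>z. c * indicator ?Q z) = integrable unit_square (\<lambda>z. c)"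
    by (rule Bochner_Integration.integrable_cong) auto
  ultimately show ?thesis by simp
qed

text \<open>Urysohn between a closed set inside the support and the complement of an open set around
  it. The function min 1 (2 (1 - \<phi>)) is a continuous majorant of the indicator of \<phi> \<le>
  1/2, the condition that will define K; the factor 1 gives its integral the form of
  \<open>weak_approximation\<close> with h = 1.\<close>

lemma separating_function:
  fixes H :: "real \<times> real \<Rightarrow> real"
  assumes H: "integrable unit_square H" and nn: "AE z in unit_square. 0 \<le> H z"
    and \<eta>: "0 < \<eta>" and e: "0 < e"
  defines "S \<equiv> {p \<in> {0..1} \<times> {0..1}. 0 < H p}"
  shows "\<exists>\<phi>. continuous_on UNIV \<phi> \<and> (\<forall>z. 0 \<le> \<phi> z \<and> \<phi> z \<le> 1) \<and> (\<integral>z. \<phi> z * H z \<partial>unit_square) \<le> e \<and>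
     (\<integral>z. min 1 (2 * (1 - \<phi> z)) * 1 \<partial>unit_square) \<le> measure lebesgue S + \<eta>"
proof -
  let ?Q = "{0..1::real} \<times> {0..1::real}"
  have Q: "?Q \<in> lmeasurable" by (intro lmeasurable_compact compact_Times) auto
  then have Qs: "?Q \<in> sets lebesgue" by blast
  have Hm: "H \<in> borel_measurable unit_square" using H by simp
  have S: "S \<in> sets lebesgue"
  proof -
    have "{z \<in> space unit_square. 0 < H z} \<in> sets unit_square"
      using borel_measurable_less[OF borel_measurable_const Hm] by simp
    then have "{z \<in> space unit_square. 0 < H z} \<in> sets lebesgue" using Qs by (subst (asm) sets_restrict_space_iff) auto
    then show ?thesis by (simp add: S_def space_restrict_space)
  qed
  have SQ: "S \<subseteq> ?Q" by (auto simp: S_def)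
  have Slm: "S \<in> lmeasurable" by (rule fmeasurableI2[OF Q SQ S])
  \<comment> \<open>\<open>H\<close> may be unbounded, so a small set need not carry a small
    integral. The excess of \<open>H\<close> over the height c has integral below e/2, and the rest
    contributes at most c times the measure of S - F.\<close>
  obtain c where c: "0 \<le> c" "(\<integral>z. H z - min (H z) c \<partial>unit_square) < e / 2"
  proof -
    have "(\<lambda>n. \<integral>z. H z - min (H z) (real n) \<partial>unit_square) \<longlonglongrightarrow> (\<integral>z. 0 \<partial>unit_square)"
    proof (rule integral_dominated_convergence[where w = "\<lambda>z. \<bar>H z\<bar>" and M = unit_square
          and s = "\<lambda>n z. H z - min (H z) (real n)" and f = "\<lambda>z. 0"])
      show "AE z in unit_square. (\<lambda>n. H z - min (H z) (real n)) \<longlonglongrightarrow> 0"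
      proof (rule AE_I2)
        fix z
        have "H z - min (H z) (real n) = 0" if "nat \<lceil>H z\<rceil> \<le> n" for n
          using that by (simp add: nat_le_iff ceiling_le_iff min_def)
        then have "\<forall>\<^sub>F n in sequentially. H z - min (H z) (real n) = 0"
          unfolding eventually_sequentially by blast
        then show "(\<lambda>n. H z - min (H z) (real n)) \<longlonglongrightarrow> 0" by (rule tendsto_eventually)
      qed
      show "AE z in unit_square. norm (H z - min (H z) (real n)) \<le> \<bar>H z\<bar>" for n
        by (rule AE_I2) (auto simp: min_def)
    qed (use H Hm in \<open>simp_all add: borel_measurable_diff borel_measurable_min\<close>)
    then have "\<forall>\<^sub>F n in sequentially. (\<integral>z. H z - min (H z) (real n) \<partial>unit_square) < e / 2"
      using e by (intro order_tendstoD) auto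
    then obtain n where "(\<integral>z. H z - min (H z) (real n) \<partial>unit_square) < e / 2"
      using eventually_happens'[OF sequentially_bot] by blast
    then show thesis by (intro that[of "real n"]) auto
  qed
  define d where "d = e / (2 * (c + 1))"
  have d: "0 < d" using e c by (simp add: d_def)
  obtain F where F: "closed F" "F \<subseteq> S" "S - F \<in> lmeasurable" "emeasure lebesgue (S - F) < ennreal d"
    by (rule sets_lebesgue_inner_closed[OF S d])
  obtain G where G: "open G" "S \<subseteq> G" "G - S \<in> lmeasurable" "emeasure lebesgue (G - S) < ennreal \<eta>"
    by (rule sets_lebesgue_outer_open[OF S \<eta>])
  obtain \<phi> :: "real \<times> real \<Rightarrow> real" where \<phi>: "continuous_on UNIV \<phi>" "\<And>z. \<phi> z \<in> closed_segment 0 1"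
    "\<And>z. z \<in> F \<Longrightarrow> \<phi> z = 0" "\<And>z. z \<in> - G \<Longrightarrow> \<phi> z = 1"
    by (rule Urysohn[of F "- G" 0 1]) (use F G in auto)
  have b: "0 \<le> \<phi> z" "\<phi> z \<le> 1" for z using \<phi>(2)[of z] by (auto simp: closed_segment_eq_real_ivl)
  have mSF: "measure lebesgue (S - F) \<le> d"
    using F(4) d unfolding emeasure_eq_measure2[OF F(3)] by (simp add: ennreal_less_iff)
  have mGS: "measure lebesgue (G - S) \<le> \<eta>"
    using G(4) \<eta> unfolding emeasure_eq_measure2[OF G(3)] by (simp add: ennreal_less_iff)
  have SF: "S - F \<subseteq> ?Q" using SQ by auto
  note intSF = indicator_unit_square(1)[OF F(3) SF] and valSF = indicator_unit_square(2)[OF F(3) SF]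
  have 1: "(\<integral>z. \<phi> z * H z \<partial>unit_square) \<le> e"
  proof -
    have "(\<integral>z. \<phi> z * H z \<partial>unit_square) \<le> (\<integral>z. (H z - min (H z) c) + c * indicator (S - F) z \<partial>unit_square)"
    proof (rule integral_mono_AE)
      show "integrable unit_square (\<lambda>z. \<phi> z * H z)" by (rule integrable_unit_square_mult[OF H \<phi>(1)])
      show "integrable unit_square (\<lambda>z. (H z - min (H z) c) + c * indicator (S - F) z)"
        using H intSF integrable_const_unit_square[of c] by (intro Bochner_Integration.integrable_add Bochner_Integration.integrable_diff integrable_min) auto
      show "AE z in unit_square. \<phi> z * H z \<le> (H z - min (H z) c) + c * indicator (S - F) z"
        using nn AE_space
      proof eventually_elim
        case (elim z)
        then have z: "z \<in> ?Q" "0 \<le> H z" by auto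
        have le: "\<phi> z * H z \<le> H z" using b[of z] z mult_right_mono[of "\<phi> z" 1 "H z"] by simp
        show ?case
        proof (cases "z \<in> S - F")
          case True
          then show ?thesis using le by (auto simp: min_def)
        next
          case False
          then have "z \<in> F \<or> H z = 0" using z by (auto simp: S_def)
          then have "\<phi> z * H z = 0" using \<phi>(3)[of z] by auto
          then show ?thesis using False by (auto simp: min_def)
        qed
      qed
    qed
    also have "\<dots> = (\<integral>z. H z - min (H z) c \<partial>unit_square) + c * measure lebesgue (S - F)"
    proof -
      show ?thesis using H intSF valSF integrable_const_unit_square[of c]
        by (subst Bochner_Integration.integral_add) (auto intro!: integrable_min Bochner_Integration.integrable_diff)
    qed
    also have "\<dots> \<le> e / 2 + c * d" using c mSF by (intro add_mono mult_left_mono) auto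
    also have "c * d \<le> e / 2" using c e by (simp add: d_def field_simps)
    finally show ?thesis by simp
  qed
  have 2: "(\<integral>z. min 1 (2 * (1 - \<phi> z)) * 1 \<partial>unit_square) \<le> measure lebesgue S + \<eta>"
  proof -
    have Glm: "G \<in> lmeasurable" and mG: "measure lebesgue G \<le> measure lebesgue S + \<eta>"
    proof -
      have eq: "G = S \<union> (G - S)" using G(2) by auto
      then show "G \<in> lmeasurable" using Slm G(3) fmeasurable.Un by metis
      have "measure lebesgue G \<le> measure lebesgue S + measure lebesgue (G - S)"
        using eq measure_Un_le[of S lebesgue "G - S"] S G(3) by (metis fmeasurableD)
      then show "measure lebesgue G \<le> measure lebesgue S + \<eta>" using mGS by simp
    qed
    note int1 = integrable_const_unit_square[of 1]
    have GQ: "G \<inter> ?Q \<in> lmeasurable" using Glm Qs by (rule fmeasurable_Int_fmeasurable)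
    note intG = indicator_unit_square(1)[OF GQ Int_lower2] and valG = indicator_unit_square(2)[OF GQ Int_lower2]
    have "(\<integral>z. min 1 (2 * (1 - \<phi> z)) * 1 \<partial>unit_square) \<le> (\<integral>z. indicator (G \<inter> ?Q) z \<partial>unit_square)"
    proof (rule integral_mono)
      have "continuous_on UNIV (\<lambda>z. min 1 (2 * (1 - \<phi> z)))" by (intro continuous_intros \<phi>(1))
      then show "integrable unit_square (\<lambda>z. min 1 (2 * (1 - \<phi> z)) * 1)"
        by (rule integrable_unit_square_mult[OF int1])
      fix z assume "z \<in> space unit_square"
      then show "min 1 (2 * (1 - \<phi> z)) * 1 \<le> indicator (G \<inter> ?Q) z" using \<phi>(4)[of z] by (auto simp: indicator_def)
    qed (rule intG)
    also have "\<dots> \<le> measure lebesgue G" unfolding valG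
      using Glm GQ by (intro measure_mono_fmeasurable) auto
    finally show ?thesis using mG by simp
  qed
  show ?thesis using \<phi>(1) b 1 2 by blast
qed

section \<open>Moments in the tracial von Neumann algebra\<close>

abbreviation "unit_interval \<equiv> lebesgue_on {0..1::real}"

text \<open>Lebesgue measure on the square is a completion and not a product measure. Fubini is
  therefore applied to a Borel function that equals the extension of h by zero almost everywhere,
  and the statements about sections are transferred back.\<close>

lemma unit_square_Fubini:
  fixes h :: "real \<times> real \<Rightarrow> real"
  assumes h: "integrable unit_square h"
  shows "AE x in unit_interval. integrable unit_interval (\<lambda>t. h (x, t))"
    and "(\<lambda>x. \<integral>t. h (x, t) \<partial>unit_interval) \<in> borel_measurable unit_interval"
    and "(\<integral>x. (\<integral>t. h (x, t) \<partial>unit_interval) \<partial>unit_interval) = (\<integral>z. h z \<partial>unit_square)"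
proof -
  let ?Q = "{0..1::real} \<times> {0..1::real}"
  have Q: "?Q \<in> sets lebesgue" by (intro fmeasurableD lmeasurable_compact compact_Times) auto
  have I: "{0..1::real} \<in> sets lebesgue" by simp
  define f where "f = (\<lambda>z. indicator ?Q z *\<^sub>R h z)"
  have f: "integrable lebesgue f" using h Q by (simp add: integrable_restrict_space f_def)
  have If: "(\<integral>z. f z \<partial>lebesgue) = (\<integral>z. h z \<partial>unit_square)"
    using Q by (simp add: integral_restrict_space f_def)
  obtain g where g: "g \<in> borel_measurable lborel" "AE z in lborel. f z = g z"
    using completion_ex_borel_measurable_real[of f lborel] f by auto
  have gl: "g \<in> borel_measurable lebesgue" using g(1) by (rule measurable_completion)
  have ae: "AE z in lebesgue. f z = g z" using g(2) by (rule AE_completion)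
  have fm: "f \<in> borel_measurable lebesgue" using f by (rule borel_measurable_integrable)
  have "integrable lebesgue g" using f integrable_cong_AE[OF fm gl ae] by simp
  then have gi: "integrable lborel g" using g(1) by (simp add: integrable_completion)
  have Ig: "(\<integral>z. g z \<partial>lborel) = (\<integral>z. f z \<partial>lebesgue)"
    using integral_cong_AE[OF fm gl ae] integral_completion[OF g(1)] by simp
  have gp: "integrable (lborel \<Otimes>\<^sub>M lborel) g" using gi by (simp add: lborel_prod)
  have gm: "g \<in> borel_measurable (lborel \<Otimes>\<^sub>M lborel)" using gp by (rule borel_measurable_integrable)
  have aep: "AE x in lborel. AE y in lborel. f (x, y) = g (x, y)"
  proof (rule lborel_pair.AE_pair)
    show "AE z in lborel \<Otimes>\<^sub>M lborel. f z = g z" using g(2) unfolding lborel_prod .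
  qed
  have gx: "AE x in lborel. integrable lborel (\<lambda>y. g (x, y))"
    using gp by (rule lborel_pair.AE_integrable_fst')
  have fx: "integrable lebesgue (\<lambda>y. f (x, y)) \<and> (\<integral>y. f (x, y) \<partial>lebesgue) = (\<integral>y. g (x, y) \<partial>lborel)"
    if "AE y in lborel. f (x, y) = g (x, y)" "integrable lborel (\<lambda>y. g (x, y))" for x
  proof -
    have gb: "(\<lambda>y. g (x, y)) \<in> borel_measurable lborel" using that(2) by (rule borel_measurable_integrable)
    have gbl: "(\<lambda>y. g (x, y)) \<in> borel_measurable lebesgue" using gb by (rule measurable_completion)
    have a: "AE y in lebesgue. g (x, y) = f (x, y)" using that(1) by (intro AE_completion) auto
    have fb: "(\<lambda>y. f (x, y)) \<in> borel_measurable lebesgue" by (rule borel_measurable_AE[OF gbl a])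
    have "integrable lebesgue (\<lambda>y. g (x, y))" using that(2) gb by (simp add: integrable_completion)
    then show ?thesis
      using integrable_cong_AE[OF gbl fb a] integral_cong_AE[OF gbl fb a] integral_completion[OF gb] by simp
  qed
  have aeF: "AE x in lborel. integrable lebesgue (\<lambda>y. f (x, y)) \<and> (\<integral>y. f (x, y) \<partial>lebesgue) = (\<integral>y. g (x, y) \<partial>lborel)"
    using aep gx by eventually_elim (rule fx)
  have sec: "(\<lambda>y. f (x, y)) = (\<lambda>y. indicator {0..1} x *\<^sub>R (indicator {0..1} y *\<^sub>R h (x, y)))" for x
    by (auto simp: f_def fun_eq_iff indicator_def)
  have intI: "integrable unit_interval (\<lambda>t. h (x, t))" if "x \<in> {0..1}" "integrable lebesgue (\<lambda>y. f (x, y))" for x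
    using that by (simp add: integrable_restrict_space sec)
  have secI: "(\<integral>y. f (x, y) \<partial>lebesgue) = indicator {0..1} x *\<^sub>R (\<integral>t. h (x, t) \<partial>unit_interval)" for x
    unfolding sec using I by (simp add: integral_restrict_space)
  have "AE x in lebesgue. integrable lebesgue (\<lambda>y. f (x, y))"
    using aeF by (intro AE_completion) auto
  then show "AE x in unit_interval. integrable unit_interval (\<lambda>t. h (x, t))"
    using intI I by (auto simp: AE_restrict_space_iff)
  have Gb: "(\<lambda>x. \<integral>y. g (x, y) \<partial>lborel) \<in> borel_measurable lborel"
    using borel_measurable_integrable[OF lborel_pair.integrable_fst'[OF gp]] .
  have Gbl: "(\<lambda>x. \<integral>y. g (x, y) \<partial>lborel) \<in> borel_measurable lebesgue" using Gb by (rule measurable_completion)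
  have aG: "AE x in lebesgue. (\<integral>y. g (x, y) \<partial>lborel) = (\<integral>y. f (x, y) \<partial>lebesgue)"
    using aeF by (intro AE_completion) auto
  have Fb: "(\<lambda>x. \<integral>y. f (x, y) \<partial>lebesgue) \<in> borel_measurable lebesgue"
    by (rule borel_measurable_AE[OF Gbl aG])
  then have "(\<lambda>x. indicator {0..1} x *\<^sub>R (\<integral>t. h (x, t) \<partial>unit_interval)) \<in> borel_measurable lebesgue"
    unfolding secI .
  then show "(\<lambda>x. \<integral>t. h (x, t) \<partial>unit_interval) \<in> borel_measurable unit_interval"
    using I by (simp add: borel_measurable_restrict_space_iff)
  have "(\<integral>x. (\<integral>t. h (x, t) \<partial>unit_interval) \<partial>unit_interval) = (\<integral>x. (\<integral>y. f (x, y) \<partial>lebesgue) \<partial>lebesgue)"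
    using I by (simp add: secI integral_restrict_space)
  also have "\<dots> = (\<integral>x. (\<integral>y. g (x, y) \<partial>lborel) \<partial>lborel)"
    using integral_cong_AE[OF Gbl Fb aG] integral_completion[OF Gb] by simp
  also have "\<dots> = (\<integral>z. g z \<partial>lborel)"
    using lborel_pair.integral_fst'[OF gp] by (simp add: lborel_prod)
  finally show "(\<integral>x. (\<integral>t. h (x, t) \<partial>unit_interval) \<partial>unit_interval) = (\<integral>z. h z \<partial>unit_square)"
    by (simp only: Ig If)
qed

lemma AE_unit_square_sections:
  assumes "AE z in unit_square. P z"
  shows "AE x in unit_interval. AE t in unit_interval. P (x, t)"
proof -
  have Q: "{0..1::real} \<times> {0..1::real} \<in> sets lebesgue" by (intro fmeasurableD lmeasurable_compact compact_Times) auto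
  have "AE z in lborel. z \<in> {0..1} \<times> {0..1} \<longrightarrow> P z"
    using assms Q by (simp add: AE_restrict_space_iff AE_completion_iff)
  then have "AE z in lborel \<Otimes>\<^sub>M lborel. z \<in> {0..1} \<times> {0..1} \<longrightarrow> P z"
    unfolding lborel_prod .
  then have "AE x in lborel. AE y in lborel. (x, y) \<in> {0..1} \<times> {0..1} \<longrightarrow> P (x, y)"
    by (rule lborel_pair.AE_pair)
  then have "AE x in lborel. x \<in> {0..1} \<longrightarrow> (AE y in lborel. y \<in> {0..1} \<longrightarrow> P (x, y))"
    by eventually_elim auto
  then show ?thesis by (simp add: AE_restrict_space_iff AE_completion_iff)
qed

lemma monom_Linf: "(\<lambda>t. complex_of_real t ^ q) \<in> Linf"
proof -
  have "continuous_on UNIV (\<lambda>t::real. complex_of_real t ^ q)" by (intro continuous_intros)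
  then have "(\<lambda>t::real. complex_of_real t ^ q) \<in> borel_measurable unit_interval"
    using borel_measurable_continuous_onI by (simp add: measurable_restrict_space1 measurable_completion)
  moreover have "AE t in unit_interval. norm (complex_of_real t ^ q) \<le> 1"
    by (rule AE_I2) (simp add: norm_power power_le_one)
  ultimately show ?thesis unfolding Linf_def by blast
qed

text \<open>Monomials are at most 1 on the square, so \<open>CE1 H\<close> dominates these
  functions; membership in \<open>Linf\<close> then admits them to the product and trace formulas of
  the copy.\<close>

lemma beta_monom:
  assumes H: "integrable unit_square H" and nn: "AE p in unit_square. 0 \<le> H p" and bd: "ess_bounded (CE1 H)"
  shows "beta H (\<lambda>t. complex_of_real t ^ q) \<in> Linf"
    and "(\<lambda>x. complex_of_real x ^ p * beta H (\<lambda>t. complex_of_real t ^ q) x) \<in> Linf"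
    and "(\<integral>x. complex_of_real x ^ p * beta H (\<lambda>t. complex_of_real t ^ q) x \<partial>unit_interval)
      = complex_of_real (\<integral>z. fst z ^ p * snd z ^ q * H z \<partial>unit_square)"
proof -
  define h where "h r z = fst z ^ r * snd z ^ q * H z" for r z
  have h: "integrable unit_square (h r)" for r
    unfolding h_def by (rule integrable_unit_square_mult[OF H continuous_monom2])
  have beta: "complex_of_real x ^ r * beta H (\<lambda>t. complex_of_real t ^ q) x = complex_of_real (\<integral>t. h r (x, t) \<partial>unit_interval)" for r x
  proof -
    have "complex_of_real x ^ r * beta H (\<lambda>t. complex_of_real t ^ q) x = (\<integral>t. complex_of_real (x ^ r) * complex_of_real (H (x, t) * t ^ q) \<partial>unit_interval)"
      by (simp add: beta_def)
    also have "\<dots> = (\<integral>t. complex_of_real (h r (x, t)) \<partial>unit_interval)"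
      by (simp add: h_def mult_ac del: Bochner_Integration.integral_mult_right_zero)
    finally show ?thesis by simp
  qed
  have m: "(\<lambda>x. complex_of_real (\<integral>t. h r (x, t) \<partial>unit_interval)) \<in> borel_measurable unit_interval" for r
    using unit_square_Fubini(2)[OF h[of r]] by simp
  obtain C where C: "AE x in unit_interval. \<bar>CE1 H x\<bar> \<le> C" using bd by (auto simp: ess_bounded_def)
  have b: "AE x in unit_interval. norm (complex_of_real (\<integral>t. h r (x, t) \<partial>unit_interval)) \<le> C" for r
    using C unit_square_Fubini(1)[OF H] unit_square_Fubini(1)[OF h[of r]] AE_unit_square_sections[OF nn] AE_space
  proof eventually_elim
    case (elim x)
    have "\<bar>\<integral>t. h r (x, t) \<partial>unit_interval\<bar> \<le> (\<integral>t. \<bar>h r (x, t)\<bar> \<partial>unit_interval)"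
      by (rule integral_abs_bound)
    also have "\<dots> \<le> (\<integral>t. H (x, t) \<partial>unit_interval)"
    proof (rule integral_mono_AE)
      show "AE t in unit_interval. \<bar>h r (x, t)\<bar> \<le> H (x, t)"
        using elim(4) AE_space
      proof eventually_elim
        case (elim t)
        have xt: "0 \<le> x" "x \<le> 1" "0 \<le> t" "t \<le> 1" using \<open>x \<in> space unit_interval\<close> elim by auto
        then have "x ^ r * t ^ q \<le> 1" "0 \<le> x ^ r * t ^ q"
          using mult_mono[of "x ^ r" 1 "t ^ q" 1] by (simp_all add: power_le_one)
        then have "\<bar>x ^ r * t ^ q\<bar> * H (x, t) \<le> 1 * H (x, t)" using elim by (intro mult_right_mono) auto
        then show ?case using elim by (simp add: h_def abs_mult)
      qed
    qed (use elim in auto)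
    also have "\<dots> \<le> C" using elim(1) by (simp add: CE1_def)
    finally show ?case by simp
  qed
  have L: "(\<lambda>x. complex_of_real x ^ r * beta H (\<lambda>t. complex_of_real t ^ q) x) \<in> Linf" for r
    unfolding beta Linf_def using m b by blast
  show "(\<lambda>x. complex_of_real x ^ p * beta H (\<lambda>t. complex_of_real t ^ q) x) \<in> Linf" by (rule L)
  show "beta H (\<lambda>t. complex_of_real t ^ q) \<in> Linf" using L[of 0] by simp
  show "(\<integral>x. complex_of_real x ^ p * beta H (\<lambda>t. complex_of_real t ^ q) x \<partial>unit_interval)
      = complex_of_real (\<integral>z. fst z ^ p * snd z ^ q * H z \<partial>unit_square)"
    unfolding beta using unit_square_Fubini(3)[OF h[of p]] by (simp add: h_def)
qed

lemma integral_monom2: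
  "(\<integral>z. fst z ^ p * snd z ^ q * 1 \<partial>unit_square) = (\<integral>t. t ^ p \<partial>unit_interval) * (\<integral>t. t ^ q \<partial>unit_interval)"
  using unit_square_Fubini(3)[OF integrable_unit_square_mult[OF integrable_const_unit_square[of 1] continuous_monom2[of p q]]]
  by simp

lemma integral_monom_bounds: "0 \<le> (\<integral>t. t ^ p \<partial>unit_interval)" "(\<integral>t. t ^ p \<partial>unit_interval) \<le> 1"
proof -
  show "0 \<le> (\<integral>t. t ^ p \<partial>unit_interval)" by (rule Bochner_Integration.integral_nonneg) auto
  have "(\<integral>t. t ^ p \<partial>unit_interval) \<le> (\<integral>t. 1 \<partial>unit_interval)"
  proof (cases "integrable unit_interval (\<lambda>t. t ^ p)")
    case True
    have "finite_measure unit_interval" by (rule finite_measure_lebesgue_on) simp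
    then have "integrable unit_interval (\<lambda>t. 1 :: real)" by (rule finite_measure.integrable_const)
    then show ?thesis using True by (intro integral_mono) (auto intro: power_le_one)
  qed (simp add: not_integrable_integral_eq)
  also have "\<dots> \<le> 1" by (simp add: measure_restrict_space)
  finally show "(\<integral>t. t ^ p \<partial>unit_interval) \<le> 1" .
qed

text \<open>Adjoints are defined by a definite description, so they have to be exhibited first.\<close>

lemma adj_eqI:
  assumes "is_adj T S" shows "adj T = S"
  unfolding adj_def
proof (rule the_equality)
  show "is_adj T S" by (rule assms)
  fix S' assume S': "is_adj T S'"
  show "S' = S"
  proof
    fix y
    have "cinner x (S' y) = cinner x (S y)" for x using assms S' by (simp add: is_adj_def)
    then have "inner x (S' y) = inner x (S y)" for x by (simp add: inner_cinner)
    then have "inner x (S' y - S y) = 0" for x by (simp add: inner_diff_right)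
    then have "inner (S' y - S y) (S' y - S y) = 0" .
    then show "S' y = S y" by simp
  qed
qed

section \<open>Closure properties of von Neumann algebras\<close>

lemma bounded_op_linear:
  assumes "bounded_op T"
  shows "T (x + y) = T x + T y" and "T (c *\<^sub>C x) = c *\<^sub>C T x"
  using assms unfolding bounded_op_def by (simp_all add: linear_simps)

lemma cinner_scaleC_left: "cinner (c *\<^sub>C x) y = cnj c * cinner x y"
  by (metis cinner_commute cinner_scaleC_right complex_cnj_mult)

lemma norm_scaleC: "norm (c *\<^sub>C x) = cmod c * norm (x :: 'h::chilbert_space)"
proof -
  have "cinner (c *\<^sub>C x) (c *\<^sub>C x) = complex_of_real ((cmod c)\<^sup>2) * cinner x x"
    by (simp add: cinner_scaleC_left cinner_scaleC_right complex_norm_square mult_ac del: of_real_power)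
  then have "(norm (c *\<^sub>C x))\<^sup>2 = (cmod c)\<^sup>2 * (norm x)\<^sup>2"
    unfolding power2_norm_eq_inner inner_cinner by simp
  then have "(norm (c *\<^sub>C x))\<^sup>2 = (cmod c * norm x)\<^sup>2" by (simp add: power_mult_distrib)
  then show ?thesis by (simp add: power2_eq_iff_nonneg)
qed

lemma bounded_op_scaleC:
  assumes "bounded_op T" shows "bounded_op (\<lambda>x. c *\<^sub>C T x)"
proof -
  have T: "bounded_linear T" using assms by (simp add: bounded_op_def)
  have "bounded_linear (\<lambda>x. c *\<^sub>C x :: 'a)"
  proof (rule bounded_linear_intro)
    fix r x
    show "c *\<^sub>C (r *\<^sub>R x) = r *\<^sub>R (c *\<^sub>C x :: 'a)"
      by (simp add: scaleR_scaleC scaleC_scaleC mult.commute)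
    show "norm (c *\<^sub>C x :: 'a) \<le> norm x * cmod c" by (simp add: norm_scaleC mult.commute)
  qed (rule scaleC_add_right)
  from bounded_linear_compose[OF this T] show ?thesis
    using assms by (simp add: bounded_op_def scaleC_scaleC mult.commute)
qed

lemma bounded_op_add: "bounded_op S \<Longrightarrow> bounded_op T \<Longrightarrow> bounded_op (\<lambda>x. S x + T x)"
  by (simp add: bounded_op_def bounded_linear_add scaleC_add_right)

lemma bounded_op_comp: "bounded_op S \<Longrightarrow> bounded_op T \<Longrightarrow> bounded_op (S \<circ> T)"
  unfolding bounded_op_def comp_def by (simp add: bounded_linear_compose)

lemma bounded_op_id: "bounded_op id"
  by (simp add: bounded_op_def id_def bounded_linear_ident)

lemma commutant_closed:
  assumes S: "\<And>s. s \<in> S \<Longrightarrow> bounded_op s"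
  shows "id \<in> commutant S"
    and "A \<in> commutant S \<Longrightarrow> B \<in> commutant S \<Longrightarrow> (\<lambda>x. A x + B x) \<in> commutant S"
    and "A \<in> commutant S \<Longrightarrow> (\<lambda>x. c *\<^sub>C A x) \<in> commutant S"
    and "A \<in> commutant S \<Longrightarrow> B \<in> commutant S \<Longrightarrow> A \<circ> B \<in> commutant S"
  using bounded_op_linear[OF S]
  by (auto simp: commutant_def bounded_op_id bounded_op_add bounded_op_scaleC bounded_op_comp fun_eq_iff)

text \<open>M is the commutant of its commutant, and a commutant of bounded operators is a unital
  algebra; the adjoint comes from the explicit clause of the definition.\<close>

lemma vN_closed:
  assumes M: "von_neumann_algebra M"
  shows "id \<in> M"
    and "A \<in> M \<Longrightarrow> B \<in> M \<Longrightarrow> (\<lambda>x. A x + B x) \<in> M"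
    and "A \<in> M \<Longrightarrow> (\<lambda>x. c *\<^sub>C A x) \<in> M"
    and "A \<in> M \<Longrightarrow> B \<in> M \<Longrightarrow> A \<circ> B \<in> M"
    and "A \<in> M \<Longrightarrow> adj A \<in> M"
    and "A \<in> M \<Longrightarrow> bounded_op A"
proof -
  have b: "\<And>s. s \<in> commutant M \<Longrightarrow> bounded_op s" by (simp add: commutant_def)
  have e: "commutant (commutant M) = M" using M by (simp add: von_neumann_algebra_def)
  show "id \<in> M"
    "A \<in> M \<Longrightarrow> B \<in> M \<Longrightarrow> (\<lambda>x. A x + B x) \<in> M"
    "A \<in> M \<Longrightarrow> (\<lambda>x. c *\<^sub>C A x) \<in> M"
    "A \<in> M \<Longrightarrow> B \<in> M \<Longrightarrow> A \<circ> B \<in> M"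
    using commutant_closed[where S = "commutant M", OF b, unfolded e] by simp_all
  show "A \<in> M \<Longrightarrow> bounded_op A" using M by (simp add: von_neumann_algebra_def)
  assume "A \<in> M"
  then obtain T where T: "T \<in> M" "is_adj A T" using M unfolding von_neumann_algebra_def by blast
  then show "adj A \<in> M" using adj_eqI[OF T(2)] by simp
qed

lemma op_prod_Nil: "op_prod [] = id" and op_prod_Cons: "op_prod (T # Ts) = T \<circ> op_prod Ts"
  by (simp_all add: op_prod_def)

lemma op_prod_append: "op_prod (Ts @ Us) = op_prod Ts \<circ> op_prod Us"
  by (induction Ts) (simp_all add: op_prod_Nil op_prod_Cons comp_assoc)

lemmas op_prod_simps = op_prod_Nil op_prod_Cons op_prod_append

section \<open>Traces of words in D, Re Z and Im Z\<close>

context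
  fixes M :: "('h::chilbert_space \<Rightarrow> 'h) set"
    and \<tau> :: "('h \<Rightarrow> 'h) \<Rightarrow> complex"
    and \<iota> :: "(real \<Rightarrow> complex) \<Rightarrow> ('h \<Rightarrow> 'h)"
    and E :: "('h \<Rightarrow> 'h) \<Rightarrow> ('h \<Rightarrow> 'h)"
    and H :: "real \<times> real \<Rightarrow> real"
    and Z D :: "'h \<Rightarrow> 'h"
  assumes tr: "tracial_vN_algebra M \<tau>"
    and copy: "Linf_copy M \<tau> \<iota>"
    and ce: "cond_expectation M \<tau> (\<iota> ` Linf) E"
    and H: "integrable unit_square H" "AE p in unit_square. 0 \<le> H p" "ess_bounded (CE1 H)"
    and circ: "A_circular M \<iota> E Z (alpha H) (beta H)"
    and D: "D = \<iota> (\<lambda>t. complex_of_real t)"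
begin

lemma copy_in: "f \<in> Linf \<Longrightarrow> \<iota> f \<in> M"
  and copy_mult: "f \<in> Linf \<Longrightarrow> g \<in> Linf \<Longrightarrow> \<iota> (\<lambda>t. f t * g t) = \<iota> f \<circ> \<iota> g"
  and copy_trace: "f \<in> Linf \<Longrightarrow> \<tau> (\<iota> f) = (\<integral>t. f t \<partial>unit_interval)"
  and ce_trace: "T \<in> M \<Longrightarrow> \<tau> (E T) = \<tau> T"
  and ce_module: "f \<in> Linf \<Longrightarrow> g \<in> Linf \<Longrightarrow> T \<in> M \<Longrightarrow> E (\<iota> f \<circ> T \<circ> \<iota> g) = \<iota> f \<circ> E T \<circ> \<iota> g"
  and circ_beta: "f \<in> Linf \<Longrightarrow> E (Z \<circ> \<iota> f \<circ> adj Z) = \<iota> (beta H f)"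
  and copy_one: "\<iota> (\<lambda>_. 1) = id"
  using copy ce circ unfolding Linf_copy_def cond_expectation_def A_circular_def by simp_all

lemma D_power: "op_prod (replicate p D) = \<iota> (\<lambda>t. complex_of_real t ^ p)"
proof (induction p)
  case 0
  show ?case by (simp add: op_prod_simps copy_one)
next
  case (Suc p)
  have "\<iota> (\<lambda>t. complex_of_real t ^ 1 * complex_of_real t ^ p) = \<iota> (\<lambda>t. complex_of_real t ^ 1) \<circ> \<iota> (\<lambda>t. complex_of_real t ^ p)"
    using copy_mult[OF monom_Linf[of 1] monom_Linf[of p]] .
  then show ?case unfolding replicate_Suc op_prod_Cons Suc by (simp add: D)
qed

lemma law_D: "law_of \<tau> [op_Re Z, op_Im Z, D] (replicate p 2) = complex_of_real (\<integral>t. t ^ p \<partial>unit_interval)"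
proof -
  have "law_of \<tau> [op_Re Z, op_Im Z, D] (replicate p 2) = \<tau> (\<iota> (\<lambda>t. complex_of_real t ^ p))"
    by (simp add: law_of_def D_power)
  also have "\<dots> = (\<integral>t. complex_of_real t ^ p \<partial>unit_interval)"
    by (rule copy_trace[OF monom_Linf])
  finally show ?thesis by (simp flip: of_real_power)
qed

text \<open>The four words are the expansion of D^p Z D^q Z^* in the real and imaginary parts of Z.
  Its conditional expectation is D^p times the image of D^q under the covariance map
  \<open>beta H\<close>, so its trace is an integral against \<open>H\<close>.\<close>

lemma law_covariance:
  defines "w \<equiv> \<lambda>p q a b. replicate p 2 @ [a] @ replicate q 2 @ [b]"
  shows "law_of \<tau> [op_Re Z, op_Im Z, D] (w p q 0 0) + law_of \<tau> [op_Re Z, op_Im Z, D] (w p q 1 1) + \<i> * (law_of \<tau> [op_Re Z, op_Im Z, D] (w p q 1 0) - law_of \<tau> [op_Re Z, op_Im Z, D] (w p q 0 1))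
    = complex_of_real (\<integral>z. fst z ^ p * snd z ^ q * H z \<partial>unit_square)"
proof -
  have vN: "von_neumann_algebra M" using tr by (simp add: tracial_vN_algebra_def)
  note cl = vN_closed[OF vN]
  have Z: "Z \<in> M" using circ by (simp add: A_circular_def)
  let ?m = "\<lambda>p. \<iota> (\<lambda>t. complex_of_real t ^ p)"
  have m: "?m p \<in> M" for p by (rule copy_in[OF monom_Linf])
  have x: "op_Re Z \<in> M" "op_Im Z \<in> M"
  proof -
    show "op_Re Z \<in> M" unfolding op_Re_def by (intro cl Z)
    have "(\<lambda>x. Z x + (- 1) *\<^sub>C adj Z x) \<in> M" by (intro cl Z)
    moreover have "(- 1) *\<^sub>C y = - y" for y :: 'h using scaleR_scaleC[of "-1" y] by simp
    ultimately have "(\<lambda>x. Z x - adj Z x) \<in> M" by simp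
    then show "op_Im Z \<in> M" unfolding op_Im_def by (intro cl)
  qed
  have ZX: "Z x = op_Re Z x + \<i> *\<^sub>C op_Im Z x" "adj Z x = op_Re Z x + (- \<i>) *\<^sub>C op_Im Z x" for x
  proof -
    have n: "(- c) *\<^sub>C y = - (c *\<^sub>C y)" for c and y :: 'h
      using scaleR_scaleC[of "-1" "c *\<^sub>C y"] by (simp add: scaleC_scaleC)
    have d: "c *\<^sub>C (y - z) = c *\<^sub>C y - c *\<^sub>C z" for c and y z :: 'h
      using scaleC_add_right[of c "y - z" z] by simp
    have h: "(1/2) *\<^sub>C y + (1/2) *\<^sub>C y = y" for y :: 'h
      using scaleC_add_left[of "1/2" "1/2" y] scaleR_scaleC[of 1 y] by simp
    have i: "\<i> * (1 / (2 * \<i>)) = 1/2" by simp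
    have h1: "(1/2) *\<^sub>C (u + v) + (1/2) *\<^sub>C (u - v) = u" for u v :: 'h
    proof -
      have "(1/2) *\<^sub>C (u + v) + (1/2) *\<^sub>C (u - v) = (1/2) *\<^sub>C ((u + v) + (u - v))" by (rule scaleC_add_right[symmetric])
      also have "(u + v) + (u - v) = u + u" by simp
      finally show ?thesis by (simp only: scaleC_add_right h)
    qed
    have h2: "(1/2) *\<^sub>C (u + v) - (1/2) *\<^sub>C (u - v) = v" for u v :: 'h
    proof -
      have "(1/2) *\<^sub>C (u + v) - (1/2) *\<^sub>C (u - v) = (1/2) *\<^sub>C ((u + v) - (u - v))" by (rule d[symmetric])
      also have "(u + v) - (u - v) = v + v" by simp
      finally show ?thesis by (simp only: scaleC_add_right h)
    qed
    show "Z x = op_Re Z x + \<i> *\<^sub>C op_Im Z x"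
      unfolding op_Re_def op_Im_def scaleC_scaleC i by (rule h1[symmetric])
    show "adj Z x = op_Re Z x + (- \<i>) *\<^sub>C op_Im Z x"
      unfolding op_Re_def op_Im_def scaleC_scaleC mult_minus_left i n using h2[of "Z x" "adj Z x"] by simp
  qed
  have \<tau>: "\<tau> (\<lambda>x. S x + T x) = \<tau> S + \<tau> T" "\<tau> (\<lambda>x. c *\<^sub>C T x) = c * \<tau> T" if "S \<in> M" "T \<in> M" for S T c
    using tr that unfolding tracial_vN_algebra_def op_functional_on_def by auto
  let ?W = "\<lambda>A B. ?m p \<circ> A \<circ> ?m q \<circ> B"
  have W: "?W A B \<in> M" if "A \<in> M" "B \<in> M" for A B by (intro cl m that)
  have word: "law_of \<tau> [op_Re Z, op_Im Z, D] (w p q a b) = \<tau> (?W ([op_Re Z, op_Im Z, D] ! a) ([op_Re Z, op_Im Z, D] ! b))" for a b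
    by (simp add: law_of_def w_def op_prod_simps D_power comp_assoc)
  note lin = bounded_op_linear[OF cl(6)]
  have "\<tau> (?W Z (adj Z)) = complex_of_real (\<integral>z. fst z ^ p * snd z ^ q * H z \<partial>unit_square)"
  proof -
    let ?b = "beta H (\<lambda>t. complex_of_real t ^ q)"
    have T: "Z \<circ> ?m q \<circ> adj Z \<in> M" by (intro cl m Z)
    have one: "\<iota> (\<lambda>t. complex_of_real t ^ 0) = id" by (simp add: copy_one)
    \<comment> \<open>The trailing factor \<open>?m 0\<close>, which is the identity, brings the
      word into the two-sided form of the module property.\<close>
    have e1: "?W Z (adj Z) = ?m p \<circ> (Z \<circ> ?m q \<circ> adj Z) \<circ> ?m 0"
      unfolding one by (simp add: comp_assoc)
    have e2: "E (?m p \<circ> (Z \<circ> ?m q \<circ> adj Z) \<circ> ?m 0) = ?m p \<circ> E (Z \<circ> ?m q \<circ> adj Z) \<circ> ?m 0"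
      by (rule ce_module[OF monom_Linf monom_Linf T])
    have e3: "E (Z \<circ> ?m q \<circ> adj Z) = \<iota> ?b" by (rule circ_beta[OF monom_Linf])
    have e4: "?m p \<circ> \<iota> ?b \<circ> ?m 0 = \<iota> (\<lambda>x. complex_of_real x ^ p * ?b x)"
      unfolding one copy_mult[OF monom_Linf beta_monom(1)[OF H]] by simp
    have "E (?W Z (adj Z)) = \<iota> (\<lambda>x. complex_of_real x ^ p * ?b x)"
      unfolding e1 e2 e3 e4 by (rule refl)
    then have "\<tau> (?W Z (adj Z)) = \<tau> (\<iota> (\<lambda>x. complex_of_real x ^ p * ?b x))"
      using ce_trace[OF W[OF Z cl(5)[OF Z]]] by simp
    then show ?thesis unfolding copy_trace[OF beta_monom(2)[OF H]] beta_monom(3)[OF H] .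
  qed
  moreover have "\<tau> (?W Z (adj Z)) = \<tau> (?W (op_Re Z) (op_Re Z)) + \<tau> (?W (op_Im Z) (op_Im Z))
     + \<i> * (\<tau> (?W (op_Im Z) (op_Re Z)) - \<tau> (?W (op_Re Z) (op_Im Z)))"
  proof -
    have left: "\<tau> (?W Z B) = \<tau> (?W (op_Re Z) B) + \<i> * \<tau> (?W (op_Im Z) B)" if B: "B \<in> M" for B
    proof -
      have "?W Z B = (\<lambda>v. ?W (op_Re Z) B v + \<i> *\<^sub>C ?W (op_Im Z) B v)"
        by (rule ext) (simp add: ZX(1) lin[OF m])
      then show ?thesis using W[OF x(1) B] W[OF x(2) B] cl(3) by (simp only: \<tau>)
    qed
    have right: "\<tau> (?W A (adj Z)) = \<tau> (?W A (op_Re Z)) - \<i> * \<tau> (?W A (op_Im Z))" if A: "A \<in> M" for A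
    proof -
      have "?W A (adj Z) = (\<lambda>v. ?W A (op_Re Z) v + (- \<i>) *\<^sub>C ?W A (op_Im Z) v)"
        by (rule ext) (simp add: ZX(2) lin[OF m] lin[OF A])
      then have "\<tau> (?W A (adj Z)) = \<tau> (?W A (op_Re Z)) + (- \<i>) * \<tau> (?W A (op_Im Z))"
        using W[OF A x(1)] W[OF A x(2)] cl(3) by (simp only: \<tau>)
      then show ?thesis by simp
    qed
    show ?thesis unfolding left[OF cl(5)[OF Z]] right[OF x(1)] right[OF x(2)]
      by (simp add: algebra_simps)
  qed
  ultimately show ?thesis unfolding word by simp
qed

end

section \<open>Sparsity of microstates and the bound for the free entropy\<close>

lemma ent_diagf_mult: "bd k A \<Longrightarrow> ent (diagf k l * A) i j = complex_of_real (l i) * ent A i j"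
proof -
  assume A: "bd k A"
  have b: "bd k (diagf k l)" by (simp add: diagf_def)
  show ?thesis
  proof (cases "i < k")
    case True
    have "ent (diagf k l * A) i j = (\<Sum>m<k. if m = i then complex_of_real (l i) * ent A i j else 0)"
      unfolding ent_times[OF b] using True by (intro sum.cong) (auto simp: diagf_def ent_fmat_of)
    then show ?thesis using True by simp
  next
    case False
    then show ?thesis using bdD[OF bd_mult[OF b A]] bdD[OF A] by simp
  qed
qed

lemma diagf_simps: "bd k (diagf k l)" "adj_fmat (diagf k l) = diagf k l" "diagf k (\<lambda>_. 1) = idm k"
  "diagf k l * diagf k l' = diagf k (\<lambda>i. l i * l' i)"
proof -
  show b: "bd k (diagf k l)" for l by (simp add: diagf_def)
  show "adj_fmat (diagf k l) = diagf k l" by (rule fmat_eqI) (auto simp: diagf_def ent_fmat_of)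
  show "diagf k (\<lambda>_. 1) = idm k" by (rule fmat_eqI) (auto simp: diagf_def ent_fmat_of ent_idm)
  show "diagf k l * diagf k l' = diagf k (\<lambda>i. l i * l' i)"
  proof (rule fmat_eqI)
    fix i j
    show "ent (diagf k l * diagf k l') i j = ent (diagf k (\<lambda>i. l i * l' i)) i j"
      unfolding ent_diagf_mult[OF b] by (simp add: diagf_def ent_fmat_of)
  qed
qed

lemma ent_mult_diagf: "bd k A \<Longrightarrow> ent (A * diagf k l) i j = ent A i j * complex_of_real (l j)"
proof -
  assume A: "bd k A"
  have "ent (A * diagf k l) i j = cnj (ent (diagf k l * adj_fmat A) j i)"
    using adj_mult[of "diagf k l" "adj_fmat A"] by (metis adj_adj diagf_simps(2) ent_simps(6))
  then show ?thesis by (simp add: ent_diagf_mult[OF bd_adj[OF A]] mult.commute)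
qed

text \<open>Meant for matrices \<open>Y 0\<close>, \<open>Y 1\<close>, \<open>Y 2\<close> that
  approximate Re Z, Im Z and D; \<open>C\<close> below is then the approximant of Z in an eigenbasis
  of \<open>Y 2\<close>.\<close>

locale diagonalized =
  fixes k :: nat and U :: fmat and l :: "nat \<Rightarrow> real" and Y :: "nat \<Rightarrow> fmat"
  assumes U: "unitary_fmat k U"
    and diag: "adj_fmat U * Y 2 * U = diagf k l"
    and bdY: "bd k (Y i)"
    and sa: "i < 2 \<Longrightarrow> adj_fmat (Y i) = Y i"
begin

abbreviation "word w \<equiv> foldr (*) (map Y w) (idm k)"

definition C :: fmat where "C = adj_fmat U * (Y 0 + cscale \<i> (Y 1)) * U"

lemma UU: "bd k U" "adj_fmat U * U = idm k" "U * adj_fmat U = idm k"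
  using U by (simp_all add: unitary_fmat_def)

lemma word_replicate: "bd k A \<Longrightarrow> foldr (*) (replicate p (Y 2)) A = U * diagf k (\<lambda>i. l i ^ p) * adj_fmat U * A"
proof (induction p)
  case 0
  then show ?case using UU by (simp add: diagf_simps mult_idm idm_mult)
next
  case (Suc p)
  have Y2: "Y 2 * U = U * diagf k l"
  proof -
    have "U * diagf k l = (U * adj_fmat U) * Y 2 * U" by (simp add: diag[symmetric] mult.assoc)
    then show ?thesis using bdY by (simp add: UU idm_mult)
  qed
  have "foldr (*) (replicate (Suc p) (Y 2)) A = (Y 2 * U) * diagf k (\<lambda>i. l i ^ p) * adj_fmat U * A"
    using Suc by (simp add: mult.assoc)
  also have "\<dots> = U * (diagf k l * diagf k (\<lambda>i. l i ^ p)) * adj_fmat U * A" by (simp add: Y2 mult.assoc)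
  finally show ?case by (simp add: diagf_simps)
qed

lemma trace_replicate: "ftr (word (replicate p 2)) = complex_of_real (\<Sum>i<k. l i ^ p)"
proof -
  have "ftr (word (replicate p 2)) = ftr (U * (diagf k (\<lambda>i. l i ^ p) * adj_fmat U))"
    using word_replicate[OF bd_idm, of p] UU by (simp add: mult.assoc mult_idm bd_adj)
  also have "\<dots> = ftr (diagf k (\<lambda>i. l i ^ p) * (adj_fmat U * U))" by (subst ftr_commute) (simp add: mult.assoc)
  also have "\<dots> = ftr (diagf k (\<lambda>i. l i ^ p))" by (simp add: UU mult_idm diagf_simps)
  also have "\<dots> = complex_of_real (\<Sum>i<k. l i ^ p)"
    by (simp add: ftr_bd[OF diagf_simps(1)]) (simp add: diagf_def ent_fmat_of)
  finally show ?thesis .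
qed

lemma bdC: "bd k C" unfolding C_def by (intro bd_mult bd_adj UU bd_add bd_cscale bdY)

text \<open>The matrix counterpart of \<open>law_covariance\<close>: the mass |C_ij|^2 at the pair
  of eigenvalues l_i, l_j plays the role of the density \<open>H\<close>.\<close>

lemma trace_covariance:
  defines "w \<equiv> \<lambda>p q a b. replicate p 2 @ [a] @ replicate q 2 @ [b]"
  shows "ftr (word (w p q 0 0)) + ftr (word (w p q 1 1)) + \<i> * (ftr (word (w p q 1 0)) - ftr (word (w p q 0 1)))
    = complex_of_real (\<Sum>(i, j)\<in>{..<k}\<times>{..<k}. (cmod (ent C i j))\<^sup>2 * (l i ^ p * l j ^ q))"
proof -
  let ?D = "\<lambda>p. diagf k (\<lambda>i. l i ^ p)" and ?c = "\<lambda>a. adj_fmat U * Y a * U"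
  have word: "ftr (word (w p q a b)) = ftr (?D p * ?c a * ?D q * ?c b)" for a b
  proof -
    have b: "bd k (Y b * idm k)" using bdY by (simp add: bd_mult)
    have "word (w p q a b) = foldr (*) (replicate p (Y 2)) (Y a * foldr (*) (replicate q (Y 2)) (Y b * idm k))"
      by (simp add: w_def)
    also have "\<dots> = U * ?D p * adj_fmat U * (Y a * (U * ?D q * adj_fmat U * (Y b * idm k)))"
      unfolding word_replicate[OF b]
      by (rule word_replicate) (intro bd_mult bdY bd_idm bd_adj UU diagf_simps)
    also have "\<dots> = U * (?D p * adj_fmat U * Y a * U * ?D q * adj_fmat U * Y b)"
      using bdY[of b] by (simp add: mult.assoc mult_idm)
    finally have "ftr (word (w p q a b)) = ftr ((?D p * adj_fmat U * Y a * U * ?D q * adj_fmat U * Y b) * U)"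
      by (simp add: ftr_commute[of U])
    then show ?thesis by (simp add: mult.assoc)
  qed
  have C: "C = ?c 0 + cscale \<i> (?c 1)"
    by (simp add: C_def distrib_left distrib_right cscale_mult_left cscale_mult_right)
  have aC: "adj_fmat C = ?c 0 - cscale \<i> (?c 1)"
    unfolding C by (simp add: adj_add adj_cscale adj_mult sa mult.assoc cscale_simps)
  have "ftr (?D p * C * ?D q * adj_fmat C) = ftr (word (w p q 0 0)) + ftr (word (w p q 1 1))
     + \<i> * (ftr (word (w p q 1 0)) - ftr (word (w p q 0 1)))"
    unfolding word aC unfolding C
    by (simp only: distrib_left distrib_right left_diff_distrib right_diff_distrib cscale_mult_left cscale_mult_right
        ftr_add ftr_diff ftr_cscale cscale_simps) (simp add: algebra_simps)
  moreover have "ftr (?D p * C * ?D q * adj_fmat C)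
     = complex_of_real (\<Sum>(i, j)\<in>{..<k}\<times>{..<k}. (cmod (ent C i j))\<^sup>2 * (l i ^ p * l j ^ q))"
  proof -
    have b: "bd k (?D p * C)" "bd k (?D p * C * ?D q)" by (intro bd_mult bdC diagf_simps)+
    have "ftr (?D p * C * ?D q * adj_fmat C) = (\<Sum>i<k. \<Sum>j<k. complex_of_real ((cmod (ent C i j))\<^sup>2 * (l i ^ p * l j ^ q)))"
      unfolding ftr_bd[OF bd_mult[OF b(2) bd_adj[OF bdC]]] ent_times[OF b(2)] ent_mult_diagf[OF b(1)] ent_diagf_mult[OF bdC]
      by (intro sum.cong refl) (simp add: complex_norm_square mult_ac del: of_real_power)
    then show ?thesis by (simp only: sum.cartesian_product of_real_sum case_prod_unfold)
  qed
  ultimately show ?thesis by simp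
qed

lemma eigenvalue_bound: "opn (Y 2) \<le> R \<Longrightarrow> i < k \<Longrightarrow> \<bar>l i\<bar> \<le> R"
proof -
  assume R: "opn (Y 2) \<le> R" and i: "i < k"
  have u: "opn U \<le> 1" by (rule opn_unitary_le[OF U])
  have "\<bar>l i\<bar> = cmod (ent (diagf k l) i i)" using i by (simp add: diagf_def ent_fmat_of)
  also have "\<dots> \<le> opn (adj_fmat U * Y 2 * U)" unfolding diag by (rule opn_entry_le)
  also have "\<dots> \<le> opn (adj_fmat U * Y 2) * opn U" by (rule opn_mult)
  also have "\<dots> \<le> opn (adj_fmat U * Y 2) * 1" using u by (intro mult_left_mono) simp_all
  also have "\<dots> \<le> opn (adj_fmat U) * opn (Y 2)" using opn_mult[of "adj_fmat U" "Y 2"] by simp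
  also have "\<dots> \<le> 1 * R" using u R by (intro mult_mono) simp_all
  finally show ?thesis by simp
qed

end

lemma norm_diff_restr_le: "norm (A - restr K A) \<le> norm A"
proof -
  have "A - restr K A = restr (- K) A" by (rule fmat_eqI) (simp add: ent_restr)
  then show ?thesis using norm_restr_le[of "- K" A] by simp
qed

lemma norm_diff_restr_sq:
  assumes "bd k A"
  shows "(norm (A - restr K A))\<^sup>2 = (\<Sum>(i, j)\<in>{..<k}\<times>{..<k}. if (i, j) \<in> K then 0 else (cmod (ent A i j))\<^sup>2)"
proof -
  have b: "bd k (A - restr K A)" using assms by (auto simp: bd_def ent_restr)
  show ?thesis unfolding norm_sq_bd[OF b] sum.cartesian_product[symmetric]
    by (intro sum.cong refl) (simp add: ent_restr)
qed

text \<open>The constant c is fixed before the cutoff R, as the supremum over R demands, while m and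
  \<gamma> may depend on R. The term ln k cancels the normalization (n/2) log k at n = 2.\<close>

lemma chi_le:
  assumes "\<And>R. 0 < R \<Longrightarrow> \<exists>m. \<exists>\<gamma>>0. \<forall>k\<ge>1. mat_vol 2 k (microstates_pres 2 q \<mu> R m k \<gamma>) \<le> ennreal (exp ((real k)\<^sup>2 * (c - ln (real k))))"
  shows "chi 2 q \<mu> \<le> ereal c"
  unfolding chi_def
proof (rule SUP_least)
  fix R :: real assume "R \<in> {0<..}"
  then obtain m \<gamma> where \<gamma>: "0 < \<gamma>" and v: "\<And>k. 1 \<le> k \<Longrightarrow> mat_vol 2 k (microstates_pres 2 q \<mu> R m k \<gamma>) \<le> ennreal (exp ((real k)\<^sup>2 * (c - ln (real k))))"
    using assms[of R] by auto
  have elog_le: "elog x \<le> ereal y" if "x \<le> ennreal (exp y)" for x y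
  proof (cases "x = 0")
    case False
    have fin: "x \<noteq> \<infinity>" using that by (auto simp: top_unique)
    have "enn2real x \<le> exp y" using that by (intro enn2real_leI) auto
    moreover have "0 < enn2real x" using False fin by (simp add: enn2real_positive_iff less_top zero_less_iff_neq_zero)
    ultimately have "ln (enn2real x) \<le> y" by (metis ln_exp ln_le_cancel_iff exp_gt_zero)
    then show ?thesis using False fin by (simp add: elog_def)
  qed (simp add: elog_def)
  have "limsup (\<lambda>k. ereal (1 / (real k)\<^sup>2) * elog (mat_vol 2 k (microstates_pres 2 q \<mu> R m k \<gamma>)) + ereal (real 2 / 2 * ln (real k))) \<le> ereal c"
  proof (rule Limsup_bounded)
    show "\<forall>\<^sub>F k in sequentially. ereal (1 / (real k)\<^sup>2) * elog (mat_vol 2 k (microstates_pres 2 q \<mu> R m k \<gamma>)) + ereal (real 2 / 2 * ln (real k)) \<le> ereal c"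
      using eventually_ge_at_top[of 1]
    proof eventually_elim
      case (elim k)
      have "ereal (1 / (real k)\<^sup>2) * elog (mat_vol 2 k (microstates_pres 2 q \<mu> R m k \<gamma>))
        \<le> ereal (1 / (real k)\<^sup>2) * ereal ((real k)\<^sup>2 * (c - ln (real k)))"
        by (intro ereal_mult_left_mono elog_le v elim) simp
      also have "\<dots> = ereal (c - ln (real k))" using elim by simp
      finally have "ereal (1 / (real k)\<^sup>2) * elog (mat_vol 2 k (microstates_pres 2 q \<mu> R m k \<gamma>)) + ereal (real 2 / 2 * ln (real k))
        \<le> ereal (c - ln (real k)) + ereal (ln (real k))"
        by (intro add_mono) simp_all
      then show ?case by simp
    qed
  qed
  then show "(INF m. INF \<gamma>\<in>{0<..}. limsup (\<lambda>k. ereal (1 / (real k)\<^sup>2) * elog (mat_vol 2 k (microstates_pres 2 q \<mu> R m k \<gamma>)) + ereal (real 2 / 2 * ln (real k)))) \<le> ereal c"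
    using \<gamma> by (intro INF_lower2[of m] INF_lower2[of \<gamma>]) auto
qed

lemma Limsup_div_ln_le:
  assumes "\<And>\<eta>. 0 < \<eta> \<Longrightarrow> \<exists>c. \<forall>\<epsilon>. 0 < \<epsilon> \<and> \<epsilon> < 1 \<longrightarrow> f \<epsilon> \<le> ereal (c + (t + \<eta>) * \<bar>ln \<epsilon>\<bar>)"
  shows "Limsup (at_right 0) (\<lambda>\<epsilon>. f \<epsilon> / ereal \<bar>ln \<epsilon>\<bar>) \<le> ereal t"
proof (rule ereal_le_epsilon2)
  fix e :: real assume e: "0 < e"
  obtain c where c: "\<And>\<epsilon>. 0 < \<epsilon> \<Longrightarrow> \<epsilon> < 1 \<Longrightarrow> f \<epsilon> \<le> ereal (c + (t + e/2) * \<bar>ln \<epsilon>\<bar>)"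
    using assms[of "e/2"] e by auto
  \<comment> \<open>Below d the quotient of |c| by |ln \<epsilon>| is at most e/2; the summand 1
    keeps |ln \<epsilon>| positive when c = 0.\<close>
  define d where "d = exp (- (2 * \<bar>c\<bar> / e + 1))"
  have "0 \<le> 2 * \<bar>c\<bar> / e" using e by simp
  then have d: "0 < d" "d < 1" unfolding d_def exp_gt_zero exp_less_one_iff by simp_all
  have "f \<epsilon> / ereal \<bar>ln \<epsilon>\<bar> \<le> ereal t + ereal e" if "0 < \<epsilon>" "\<epsilon> < d" for \<epsilon>
  proof -
    have "ln \<epsilon> < ln d" using that d by simp
    then have L: "2 * \<bar>c\<bar> / e + 1 < \<bar>ln \<epsilon>\<bar>" by (simp add: d_def)
    moreover have "0 \<le> 2 * \<bar>c\<bar> / e" using e by simp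
    ultimately have pos: "0 < \<bar>ln \<epsilon>\<bar>" by linarith
    have "2 * \<bar>c\<bar> / e \<le> \<bar>ln \<epsilon>\<bar>" using L by linarith
    then have "\<bar>c\<bar> \<le> e / 2 * \<bar>ln \<epsilon>\<bar>" using e by (simp add: field_simps)
    then have cc: "c + (t + e/2) * \<bar>ln \<epsilon>\<bar> \<le> (t + e) * \<bar>ln \<epsilon>\<bar>" by (simp add: algebra_simps)
    have "f \<epsilon> \<le> ereal (c + (t + e/2) * \<bar>ln \<epsilon>\<bar>)" using c that d by simp
    also have "\<dots> \<le> ereal ((t + e) * \<bar>ln \<epsilon>\<bar>)" using cc by simp
    finally have "f \<epsilon> / ereal \<bar>ln \<epsilon>\<bar> \<le> ereal ((t + e) * \<bar>ln \<epsilon>\<bar>) / ereal \<bar>ln \<epsilon>\<bar>"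
      using pos by (intro ereal_divide_right_mono) simp_all
    also have "\<dots> = ereal t + ereal e" using pos by simp
    finally show ?thesis .
  qed
  then have "\<forall>\<^sub>F \<epsilon> in at_right 0. f \<epsilon> / ereal \<bar>ln \<epsilon>\<bar> \<le> ereal t + ereal e"
    unfolding eventually_at_right_field using d by blast
  then show "Limsup (at_right 0) (\<lambda>\<epsilon>. f \<epsilon> / ereal \<bar>ln \<epsilon>\<bar>) \<le> ereal t + ereal e"
    by (rule Limsup_bounded)
qed

lemma norm_sq_sa: "adj_fmat A = A \<Longrightarrow> complex_of_real ((norm A)\<^sup>2) = ftr (A * A)"
  by (simp only: norm_sq_ftr)

lemma norm_sa_le:
  assumes "adj_fmat A = A" and k: "1 \<le> k" and close: "cmod (ftr (A * A) / of_nat k - z) \<le> 1"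
  shows "(norm A)\<^sup>2 \<le> (cmod z + 1) * real k"
proof -
  have "(norm A)\<^sup>2 / real k = cmod (ftr (A * A) / of_nat k)"
    unfolding norm_sq_sa[OF assms(1), symmetric] by (simp add: norm_divide norm_power)
  also have "\<dots> \<le> cmod z + 1" using norm_triangle_sub[of "ftr (A * A) / of_nat k" z] close by linarith
  finally show ?thesis using k by (simp add: field_simps)
qed

text \<open>The letters \<open>0\<close>, \<open>1\<close>, \<open>2\<close> stand for \<open>Re Z\<close>, \<open>Im Z\<close>, \<open>D\<close>, so that the second condition prescribes the
  moments \<open>\<tau>(D\<^sup>p Z D\<^sup>q Z\<^sup>*)\<close>.\<close>

definition law_with_density :: "law \<Rightarrow> (real \<times> real \<Rightarrow> real) \<Rightarrow> bool" where
  "law_with_density \<mu> H \<longleftrightarrow>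
     (\<forall>p. \<mu> (replicate p 2) = complex_of_real (\<integral>t. t ^ p \<partial>unit_interval)) \<and>
     (\<forall>p q. let w = \<lambda>a b. replicate p 2 @ [a] @ replicate q 2 @ [b] in
        \<mu> (w 0 0) + \<mu> (w 1 1) + \<i> * (\<mu> (w 1 0) - \<mu> (w 0 1))
          = complex_of_real (\<integral>z. fst z ^ p * snd z ^ q * H z \<partial>unit_square))"

text \<open>Two discrete measures sit at the pairs of eigenvalues: one with weights |C_ij|^2 / k,
  whose moments are near those of \<open>H\<close>, and one with weights 1/k^2, whose moments are
  near those of Lebesgue measure. With K the pairs where \<phi> \<le> 1/2, the first bounds the norm
  of C off K and the second bounds card K. In \<rho>, the root bounds the unperturbed matrix,
  \<sigma> the perturbation, and \<sigma> + 2 the error off K.\<close>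

lemma microstate_structure:
  fixes \<phi> H :: "real \<times> real \<Rightarrow> real" and a :: real
  assumes \<mu>: "law_with_density \<mu> H"
    and ext: "\<And>w. set w \<subseteq> {..<3} \<Longrightarrow> \<nu> w = \<mu> w"
    and H: "integrable unit_square H"
    and \<phi>: "continuous_on UNIV \<phi>" "\<And>z. 0 \<le> \<phi> z \<and> \<phi> z \<le> 1" "(\<integral>z. \<phi> z * H z \<partial>unit_square) \<le> \<epsilon>\<^sup>2"
      "(\<integral>z. min 1 (2 * (1 - \<phi> z)) * 1 \<partial>unit_square) \<le> a + \<eta>"
    and eps: "0 < \<epsilon>" "\<epsilon> \<le> 1" and \<eta>: "0 < \<eta>" and R: "0 < R"
  defines "\<sigma> \<equiv> sqrt (cmod (\<nu> [3, 3]) + cmod (\<nu> [4, 4]) + 2)"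
  defines "\<rho> \<equiv> sqrt (cmod (\<mu> [0, 0]) + cmod (\<mu> [1, 1]) + 2) + \<sigma> + 2"
  shows "\<exists>m. \<exists>\<gamma>>0. \<forall>k\<ge>1. \<forall>As\<in>microstates 5 (perturbed_law 2 1 \<epsilon> \<nu>) R m k \<gamma>.
    norm (fm k (As ! 0) + cscale \<i> (fm k (As ! 1))) \<le> \<rho> * sqrt (real k) \<and>
    near_sparse k (a + 2 * \<eta>) (\<epsilon> * (\<rho> * sqrt (real k))) (fm k (As ! 0) + cscale \<i> (fm k (As ! 1)))"
proof -
  have mu1: "\<mu> (replicate p 2) = complex_of_real (\<integral>t. t ^ p \<partial>unit_interval)" for p
    using \<mu> by (simp add: law_with_density_def)
  have mu2: "\<mu> (replicate p 2 @ [0] @ replicate q 2 @ [0]) + \<mu> (replicate p 2 @ [1] @ replicate q 2 @ [1])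
      + \<i> * (\<mu> (replicate p 2 @ [1] @ replicate q 2 @ [0]) - \<mu> (replicate p 2 @ [0] @ replicate q 2 @ [1]))
      = complex_of_real (\<integral>z. fst z ^ p * snd z ^ q * H z \<partial>unit_square)" for p q
    using \<mu> unfolding law_with_density_def Let_def by (elim conjE allE)
  let ?\<psi> = "\<lambda>z. min 1 (2 * (1 - \<phi> z))"
  have e2: "0 < \<epsilon>\<^sup>2" using eps by simp
  have \<psi>: "continuous_on UNIV ?\<psi>" by (intro continuous_intros \<phi>(1))
  obtain m1 \<delta>1 where \<delta>1: "0 < \<delta>1" and w1: "\<forall>(J :: (nat \<times> nat) set) w x y. finite J \<longrightarrow>
    (\<forall>i\<in>J. 0 \<le> w i \<and> \<bar>x i\<bar> \<le> R \<and> \<bar>y i\<bar> \<le> R) \<longrightarrow>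
    (\<forall>p q. p + q \<le> m1 \<longrightarrow> \<bar>(\<Sum>i\<in>J. w i * (x i ^ p * y i ^ q)) - (\<integral>z. fst z ^ p * snd z ^ q * H z \<partial>unit_square)\<bar> \<le> \<delta>1) \<longrightarrow>
    (\<Sum>i\<in>J. w i * \<phi> (x i, y i)) \<le> (\<integral>z. \<phi> z * H z \<partial>unit_square) + \<epsilon>\<^sup>2"
    using weak_approximation[OF \<phi>(1) H e2, where R = R] by (elim exE conjE) (rule that)
  obtain m2 \<delta>2 where \<delta>2: "0 < \<delta>2" and w2: "\<forall>(J :: (nat \<times> nat) set) w x y. finite J \<longrightarrow>
    (\<forall>i\<in>J. 0 \<le> w i \<and> \<bar>x i\<bar> \<le> R \<and> \<bar>y i\<bar> \<le> R) \<longrightarrow>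
    (\<forall>p q. p + q \<le> m2 \<longrightarrow> \<bar>(\<Sum>i\<in>J. w i * (x i ^ p * y i ^ q)) - (\<integral>z. fst z ^ p * snd z ^ q * 1 \<partial>unit_square)\<bar> \<le> \<delta>2) \<longrightarrow>
    (\<Sum>i\<in>J. w i * ?\<psi> (x i, y i)) \<le> (\<integral>z. ?\<psi> z * 1 \<partial>unit_square) + \<eta>"
    using weak_approximation[OF \<psi> integrable_const_unit_square[of 1] \<eta>, where R = R] by (elim exE conjE) (rule that)
  \<comment> \<open>Words for the covariance have length p + q + 2 with p + q at most m1, words in D
    alone have length at most m2, and the norm bounds use length 2.\<close>
  define m where "m = m1 + m2 + 2"
  \<comment> \<open>The factor \<open>2 ^ m\<close> pays for undoing the perturbation, and 4 for the
    four words of the covariance; products of moments of D use three of these shares.\<close>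
  define \<gamma> where "\<gamma> = min 1 (min \<delta>1 \<delta>2) / (4 * 2 ^ m)"
  have \<gamma>: "0 < \<gamma>" using \<delta>1 \<delta>2 by (simp add: \<gamma>_def)
  have "4 * (2 ^ m * \<gamma>) = min 1 (min \<delta>1 \<delta>2)" by (simp add: \<gamma>_def)
  then have \<gamma>b: "4 * (2 ^ m * \<gamma>) \<le> 1" "4 * (2 ^ m * \<gamma>) \<le> \<delta>1" "4 * (2 ^ m * \<gamma>) \<le> \<delta>2" by simp_all
  have main: "norm A \<le> \<rho> * sqrt (real k) \<and>
    near_sparse k (a + 2 * \<eta>) (\<epsilon> * (\<rho> * sqrt (real k))) A"
    if k: "1 \<le> k" and As: "As \<in> microstates 5 (perturbed_law 2 1 \<epsilon> \<nu>) R m k \<gamma>"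
      and A: "A = fm k (As ! 0) + cscale \<i> (fm k (As ! 1))" for k As A
  proof -
    let ?e = "complex_of_real \<epsilon>"
    define X where "X = (\<lambda>i. fm k (As ! i))"
    define Y where "Y = (\<lambda>i. if i < 2 then X i - cscale ?e (X (3 + i)) else X i)"
    have sa5: "selfadjoint_mat k (As ! i)" "opnorm_le k (As ! i) R" if "i < 5" for i
      using As that by (auto simp: microstates_def)
    have saX: "adj_fmat (X i) = X i" if "i < 5" for i using adj_fm[OF sa5(1)[OF that]] by (simp add: X_def)
    have bX: "bd k (X i)" for i by (simp add: X_def)
    have bY: "bd k (Y i)" for i by (simp add: Y_def bX bd_diff bd_cscale)
    have saY: "adj_fmat (Y i) = Y i" if "i < 3" for i
      using that saX by (simp add: Y_def adj_diff adj_cscale)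
    have close: "cmod (ftr (foldr (*) (map Y w) (idm k)) / of_nat k - \<mu> w) \<le> 2 ^ m * \<gamma>"
      if w: "set w \<subseteq> {..<3}" "length w \<le> m" for w
    proof -
      have "cmod (ftr (foldr (*) (map Y w) (idm k)) / of_nat k - \<nu> w) \<le> 2 ^ length w * \<gamma>"
        unfolding Y_def X_def by (rule microstates_unperturbed[OF As eps w \<gamma>])
      also have "\<dots> \<le> 2 ^ m * \<gamma>" using w \<gamma> by (intro mult_right_mono power_increasing) auto
      finally show ?thesis by (simp only: ext[OF w(1)])
    qed
    have \<gamma>1: "\<gamma> \<le> 1"
    proof -
      have "1 * \<gamma> \<le> 2 ^ m * \<gamma>" using \<gamma> by (intro mult_right_mono) auto
      then show ?thesis using \<gamma>b(1) \<gamma> by linarith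
    qed
    have nS: "norm (X 3 + cscale \<i> (X 4)) \<le> \<sigma> * sqrt (real k)"
    proof -
      have sq: "(norm (X i))\<^sup>2 \<le> (cmod (\<nu> [i, i]) + 1) * real k" if "i \<in> {3, 4}" for i
      proof (rule norm_sa_le[OF _ k])
        show "adj_fmat (X i) = X i" using that by (intro saX) auto
        have sw: "shift_words ?e \<nu> [i, i] = \<nu> [i, i]" using that by auto
        have "cmod (ftr (foldr (*) (map X [i, i]) (idm k)) / of_nat k - shift_words ?e \<nu> [i, i]) < \<gamma>"
          unfolding X_def using that by (intro microstates_close[OF As]) (auto simp: m_def)
        then have "cmod (ftr (X i * X i) / of_nat k - \<nu> [i, i]) < \<gamma>"
          unfolding sw by (simp add: mult_idm bX)
        then show "cmod (ftr (X i * X i) / of_nat k - \<nu> [i, i]) \<le> 1" using \<gamma>1 by linarith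
      qed
      have "(cmod (\<nu> [3, 3]) + cmod (\<nu> [4, 4]) + 2) * real k = (cmod (\<nu> [3, 3]) + 1) * real k + (cmod (\<nu> [4, 4]) + 1) * real k"
        by (simp add: algebra_simps)
      moreover have "(norm (X 3))\<^sup>2 \<le> (cmod (\<nu> [3, 3]) + 1) * real k" "(norm (X 4))\<^sup>2 \<le> (cmod (\<nu> [4, 4]) + 1) * real k"
        by (rule sq, simp)+
      moreover have "(norm (X 3 + cscale \<i> (X 4)))\<^sup>2 = (norm (X 3))\<^sup>2 + (norm (X 4))\<^sup>2"
        by (intro norm_cplx_sa saX) simp_all
      ultimately have "(norm (X 3 + cscale \<i> (X 4)))\<^sup>2 \<le> (cmod (\<nu> [3, 3]) + cmod (\<nu> [4, 4]) + 2) * real k"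
        by linarith
      then have "norm (X 3 + cscale \<i> (X 4)) \<le> sqrt ((cmod (\<nu> [3, 3]) + cmod (\<nu> [4, 4]) + 2) * real k)"
        by (rule real_le_rsqrt)
      then show ?thesis by (simp add: \<sigma>_def real_sqrt_mult)
    qed
    define B where "B = Y 0 + cscale \<i> (Y 1)"
    have AB: "A = B + \<epsilon> *\<^sub>R (X 3 + cscale \<i> (X 4))"
      by (rule fmat_eqI) (simp add: A B_def Y_def X_def algebra_simps)
    have nB: "norm B \<le> sqrt (cmod (\<mu> [0, 0]) + cmod (\<mu> [1, 1]) + 2) * sqrt (real k)"
    proof -
      have sq: "(norm (Y i))\<^sup>2 \<le> (cmod (\<mu> [i, i]) + 1) * real k" if "i < 2" for i
      proof (rule norm_sa_le[OF _ k])
        show "adj_fmat (Y i) = Y i" using that by (intro saY) auto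
        have "cmod (ftr (foldr (*) (map Y [i, i]) (idm k)) / of_nat k - \<mu> [i, i]) \<le> 2 ^ m * \<gamma>"
          using that by (intro close) (auto simp: m_def)
        then show "cmod (ftr (Y i * Y i) / of_nat k - \<mu> [i, i]) \<le> 1"
          using \<gamma>b(1) \<gamma> by (simp add: mult_idm bY)
      qed
      have "(cmod (\<mu> [0, 0]) + cmod (\<mu> [1, 1]) + 2) * real k = (cmod (\<mu> [0, 0]) + 1) * real k + (cmod (\<mu> [1, 1]) + 1) * real k"
        by (simp add: algebra_simps)
      moreover have "(norm (Y 0))\<^sup>2 \<le> (cmod (\<mu> [0, 0]) + 1) * real k" "(norm (Y 1))\<^sup>2 \<le> (cmod (\<mu> [1, 1]) + 1) * real k"
        by (rule sq, simp)+
      moreover have "(norm B)\<^sup>2 = (norm (Y 0))\<^sup>2 + (norm (Y 1))\<^sup>2"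
        unfolding B_def by (intro norm_cplx_sa saY) simp_all
      ultimately have "(norm B)\<^sup>2 \<le> (cmod (\<mu> [0, 0]) + cmod (\<mu> [1, 1]) + 2) * real k"
        by linarith
      then have "norm B \<le> sqrt ((cmod (\<mu> [0, 0]) + cmod (\<mu> [1, 1]) + 2) * real k)"
        by (rule real_le_rsqrt)
      then show ?thesis by (simp add: real_sqrt_mult)
    qed
    have neS: "norm (\<epsilon> *\<^sub>R (X 3 + cscale \<i> (X 4))) \<le> \<epsilon> * (\<sigma> * sqrt (real k))"
      using nS eps by (simp add: mult_left_mono)
    have \<sigma>0: "0 \<le> \<sigma> * sqrt (real k)" by (simp add: \<sigma>_def)
    have nA: "norm A \<le> \<rho> * sqrt (real k)"
    proof -
      have "\<epsilon> * (\<sigma> * sqrt (real k)) \<le> 1 * (\<sigma> * sqrt (real k))" using eps \<sigma>0 by (intro mult_right_mono) auto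
      then have "norm A \<le> sqrt (cmod (\<mu> [0, 0]) + cmod (\<mu> [1, 1]) + 2) * sqrt (real k) + \<sigma> * sqrt (real k)"
        unfolding AB using norm_triangle_ineq[of B "\<epsilon> *\<^sub>R (X 3 + cscale \<i> (X 4))"] nB neS by linarith
      moreover have "0 \<le> 2 * sqrt (real k)" by simp
      ultimately show ?thesis unfolding \<rho>_def distrib_right by linarith
    qed
    \<comment> \<open>\<open>Y 2\<close> is the microstate of D itself, as only the letters 0 and 1
      are perturbed.\<close>
    obtain U l where U: "unitary_fmat k U" and diag: "adj_fmat U * Y 2 * U = diagf k l"
      using spectral_fmat[OF bY[of 2] saY[of 2, simplified]] by blast
    interpret D: diagonalized k U l Y
      by standard (use U diag bY saY in auto)
    have l: "\<bar>l i\<bar> \<le> R" if "i < k" for i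
    proof (rule D.eigenvalue_bound[OF _ that])
      show "opn (Y 2) \<le> R"
        using sa5[of 2] R by (simp add: Y_def X_def opn_fm_le selfadjoint_mat_def)
    qed
    let ?J = "{..<k} \<times> {..<k}"
    define u where "u = (\<lambda>(i, j). (cmod (ent D.C i j))\<^sup>2 / real k)"
    define x y :: "nat \<times> nat \<Rightarrow> real" where "x = (\<lambda>(i, j). l i)" and "y = (\<lambda>(i, j). l j)"
    have lR: "\<forall>i\<in>?J. \<bar>x i\<bar> \<le> R \<and> \<bar>y i\<bar> \<le> R" using l by (auto simp: x_def y_def)
    have u0: "0 \<le> u i" for i by (simp add: u_def split: prod.split)
    have sum_phi: "(\<Sum>i\<in>?J. u i * \<phi> (x i, y i)) \<le> 2 * \<epsilon>\<^sup>2"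
    proof -
      have "\<bar>(\<Sum>i\<in>?J. u i * (x i ^ p * y i ^ q)) - (\<integral>z. fst z ^ p * snd z ^ q * H z \<partial>unit_square)\<bar> \<le> \<delta>1"
        if pq: "p + q \<le> m1" for p q
      proof -
        define w where "w = (\<lambda>a b. replicate p 2 @ [a] @ replicate q 2 @ [b :: nat])"
        define d where "d a b = ftr (foldr (*) (map Y (w a b)) (idm k)) / of_nat k - \<mu> (w a b)" for a b
        have d: "cmod (d a b) \<le> 2 ^ m * \<gamma>" if "a < 2" "b < 2" for a b
          unfolding d_def using that pq by (intro close) (auto simp: w_def m_def)
        have "(\<Sum>i\<in>?J. u i * (x i ^ p * y i ^ q)) = (\<Sum>(i, j)\<in>?J. (cmod (ent D.C i j))\<^sup>2 * (l i ^ p * l j ^ q)) / real k"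
          unfolding sum_divide_distrib by (intro sum.cong refl) (auto simp: u_def x_def y_def)
        then have "complex_of_real (\<Sum>i\<in>?J. u i * (x i ^ p * y i ^ q))
          = complex_of_real (\<Sum>(i, j)\<in>?J. (cmod (ent D.C i j))\<^sup>2 * (l i ^ p * l j ^ q)) / of_nat k"
          by simp
        then have "complex_of_real (\<Sum>i\<in>?J. u i * (x i ^ p * y i ^ q)) - complex_of_real (\<integral>z. fst z ^ p * snd z ^ q * H z \<partial>unit_square)
          = d 0 0 + d 1 1 + \<i> * (d 1 0 - d 0 1)"
          unfolding D.trace_covariance[symmetric] mu2[symmetric] d_def w_def
          by (simp add: add_divide_distrib diff_divide_distrib algebra_simps)
        from arg_cong[OF this, of cmod, folded of_real_diff, unfolded norm_of_real]
        have "\<bar>(\<Sum>i\<in>?J. u i * (x i ^ p * y i ^ q)) - (\<integral>z. fst z ^ p * snd z ^ q * H z \<partial>unit_square)\<bar>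
          = cmod (d 0 0 + d 1 1 + \<i> * (d 1 0 - d 0 1))" .
        also have "\<dots> \<le> (cmod (d 0 0) + cmod (d 1 1)) + cmod (\<i> * (d 1 0 - d 0 1))"
          by (intro order_trans[OF norm_triangle_ineq] add_mono norm_triangle_ineq order_refl)
        also have "cmod (\<i> * (d 1 0 - d 0 1)) \<le> cmod (d 1 0) + cmod (d 0 1)"
          by (simp add: norm_mult norm_triangle_ineq4)
        finally show ?thesis using d[of 0 0] d[of 1 1] d[of 1 0] d[of 0 1] \<gamma>b(2) by linarith
      qed
      then have "(\<Sum>i\<in>?J. u i * \<phi> (x i, y i)) \<le> (\<integral>z. \<phi> z * H z \<partial>unit_square) + \<epsilon>\<^sup>2"
        using lR u0 by (intro w1[rule_format]) auto
      then show ?thesis using \<phi>(3) by linarith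
    qed
    have sum_psi: "(\<Sum>i\<in>?J. (1 / (real k)\<^sup>2) * ?\<psi> (x i, y i)) \<le> a + 2 * \<eta>"
    proof -
      have "\<bar>(\<Sum>i\<in>?J. (1 / (real k)\<^sup>2) * (x i ^ p * y i ^ q)) - (\<integral>z. fst z ^ p * snd z ^ q * 1 \<partial>unit_square)\<bar> \<le> \<delta>2"
        if pq: "p + q \<le> m2" for p q
      proof -
        define s t where "s p = (\<Sum>i<k. l i ^ p) / real k" and "t p = (\<integral>t. t ^ p \<partial>unit_interval)" for p
        have st: "\<bar>s r - t r\<bar> \<le> 2 ^ m * \<gamma>" if "r \<le> m2" for r
        proof -
          have "cmod (ftr (foldr (*) (map Y (replicate r 2)) (idm k)) / of_nat k - \<mu> (replicate r 2)) \<le> 2 ^ m * \<gamma>"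
            using that by (intro close) (auto simp: m_def)
          then have "cmod (complex_of_real (s r - t r)) \<le> 2 ^ m * \<gamma>"
            unfolding D.trace_replicate mu1 by (simp add: s_def t_def)
          then show ?thesis by (simp only: norm_of_real)
        qed
        have t01: "0 \<le> t r" "t r \<le> 1" for r unfolding t_def by (rule integral_monom_bounds)+
        have "(\<Sum>i\<in>?J. (1 / (real k)\<^sup>2) * (x i ^ p * y i ^ q)) = (\<Sum>i<k. \<Sum>j<k. l i ^ p * l j ^ q) / (real k)\<^sup>2"
          unfolding sum.cartesian_product sum_divide_distrib by (intro sum.cong refl) (auto simp: x_def y_def)
        also have "\<dots> = s p * s q" by (simp add: s_def sum_product power2_eq_square)
        finally have eq: "(\<Sum>i\<in>?J. (1 / (real k)\<^sup>2) * (x i ^ p * y i ^ q)) = s p * s q" .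
        \<comment> \<open>The moments of the uniform weights factor, so the one-variable moments
          suffice. Here |s p| is at most 2, since t p is at most 1 and the tolerance at most
          1/4.\<close>
        have "\<bar>s p * s q - t p * t q\<bar> = \<bar>s p * (s q - t q) + (s p - t p) * t q\<bar>" by (simp add: algebra_simps)
        also have "\<dots> \<le> \<bar>s p\<bar> * \<bar>s q - t q\<bar> + \<bar>s p - t p\<bar> * \<bar>t q\<bar>"
          by (rule order_trans[OF abs_triangle_ineq]) (simp add: abs_mult)
        also have "\<dots> \<le> 2 * (2 ^ m * \<gamma>) + 2 ^ m * \<gamma> * 1"
          using st[of p] st[of q] t01[of p] t01[of q] pq \<gamma>b(1) by (intro add_mono mult_mono) auto
        also have "\<dots> \<le> \<delta>2"
        proof -
          have "0 \<le> 2 ^ m * \<gamma>" using \<gamma> by simp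
          then show ?thesis using \<gamma>b(3) by linarith
        qed
        finally show ?thesis unfolding eq integral_monom2 by (simp add: t_def)
      qed
      then have "(\<Sum>i\<in>?J. (1 / (real k)\<^sup>2) * ?\<psi> (x i, y i)) \<le> (\<integral>z. ?\<psi> z * 1 \<partial>unit_square) + \<eta>"
        using lR by (intro w2[rule_format]) auto
      then show ?thesis using \<phi>(4) by linarith
    qed
    define K where "K = {i \<in> ?J. \<phi> (x i, y i) \<le> 1/2}"
    have cK: "real (card K) \<le> (a + 2 * \<eta>) * (real k)\<^sup>2"
    proof -
      \<comment> \<open>Where \<phi> \<le> 1/2, the function \<open>?\<psi>\<close> equals
        1.\<close>
      have "real (card K) / (real k)\<^sup>2 = (\<Sum>i\<in>?J. if \<phi> (x i, y i) \<le> 1/2 then 1 / (real k)\<^sup>2 else 0)"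
        by (simp add: K_def sum.inter_filter[symmetric])
      also have "\<dots> \<le> (\<Sum>i\<in>?J. (1 / (real k)\<^sup>2) * ?\<psi> (x i, y i))"
        using \<phi>(2) k by (intro sum_mono) (auto simp: field_simps)
      also note sum_psi
      finally show ?thesis using k by (simp only: pos_divide_le_eq zero_less_power of_nat_0_less_iff)
    qed
    have off: "norm (D.C - restr K D.C) \<le> 2 * \<epsilon> * sqrt (real k)"
    proof -
      \<comment> \<open>Off K the factor 2 \<phi> exceeds 1, and the factor k undoes the
        normalization of the weights u.\<close>
      have "(norm (D.C - restr K D.C))\<^sup>2 \<le> (\<Sum>i\<in>?J. 2 * real k * (u i * \<phi> (x i, y i)))"
        unfolding norm_diff_restr_sq[OF D.bdC]
      proof (rule sum_mono)
        fix z assume "z \<in> ?J"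
        then obtain i j where z: "z = (i, j)" and ij: "i \<in> {..<k}" "j \<in> {..<k}" by auto
        let ?c = "(cmod (ent D.C i j))\<^sup>2"
        have eq: "2 * real k * (u (i, j) * \<phi> (x (i, j), y (i, j))) = ?c * (2 * \<phi> (l i, l j))"
          using k by (simp add: u_def x_def y_def)
        have "(if (i, j) \<in> K then 0 else ?c) \<le> 2 * real k * (u (i, j) * \<phi> (x (i, j), y (i, j)))"
        proof (cases "(i, j) \<in> K")
          case True
          then show ?thesis unfolding eq using \<phi>(2)[of "(l i, l j)"] by simp
        next
          case False
          then have "?c * 1 \<le> ?c * (2 * \<phi> (l i, l j))"
            using ij by (intro mult_left_mono) (auto simp: K_def x_def y_def)
          then show ?thesis unfolding eq using False by simp
        qed
        then show "(case z of (i, j) \<Rightarrow> if (i, j) \<in> K then 0 else (cmod (ent D.C i j))\<^sup>2)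
            \<le> 2 * real k * (u z * \<phi> (x z, y z))"
          by (simp only: z prod.case)
      qed
      also have "\<dots> = 2 * real k * (\<Sum>i\<in>?J. u i * \<phi> (x i, y i))" by (rule sum_distrib_left[symmetric])
      also have "\<dots> \<le> 2 * real k * (2 * \<epsilon>\<^sup>2)" using sum_phi by (intro mult_left_mono) auto
      also have "\<dots> = (2 * \<epsilon> * sqrt (real k))\<^sup>2" by (simp add: power_mult_distrib)
      finally show ?thesis by (rule power2_le_imp_le) (use eps in simp)
    qed
    \<comment> \<open>The perturbation need not be sparse in the eigenbasis, but its norm is of
      order \<epsilon> sqrt k, so it only adds \<sigma> to the constant of the error.\<close>
    let ?N = "\<epsilon> *\<^sub>R (X 3 + cscale \<i> (X 4))"
    let ?N' = "adj_fmat U * ?N * U"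
    have conj: "adj_fmat U * A * U = D.C + ?N'"
      unfolding AB D.C_def B_def[symmetric] by (simp only: distrib_left distrib_right)
    have split: "adj_fmat U * A * U - restr K (adj_fmat U * A * U) = (D.C - restr K D.C) + (?N' - restr K ?N')"
      unfolding conj by (rule fmat_eqI) (simp add: ent_restr)
    have "opn U \<le> 1" by (rule opn_unitary_le[OF U])
    then have "norm ?N' \<le> norm ?N" by (intro norm_sandwich_le) simp_all
    then have "norm (?N' - restr K ?N') \<le> \<epsilon> * (\<sigma> * sqrt (real k))"
      using norm_diff_restr_le[of ?N' K] neS by linarith
    then have "norm (adj_fmat U * A * U - restr K (adj_fmat U * A * U)) \<le> 2 * \<epsilon> * sqrt (real k) + \<epsilon> * (\<sigma> * sqrt (real k))"
      unfolding split using norm_triangle_ineq[of "D.C - restr K D.C" "?N' - restr K ?N'"] off by linarith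
    also have "\<dots> = \<epsilon> * ((\<sigma> + 2) * sqrt (real k))" by (simp add: algebra_simps)
    also have "\<dots> \<le> \<epsilon> * (\<rho> * sqrt (real k))"
      using eps by (intro mult_left_mono mult_right_mono) (simp_all add: \<rho>_def)
    finally have "norm (adj_fmat U * A * U - restr K (adj_fmat U * A * U)) \<le> \<epsilon> * (\<rho> * sqrt (real k))" .
    moreover have "K \<subseteq> ?J" by (auto simp: K_def)
    ultimately show ?thesis unfolding near_sparse_def using nA U cK by blast
  qed
  show ?thesis
  proof (intro exI[of _ m] exI[of _ \<gamma>] conjI[OF \<gamma>] allI impI ballI, goal_cases)
    case (1 k As)
    show ?case by (rule main[OF 1 refl])
  qed
qed

section \<open>From covers to the bound for \<open>chi\<close>\<close>

lemma exp_half_sqrt_power: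
  assumes "0 < s" shows "(exp (1/2) * sqrt s) ^ (2 * n) = exp (real n * (1 + ln s))"
proof -
  have "(exp (1/2) * sqrt s)\<^sup>2 = exp (1 + ln s)"
    using assms by (simp add: power_mult_distrib exp_add flip: exp_of_nat_mult)
  then show ?thesis by (simp add: power_mult flip: exp_of_nat_mult)
qed

text \<open>The first bound takes the logarithm of the size of the cover in
  \<open>sparse_orbit_cover\<close> times the volume of a ball, divided by k^2; the coefficient of
  |ln \<epsilon>| is 1 + 2 b - 2. The second covers all microstates by a single ball about 0, whose
  radius is of order sqrt k uniformly in \<epsilon> below 1.\<close>

lemma chi_perturbed_le:
  fixes H :: "real \<times> real \<Rightarrow> real"
  assumes \<mu>: "law_with_density \<mu> H"
    and ext: "\<And>w. set w \<subseteq> {..<3} \<Longrightarrow> \<nu> w = \<mu> w"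
    and H: "integrable unit_square H" and nn: "AE p in unit_square. 0 \<le> H p"
    and \<eta>: "0 < \<eta>"
  shows "\<exists>c. \<forall>\<epsilon>. 0 < \<epsilon> \<and> \<epsilon> < 1 \<longrightarrow> chi 2 3 (perturbed_law 2 1 \<epsilon> \<nu>) \<le> ereal (c + (2 * measure lebesgue (supp H) - 1 + \<eta>) * \<bar>ln \<epsilon>\<bar>)"
    and "\<exists>c. \<forall>\<epsilon>. 0 < \<epsilon> \<and> \<epsilon> < 1 \<longrightarrow> chi 2 3 (perturbed_law 2 1 \<epsilon> \<nu>) \<le> ereal c"
proof -
  define a where "a = measure lebesgue (supp H)"
  \<comment> \<open>Two tolerances \<eta>/4, one for the area of the neighbourhood of the support
    and one for the moment approximation, make 2 b equal to 2 a + \<eta>.\<close>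
  define b where "b = a + 2 * (\<eta> / 4)"
  have b: "0 \<le> b" using \<eta> by (simp add: b_def a_def)
  define \<sigma> where "\<sigma> = sqrt (cmod (\<nu> [3, 3]) + cmod (\<nu> [4, 4]) + 2)"
  define \<rho> where "\<rho> = sqrt (cmod (\<mu> [0, 0]) + cmod (\<mu> [1, 1]) + 2) + \<sigma> + 2"
  have "0 \<le> \<sigma>" by (simp add: \<sigma>_def)
  then have \<rho>: "0 < \<rho>" by (simp add: \<rho>_def add_nonneg_pos)
  define c where "c = ln 150 + 2 * b * ln 3 + 1 + ln (64 * pi * \<rho>\<^sup>2)"
  define c' where "c' = 1 + ln (4 * pi * \<rho>\<^sup>2)"
  have struct: "\<exists>m. \<exists>\<gamma>>0. \<forall>k\<ge>1. \<forall>As\<in>microstates 5 (perturbed_law 2 1 \<epsilon> \<nu>) R m k \<gamma>.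
    norm (fm k (As ! 0) + cscale \<i> (fm k (As ! 1))) \<le> \<rho> * sqrt (real k) \<and>
    near_sparse k b (\<epsilon> * (\<rho> * sqrt (real k))) (fm k (As ! 0) + cscale \<i> (fm k (As ! 1)))"
    if eps: "0 < \<epsilon>" "\<epsilon> < 1" and R: "0 < R" for \<epsilon> R
  proof -
    have "0 < \<eta> / 4" "0 < \<epsilon>\<^sup>2" using \<eta> eps by simp_all
    from separating_function[OF H nn this] obtain \<phi> where \<phi>: "continuous_on UNIV \<phi>" "\<And>z. 0 \<le> \<phi> z \<and> \<phi> z \<le> 1"
      "(\<integral>z. \<phi> z * H z \<partial>unit_square) \<le> \<epsilon>\<^sup>2"
      "(\<integral>z. min 1 (2 * (1 - \<phi> z)) * 1 \<partial>unit_square) \<le> a + \<eta> / 4"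
      unfolding a_def supp_def by (elim exE conjE) blast
    show ?thesis unfolding \<rho>_def \<sigma>_def b_def
      by (rule microstate_structure[OF \<mu> ext H \<phi> eps(1) less_imp_le[OF eps(2)] _ R]) (use \<eta> in simp_all)
  qed
  have pres: "\<exists>As\<in>microstates 5 P R m k \<gamma>. As ! 0 = A \<and> As ! 1 = B"
    if AB: "[A, B] \<in> microstates_pres 2 3 P R m k \<gamma>" for A B P R m k \<gamma>
  proof -
    obtain Bs where "[A, B] @ Bs \<in> microstates (2 + 3) P R m k \<gamma>" using AB by (auto simp: microstates_pres_def)
    then show ?thesis by (intro bexI[of _ "[A, B] @ Bs"]) simp_all
  qed
  have B: "chi 2 3 (perturbed_law 2 1 \<epsilon> \<nu>) \<le> ereal (c + (2 * a - 1 + \<eta>) * \<bar>ln \<epsilon>\<bar>)"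
    if eps: "0 < \<epsilon>" "\<epsilon> < 1" for \<epsilon>
  proof (rule chi_le)
    fix R :: real assume "0 < R"
    from struct[OF eps this] obtain m \<gamma> where \<gamma>: "0 < \<gamma>"
      and st: "\<forall>k\<ge>1. \<forall>As\<in>microstates 5 (perturbed_law 2 1 \<epsilon> \<nu>) R m k \<gamma>.
    norm (fm k (As ! 0) + cscale \<i> (fm k (As ! 1))) \<le> \<rho> * sqrt (real k) \<and>
    near_sparse k b (\<epsilon> * (\<rho> * sqrt (real k))) (fm k (As ! 0) + cscale \<i> (fm k (As ! 1)))"
      by (elim exE conjE) (rule that)
    have "mat_vol 2 k (microstates_pres 2 3 (perturbed_law 2 1 \<epsilon> \<nu>) R m k \<gamma>)
        \<le> ennreal (exp ((real k)\<^sup>2 * (c + (2 * a - 1 + \<eta>) * \<bar>ln \<epsilon>\<bar> - ln (real k))))" if k: "1 \<le> k" for k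
    proof -
      let ?r = "\<rho> * sqrt (real k)"
      have r: "0 < ?r" using \<rho> k by simp
      from sparse_orbit_cover[OF r eps(1) less_imp_le[OF eps(2)] b, of k]
      obtain F where F: "finite F \<and> real (card F) \<le> (150 / \<epsilon>) ^ (k\<^sup>2) * (3 / \<epsilon>) powr (2 * b * (real k)\<^sup>2) \<and>
        (\<forall>A. bd k A \<longrightarrow> norm A \<le> ?r \<longrightarrow> near_sparse k b (\<epsilon> * ?r) A \<longrightarrow> (\<exists>X\<in>F. norm (A - X) \<le> 4 * \<epsilon> * ?r))"
        by (rule exE)
      have cov: "\<exists>X\<in>F. norm (fm k A + cscale \<i> (fm k B) - X) \<le> 4 * \<epsilon> * ?r"
        if AB: "[A, B] \<in> microstates_pres 2 3 (perturbed_law 2 1 \<epsilon> \<nu>) R m k \<gamma>" for A B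
      proof -
        obtain As where As: "As \<in> microstates 5 (perturbed_law 2 1 \<epsilon> \<nu>) R m k \<gamma>" "As ! 0 = A" "As ! 1 = B"
          using pres[OF AB] by blast
        let ?A = "fm k A + cscale \<i> (fm k B)"
        have bA: "bd k ?A" by (simp add: bd_add bd_cscale)
        from st[rule_format, OF k As(1), unfolded As(2,3)] bA show ?thesis using F by simp
      qed
      \<comment> \<open>The 64 is 8^2: a factor 4 comes from the radius of the cover and a factor 2
        from the recentering in \<open>mat_vol_le\<close>.\<close>
      let ?s = "64 * pi * \<epsilon>\<^sup>2 * \<rho>\<^sup>2 / real k"
      have s: "0 < ?s" using eps \<rho> k by simp
      have s_eq: "2 * pi * ((2 * (4 * \<epsilon> * ?r))\<^sup>2 / (2 * (real k)\<^sup>2)) = ?s"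
        using k by (simp add: power_mult_distrib field_simps power2_eq_square[of "real k"])
      have "mat_vol 2 k (microstates_pres 2 3 (perturbed_law 2 1 \<epsilon> \<nu>) R m k \<gamma>)
        \<le> ennreal (real (card F) * (exp (1/2) * sqrt (2 * pi * ((2 * (4 * \<epsilon> * ?r))\<^sup>2 / (2 * (real k)\<^sup>2)))) ^ (2 * k\<^sup>2))"
        using k r eps by (intro mat_vol_le[OF _ _ conjunct1[OF F] cov]) simp_all
      also have "\<dots> \<le> ennreal (exp ((real k)\<^sup>2 * (c + (2 * a - 1 + \<eta>) * \<bar>ln \<epsilon>\<bar> - ln (real k))))"
      proof (rule ennreal_leI)
        have 1: "(150 / \<epsilon>) ^ (k\<^sup>2) = exp ((real k)\<^sup>2 * ln (150 / \<epsilon>))"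
          using eps exp_of_nat_mult[of "k\<^sup>2" "ln (150 / \<epsilon>)"] by simp
        have 2: "(3 / \<epsilon>) powr (2 * b * (real k)\<^sup>2) = exp (2 * b * (real k)\<^sup>2 * ln (3 / \<epsilon>))"
          using eps by (simp add: powr_def)
        have "real (card F) * (exp (1/2) * sqrt ?s) ^ (2 * k\<^sup>2)
          \<le> (exp ((real k)\<^sup>2 * ln (150 / \<epsilon>)) * exp (2 * b * (real k)\<^sup>2 * ln (3 / \<epsilon>))) * exp (real (k\<^sup>2) * (1 + ln ?s))"
          unfolding exp_half_sqrt_power[OF s] using F unfolding 1 2 by (intro mult_right_mono) simp_all
        also have "\<dots> = exp ((real k)\<^sup>2 * (ln (150 / \<epsilon>) + 2 * b * ln (3 / \<epsilon>) + (1 + ln ?s)))"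
          unfolding exp_add[symmetric] by (simp add: algebra_simps)
        also have "ln (150 / \<epsilon>) + 2 * b * ln (3 / \<epsilon>) + (1 + ln ?s) = c + (2 * a - 1 + \<eta>) * \<bar>ln \<epsilon>\<bar> - ln (real k)"
        proof -
          have l1: "ln ?s = ln (64 * pi * \<rho>\<^sup>2) + 2 * ln \<epsilon> - ln (real k)"
          proof -
            have "ln ?s = ln ((64 * pi * \<rho>\<^sup>2) * \<epsilon>\<^sup>2 / real k)" by (simp add: mult_ac)
            also have "\<dots> = ln (64 * pi * \<rho>\<^sup>2) + ln (\<epsilon>\<^sup>2) - ln (real k)"
              using eps \<rho> k by (subst ln_div; (subst ln_mult)?; simp)
            also have "ln (\<epsilon>\<^sup>2) = 2 * ln \<epsilon>" using eps by (simp add: ln_realpow)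
            finally show ?thesis .
          qed
          have l2: "ln (150 / \<epsilon>) = ln 150 - ln \<epsilon>" "ln (3 / \<epsilon>) = ln 3 - ln \<epsilon>" using eps by (simp_all add: ln_div)
          have l3: "\<bar>ln \<epsilon>\<bar> = - ln \<epsilon>" using eps by simp
          show ?thesis unfolding l1 l2 l3 c_def b_def by (simp add: algebra_simps)
        qed
        finally show "real (card F) * (exp (1/2) * sqrt (2 * pi * ((2 * (4 * \<epsilon> * ?r))\<^sup>2 / (2 * (real k)\<^sup>2)))) ^ (2 * k\<^sup>2)
          \<le> exp ((real k)\<^sup>2 * (c + (2 * a - 1 + \<eta>) * \<bar>ln \<epsilon>\<bar> - ln (real k)))"
          unfolding s_eq .
      qed
      finally show ?thesis .
    qed
    then show "\<exists>m. \<exists>\<gamma>>0. \<forall>k\<ge>1. mat_vol 2 k (microstates_pres 2 3 (perturbed_law 2 1 \<epsilon> \<nu>) R m k \<gamma>)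
        \<le> ennreal (exp ((real k)\<^sup>2 * (c + (2 * a - 1 + \<eta>) * \<bar>ln \<epsilon>\<bar> - ln (real k))))"
      using \<gamma> by (intro exI[of _ m] exI[of _ \<gamma>]) simp
  qed
  have A: "chi 2 3 (perturbed_law 2 1 \<epsilon> \<nu>) \<le> ereal c'" if eps: "0 < \<epsilon>" "\<epsilon> < 1" for \<epsilon>
  proof (rule chi_le)
    fix R :: real assume "0 < R"
    from struct[OF eps this] obtain m \<gamma> where \<gamma>: "0 < \<gamma>"
      and st: "\<And>k As. 1 \<le> k \<Longrightarrow> As \<in> microstates 5 (perturbed_law 2 1 \<epsilon> \<nu>) R m k \<gamma> \<Longrightarrow>
        norm (fm k (As ! 0) + cscale \<i> (fm k (As ! 1))) \<le> \<rho> * sqrt (real k)"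
      by blast
    have "mat_vol 2 k (microstates_pres 2 3 (perturbed_law 2 1 \<epsilon> \<nu>) R m k \<gamma>)
        \<le> ennreal (exp ((real k)\<^sup>2 * (c' - ln (real k))))" if k: "1 \<le> k" for k
    proof -
      let ?r = "\<rho> * sqrt (real k)" and ?s = "4 * pi * \<rho>\<^sup>2 / real k"
      have r: "0 < ?r" using \<rho> k by simp
      have s: "0 < ?s" using \<rho> k by simp
      have s_eq: "2 * pi * ((2 * ?r)\<^sup>2 / (2 * (real k)\<^sup>2)) = ?s"
        using k by (simp add: power_mult_distrib field_simps power2_eq_square[of "real k"])
      have cov: "\<exists>X\<in>{0}. norm (fm k A + cscale \<i> (fm k B) - X) \<le> ?r"
        if AB: "[A, B] \<in> microstates_pres 2 3 (perturbed_law 2 1 \<epsilon> \<nu>) R m k \<gamma>" for A B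
        using pres[OF AB] st[OF k] by auto
      have "mat_vol 2 k (microstates_pres 2 3 (perturbed_law 2 1 \<epsilon> \<nu>) R m k \<gamma>)
        \<le> ennreal (real (card {0 :: fmat}) * (exp (1/2) * sqrt (2 * pi * ((2 * ?r)\<^sup>2 / (2 * (real k)\<^sup>2)))) ^ (2 * k\<^sup>2))"
        using k r by (intro mat_vol_le[OF _ _ _ cov]) simp_all
      also have "\<dots> = ennreal (exp (real (k\<^sup>2) * (1 + ln ?s)))"
        unfolding s_eq exp_half_sqrt_power[OF s] by simp
      also have "1 + ln ?s = c' - ln (real k)" using \<rho> k by (simp add: c'_def ln_div)
      finally show ?thesis by simp
    qed
    then show "\<exists>m. \<exists>\<gamma>>0. \<forall>k\<ge>1. mat_vol 2 k (microstates_pres 2 3 (perturbed_law 2 1 \<epsilon> \<nu>) R m k \<gamma>)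
        \<le> ennreal (exp ((real k)\<^sup>2 * (c' - ln (real k))))"
      using \<gamma> by (intro exI[of _ m] exI[of _ \<gamma>]) simp
  qed
  show "\<exists>c. \<forall>\<epsilon>. 0 < \<epsilon> \<and> \<epsilon> < 1 \<longrightarrow> chi 2 3 (perturbed_law 2 1 \<epsilon> \<nu>) \<le> ereal (c + (2 * measure lebesgue (supp H) - 1 + \<eta>) * \<bar>ln \<epsilon>\<bar>)"
    using B unfolding a_def by (intro exI[of _ c] allI impI) simp
  show "\<exists>c. \<forall>\<epsilon>. 0 < \<epsilon> \<and> \<epsilon> < 1 \<longrightarrow> chi 2 3 (perturbed_law 2 1 \<epsilon> \<nu>) \<le> ereal c"
    using A by (intro exI[of _ c'] allI impI) simp
qed

theorem theorem3p3:
  fixes M :: "('h::chilbert_space \<Rightarrow> 'h) set"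
    and \<tau> :: "('h \<Rightarrow> 'h) \<Rightarrow> complex"
    and \<iota> :: "(real \<Rightarrow> complex) \<Rightarrow> ('h \<Rightarrow> 'h)"
    and E :: "('h \<Rightarrow> 'h) \<Rightarrow> ('h \<Rightarrow> 'h)"
    and H :: "real \<times> real \<Rightarrow> real"
    and Z\<^sub>H D :: "'h \<Rightarrow> 'h"
  assumes "tracial_vN_algebra M \<tau>"
    and "Linf_copy M \<tau> \<iota>"
    and "cond_expectation M \<tau> (\<iota> ` Linf) E"
    and "integrable (lebesgue_on ({0..1} \<times> {0..1})) H"
    and "AE p in lebesgue_on ({0..1} \<times> {0..1}). 0 \<le> H p"
    and "ess_bounded (CE1 H)"
    and "ess_bounded (CE2 H)"
    and "A_circular M \<iota> E Z\<^sub>H (alpha H) (beta H)"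
    and "D = \<iota> (\<lambda>t. complex_of_real t)"
  shows "delta0_nonsa \<tau> Z\<^sub>H [D] \<le> ereal (min 2 (1 + 2 * measure lebesgue (supp H)))"
proof -
  let ?\<mu> = "law_of \<tau> [op_Re Z\<^sub>H, op_Im Z\<^sub>H, D]"
  let ?a = "measure lebesgue (supp H)"
  have \<mu>: "law_with_density ?\<mu> H"
    unfolding law_with_density_def Let_def
    by (intro conjI allI law_D[OF assms(1-6,8,9)] law_covariance[OF assms(1-6,8,9)])
  have "delta0_law 2 1 ?\<mu> \<le> ereal (min 2 (1 + 2 * ?a))"
    unfolding delta0_law_def
  proof (rule SUP_least)
    fix \<nu> assume "\<nu> \<in> {\<nu>. semicircular_extension 2 1 ?\<mu> \<nu>}"
    then have ext: "\<nu> w = ?\<mu> w" if "set w \<subseteq> {..<3}" for w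
      using that by (simp add: semicircular_extension_def)
    note chi = chi_perturbed_le[OF \<mu> _ assms(4,5), of \<nu>]
    let ?L = "Limsup (at_right 0) (\<lambda>\<epsilon>. chi 2 3 (perturbed_law 2 1 \<epsilon> \<nu>) / ereal \<bar>ln \<epsilon>\<bar>)"
    have "?L \<le> ereal (2 * ?a - 1)" by (rule Limsup_div_ln_le, rule chi(1)) (rule ext)
    \<comment> \<open>The single-ball bound has no |ln \<epsilon>| term, so any \<eta> > 0 is
      admissible with the constant alone; this is the source of the 2 in the minimum.\<close>
    moreover have "?L \<le> ereal 0"
    proof (rule Limsup_div_ln_le)
      fix \<eta> :: real assume \<eta>: "0 < \<eta>"
      have "\<exists>c. \<forall>\<epsilon>. 0 < \<epsilon> \<and> \<epsilon> < 1 \<longrightarrow> chi 2 3 (perturbed_law 2 1 \<epsilon> \<nu>) \<le> ereal c"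
        using ext \<eta> by (rule chi(2))
      then obtain c where c: "\<forall>\<epsilon>. 0 < \<epsilon> \<and> \<epsilon> < 1 \<longrightarrow> chi 2 3 (perturbed_law 2 1 \<epsilon> \<nu>) \<le> ereal c"
        by (rule exE)
      show "\<exists>c. \<forall>\<epsilon>. 0 < \<epsilon> \<and> \<epsilon> < 1 \<longrightarrow> chi 2 3 (perturbed_law 2 1 \<epsilon> \<nu>) \<le> ereal (c + (0 + \<eta>) * \<bar>ln \<epsilon>\<bar>)"
      proof (intro exI[of _ c] allI impI)
        fix \<epsilon> :: real assume "0 < \<epsilon> \<and> \<epsilon> < 1"
        then have "chi 2 3 (perturbed_law 2 1 \<epsilon> \<nu>) \<le> ereal c" using c by simp
        also have "ereal c \<le> ereal (c + (0 + \<eta>) * \<bar>ln \<epsilon>\<bar>)" using \<eta> by simp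
        finally show "chi 2 3 (perturbed_law 2 1 \<epsilon> \<nu>) \<le> ereal (c + (0 + \<eta>) * \<bar>ln \<epsilon>\<bar>)" .
      qed
    qed
    ultimately have "?L \<le> ereal (min (2 * ?a - 1) 0)" by (simp add: min_def)
    then have "ereal (real 2) + ?L \<le> ereal (real 2) + ereal (min (2 * ?a - 1) 0)" by (rule add_left_mono)
    also have "\<dots> = ereal (min 2 (1 + 2 * ?a))" by (simp add: min_def)
    finally have le: "ereal (real 2) + ?L \<le> ereal (min 2 (1 + 2 * ?a))" .
    have three: "(1 :: nat) + 2 = 3" by simp
    show "ereal (real 2) + Limsup (at_right 0) (\<lambda>\<epsilon>. chi 2 (1 + 2) (perturbed_law 2 1 \<epsilon> \<nu>) / ereal \<bar>ln \<epsilon>\<bar>)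
      \<le> ereal (min 2 (1 + 2 * ?a))" unfolding three by (rule le)
  qed
  moreover have "delta0_nonsa \<tau> Z\<^sub>H [D] = delta0_law 2 1 ?\<mu>"
    by (simp add: delta0_nonsa_def delta0_def numeral_2_eq_2)
  ultimately show ?thesis by simp
qed

end
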